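(* Let $n\ge1$, let $m\ge0$ be an integer, let $0<\alpha\le2$, and set $s:=m+\frac{\alpha}{2}$; assume $0<s<\frac n2$. Let $0<\sigma<n$, $0<p\le\frac{2n-\sigma}{n-2s}$ and $0<q\le\frac{n+2s-\sigma}{n-2s}$. Suppose $u\in C(\mathbb{R}^{n})$ is a nonnegative solution of the integral equation $$u(x)=\int_{\mathbb{R}^n}\frac{R_{2s,n}}{|x-y|^{n-2s}}\left(\int_{\mathbb{R}^{n}}\frac{1}{|y-z|^{\sigma}}u^p(z)\,dz\right)u^{q}(y)\,dy,\qquad x\in\mathbb{R}^n.$$ (1) In the critical case $p=\frac{2n-\sigma}{n-2s}$ and $q=\frac{n+2s-\sigma}{n-2s}$, either $u\equiv0$ or $u$ has the form $$u(x)=\mu^{\frac{n-2s}{2}}Q\left(\mu(x-x_{0})\right)\qquad\text{for some }\mu>0\text{ and }x_{0}\in\mathbb{R}^{n},$$ where $$Q(x)=\left(\frac{1}{R_{2s,n}\,I\left(\frac{\sigma}{2}\right)I\left(\frac{n-2s}{2}\right)}\right)^{\frac{n-2s}{2(n+2s-\sigma)}}\left(\frac{1}{1+|x|^{2}}\right)^{\frac{n-2s}{2}}.$$ (2) In the subcritical cases, i.e. $0<p<\frac{2n-\sigma}{n-2s}$ or $0<q<\frac{n+2s-\sigma}{n-2s}$, the unique nonnegative solution is $u\equiv0$ in $\mathbb{R}^{n}$.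
   Context: $R_{\gamma,n}:=\frac{\Gamma(\frac{n-\gamma}{2})}{\pi^{\frac{n}{2}}2^{\gamma}\Gamma(\frac{\gamma}{2})}$ for $0<\gamma<n$, and $I(\gamma):=\frac{\pi^{\frac{n}{2}}\Gamma\left(\frac{n-2\gamma}{2}\right)}{\Gamma(n-\gamma)}$ for $0<\gamma<\frac{n}{2}$. A solution of the integral equation is a function satisfying it at every $x\in\mathbb{R}^n$. *)

theory Defs
  imports "HOL-Analysis.Analysis"
begin

definition riesz_const :: "real \<Rightarrow> nat \<Rightarrow> real" where
  "riesz_const \<gamma> n =
     Gamma ((real n - \<gamma>) / 2) / (pi powr (real n / 2) * 2 powr \<gamma> * Gamma (\<gamma> / 2))"

definition bubble_const :: "real \<Rightarrow> nat \<Rightarrow> real" where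
  "bubble_const \<gamma> n = pi powr (real n / 2) * Gamma ((real n - 2 * \<gamma>) / 2) / Gamma (real n - \<gamma>)"

text \<open>
  The dimension is the cardinality of the index type. Both integrals are Lebesgue integrals
  of nonnegative functions with values in [0, \<infinity>], so the equation at a point x includes
  the finiteness of the right-hand side. The predicate is meant for nonnegative u only, since
  the coercion to extended nonnegative reals truncates negative values. At coinciding points
  the kernels take the value 0 (division by zero), which affects null sets only.
\<close>

definition hartree_integral_solution ::
  "real \<Rightarrow> real \<Rightarrow> real \<Rightarrow> real \<Rightarrow> (real ^ 'n \<Rightarrow> real) \<Rightarrow> bool" where
  "hartree_integral_solution s \<sigma> p q u \<longleftrightarrow>
     (\<forall>x. ennreal (u x) =
        (\<integral>\<^sup>+ y. ennreal (riesz_const (2 * s) CARD('n) / norm (x - y) powr (real CARD('n) - 2 * s))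
               * (\<integral>\<^sup>+ z. ennreal (1 / norm (y - z) powr \<sigma> * u z powr p) \<partial>lborel)
               * ennreal (u y powr q) \<partial>lborel))"

definition Q_profile :: "real \<Rightarrow> real \<Rightarrow> real ^ 'n \<Rightarrow> real" where
  "Q_profile s \<sigma> x =
     (1 / (riesz_const (2 * s) CARD('n) * bubble_const (\<sigma> / 2) CARD('n)
           * bubble_const ((real CARD('n) - 2 * s) / 2) CARD('n)))
       powr ((real CARD('n) - 2 * s) / (2 * (real CARD('n) + 2 * s - \<sigma>)))
     * (1 / (1 + (norm x)\<^sup>2)) powr ((real CARD('n) - 2 * s) / 2)"

end

theory Submission
  imports Defs "HOL-Probability.Distributions"
begin

text \<open>
  The argument is a pointwise version of the method of moving spheres. Write \<open>\<nu> = n - 2s\<close> and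
  \<open>u\<^sub>r\<close> for the Kelvin transform \<open>(r/|y-c|)\<^sup>\<nu> u(c + r\<^sup>2(y-c)/|y-c|\<^sup>2)\<close>. Folding the two Riesz
  potentials of the equation along the sphere \<open>|y-c| = r\<close> turns an upper bound for \<open>u\<^sub>r/u\<close> on the set
  \<open>{|y-c| > r, u\<^sub>r > u}\<close> into a strictly better one as soon as that set is small, whatever the sizes of
  the exponents, so the set is empty. This starts the spheres and moves them on unless
  \<open>u\<^sub>r = u\<close>, which forces both exponents to be critical. If no sphere ever stopped, \<open>u\<close> would be constant,
  which is impossible. Otherwise \<open>|y|\<^sup>\<nu> u(y)\<close> has a limit \<open>L > 0\<close> at infinity, around every centre \<open>x\<close> the
  spheres stop at the radius with \<open>r\<^sup>2 = \<phi>(x) = (L/u(x))\<^sup>2\<^sup>/\<^sup>\<nu>\<close>, and the resulting functional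
  equation for \<open>\<phi>\<close> has only the solutions \<open>d + |x-x\<^sub>0|\<^sup>2\<close>.
\<close>

section \<open>Inversions in spheres\<close>

text \<open>Why ratios: differences u_r - u would have to pass through u^p and u^q, and linearising
  these produces u^(p-1) and u^(q-1), singular for exponents below 1. A ratio passes through
  unharmed: u_r \<le> \<theta> u gives u_r^p \<le> \<theta>^p u^p for every p > 0. The price is that
  the error caused by the bad set must be small relative to the potential itself, uniformly in the
  evaluation point up to infinity. For subsets of a fixed ball this is possible, since the full
  potential decays no faster than |x|^-\<gamma>, the rate of a potential of a bounded set; hence the
  bad set is always confined to a ball before its measure is used. Nothing but continuity of u is
  known in advance. Local integrability of the kernels, local boundedness of the inner potential and
  the lower decay bound for u are all extracted from the equation. Infinity is made compact by z =
  (y-c)/|y-c|^2: there |y-c|^\<nu> u_t(y) = t^\<nu> u(c + t^2 z), which is continuous up to z =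
  0.\<close>

lemma nn_integral_affine_euclidean:
  fixes f :: "'a::euclidean_space \<Rightarrow> ennreal"
  assumes [measurable]: "f \<in> borel_measurable borel" and c: "c > 0"
  shows "(\<integral>\<^sup>+x. f x \<partial>lborel) = ennreal (c ^ DIM('a)) * (\<integral>\<^sup>+x. f (t + c *\<^sub>R x) \<partial>lborel)"
  using c by (subst lborel_affine[of c t])
     (simp_all add: nn_integral_density nn_integral_distr nn_integral_cmult)

text \<open>The measure \<open>|x|\<^sup>-\<^sup>n dx\<close> is invariant under dilations, so it disintegrates over the orbits
  \<open>t \<mapsto> e\<^sup>t y\<close> with \<open>y\<close> ranging over a fundamental annulus.\<close>

lemma nn_integral_dilation_orbits:
  fixes f :: "'a::euclidean_space \<Rightarrow> ennreal"
  assumes [measurable]: "f \<in> borel_measurable borel"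
  shows "(\<integral>\<^sup>+x. ennreal (1 / norm x ^ DIM('a)) * f x \<partial>lborel)
    = (\<integral>\<^sup>+y. ennreal (1 / norm y ^ DIM('a)) * indicator {1..exp 1} (norm y)
          * (\<integral>\<^sup>+t. f (exp t *\<^sub>R y) \<partial>lborel) \<partial>lborel)"
proof -
  define g where "g x = ennreal (1 / norm x ^ DIM('a)) * f x" for x
  have [measurable]: "g \<in> borel_measurable borel" unfolding g_def by measurable
  let ?i = "\<lambda>x. indicator {1..exp 1} (norm x) :: ennreal"
  \<comment> \<open>The times at which the dilated point lies in the annulus form an interval of
    length ln e - ln 1 = 1.\<close>
  have one: "(\<integral>\<^sup>+t. ?i (exp (-t) *\<^sub>R x) \<partial>lborel) = 1" if "x \<noteq> 0" for x :: 'a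
  proof -
    have "?i (exp (-t) *\<^sub>R x) = indicator {ln (norm x) - 1..ln (norm x)} t" for t
    proof -
      have x: "norm x = exp (ln (norm x))" using that by simp
      have "norm (exp (-t) *\<^sub>R x) = exp (ln (norm x) - t)"
        by (subst norm_scaleR, subst x) (simp add: exp_diff exp_minus field_simps)
      then show ?thesis by (auto simp: indicator_def)
    qed
    then show ?thesis by simp
  qed
  have "(\<integral>\<^sup>+x. g x \<partial>lborel) = (\<integral>\<^sup>+x. g x * (\<integral>\<^sup>+t. ?i (exp (-t) *\<^sub>R x) \<partial>lborel) \<partial>lborel)"
  proof (rule nn_integral_cong)
    fix x show "g x = g x * (\<integral>\<^sup>+t. ?i (exp (-t) *\<^sub>R x) \<partial>lborel)"
    proof (cases "x = 0")
      case False
      show ?thesis unfolding one[OF False] by simp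
    qed (simp add: g_def)
  qed
  also have "\<dots> = (\<integral>\<^sup>+x. (\<integral>\<^sup>+t. g x * ?i (exp (-t) *\<^sub>R x) \<partial>lborel) \<partial>lborel)"
    by (intro nn_integral_cong nn_integral_cmult[symmetric]) measurable
  also have "\<dots> = (\<integral>\<^sup>+t. (\<integral>\<^sup>+x. g x * ?i (exp (-t) *\<^sub>R x) \<partial>lborel) \<partial>lborel)"
    by (rule lborel_pair.Fubini') measurable
  also have "\<dots> = (\<integral>\<^sup>+t. (\<integral>\<^sup>+y. ennreal (1 / norm y ^ DIM('a)) * ?i y * f (exp t *\<^sub>R y) \<partial>lborel) \<partial>lborel)"
  proof (rule nn_integral_cong)
    fix t :: real
    have "(\<integral>\<^sup>+x. g x * ?i (exp (-t) *\<^sub>R x) \<partial>lborel)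
      = ennreal (exp t ^ DIM('a)) * (\<integral>\<^sup>+y. g (0 + exp t *\<^sub>R y) * ?i (exp (-t) *\<^sub>R (0 + exp t *\<^sub>R y)) \<partial>lborel)"
      by (rule nn_integral_affine_euclidean) auto
    also have "\<dots> = (\<integral>\<^sup>+y. ennreal (exp t ^ DIM('a)) * (g (0 + exp t *\<^sub>R y) * ?i (exp (-t) *\<^sub>R (0 + exp t *\<^sub>R y))) \<partial>lborel)"
      by (intro nn_integral_cmult[symmetric]) measurable
    also have "\<dots> = (\<integral>\<^sup>+y. ennreal (1 / norm y ^ DIM('a)) * ?i y * f (exp t *\<^sub>R y) \<partial>lborel)"
    proof (rule nn_integral_cong)
      fix y :: 'a
      have "ennreal (exp t ^ DIM('a)) * ennreal (1 / norm (exp t *\<^sub>R y) ^ DIM('a)) = ennreal (1 / norm y ^ DIM('a))"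
        by (subst ennreal_mult[symmetric]) (auto simp: power_mult_distrib)
      then show "ennreal (exp t ^ DIM('a)) * (g (0 + exp t *\<^sub>R y) * ?i (exp (-t) *\<^sub>R (0 + exp t *\<^sub>R y)))
        = ennreal (1 / norm y ^ DIM('a)) * ?i y * f (exp t *\<^sub>R y)"
        by (simp add: g_def exp_minus mult.assoc[symmetric]) (simp add: mult_ac)
    qed
    finally show "(\<integral>\<^sup>+x. g x * ?i (exp (-t) *\<^sub>R x) \<partial>lborel)
      = (\<integral>\<^sup>+y. ennreal (1 / norm y ^ DIM('a)) * ?i y * f (exp t *\<^sub>R y) \<partial>lborel)" .
  qed
  also have "\<dots> = (\<integral>\<^sup>+y. (\<integral>\<^sup>+t. ennreal (1 / norm y ^ DIM('a)) * ?i y * f (exp t *\<^sub>R y) \<partial>lborel) \<partial>lborel)"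
    by (rule lborel_pair.Fubini') measurable
  also have "\<dots> = (\<integral>\<^sup>+y. ennreal (1 / norm y ^ DIM('a)) * ?i y * (\<integral>\<^sup>+t. f (exp t *\<^sub>R y) \<partial>lborel) \<partial>lborel)"
    by (intro nn_integral_cong nn_integral_cmult) measurable
  finally show ?thesis by (simp add: g_def)
qed

text \<open>At the centre the quotient is 0 by convention, so \<open>inversion c r c = c\<close>.
  This concerns a null set only, and integrands are compared off \<open>c\<close>.\<close>

definition inversion :: "'a::real_normed_vector \<Rightarrow> real \<Rightarrow> 'a \<Rightarrow> 'a" where
  "inversion c r y = c + (r\<^sup>2 / (norm (y - c))\<^sup>2) *\<^sub>R (y - c)"

lemma inversion_measurable [measurable]:
  "inversion c r \<in> borel_measurable (borel :: 'a::euclidean_space measure)"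
  unfolding inversion_def[abs_def] by measurable

lemma norm_inversion:
  assumes "y \<noteq> c"
  shows "norm (inversion c r y - c) = r\<^sup>2 / norm (y - c)"
  using assms by (simp add: inversion_def power2_eq_square)

lemma inversion_involutive:
  assumes "y \<noteq> c" "r > 0"
  shows "inversion c r (inversion c r y) = y"
proof -
  have "(r\<^sup>2 / (r\<^sup>2 / norm (y - c))\<^sup>2) * (r\<^sup>2 / (norm (y - c))\<^sup>2) = 1"
    using assms by (simp add: field_simps power2_eq_square)
  note scale = this
  have diff: "inversion c r y - c = (r\<^sup>2 / (norm (y - c))\<^sup>2) *\<^sub>R (y - c)"
    by (simp only: inversion_def add_diff_cancel_left')
  have "inversion c r (inversion c r y)
     = c + (r\<^sup>2 / (norm (inversion c r y - c))\<^sup>2) *\<^sub>R (inversion c r y - c)"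
    by (rule inversion_def)
  also have "\<dots> = c + (r\<^sup>2 / (r\<^sup>2 / norm (y - c))\<^sup>2) *\<^sub>R ((r\<^sup>2 / (norm (y - c))\<^sup>2) *\<^sub>R (y - c))"
    unfolding norm_inversion[OF assms(1)] by (simp only: diff)
  also have "\<dots> = y"
    by (simp only: scaleR_scaleR scale scaleR_one) simp
  finally show ?thesis .
qed

text \<open>Inversion maps each orbit t -> e^t y to itself by t -> -2 ln |y| - t. This is a
  reflection of the line, so every orbit integral is preserved and no Jacobian determinant has to be
  computed.\<close>

lemma nn_integral_inversion0:
  fixes f :: "'a::euclidean_space \<Rightarrow> ennreal"
  assumes [measurable]: "f \<in> borel_measurable borel"
  shows "(\<integral>\<^sup>+x. ennreal (1 / norm x ^ DIM('a)) * f x \<partial>lborel)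
    = (\<integral>\<^sup>+x. ennreal (1 / norm x ^ DIM('a)) * f (inversion 0 1 x) \<partial>lborel)"
proof -
  have orbit: "(\<integral>\<^sup>+t. f (inversion 0 1 (exp t *\<^sub>R y)) \<partial>lborel) = (\<integral>\<^sup>+t. f (exp t *\<^sub>R y) \<partial>lborel)"
    if "y \<noteq> 0" for y
  proof -
    have "inversion 0 1 (exp t *\<^sub>R y) = exp (- 2 * ln (norm y) + (-1) * t) *\<^sub>R y" for t
    proof -
      have "- 2 * ln (norm y) + (-1) * t = - (ln (norm y) + ln (norm y) + t)" by simp
      then have "exp (- 2 * ln (norm y) + (-1) * t) = inverse (exp (ln (norm y)) * exp (ln (norm y)) * exp t)"
        by (simp only: exp_minus exp_add)
      also have "\<dots> = 1 / (exp t * (norm y)\<^sup>2)"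
        using that by (simp add: divide_simps power2_eq_square)
      finally have "exp (- 2 * ln (norm y) + (-1) * t) = 1 / (exp t * (norm y)\<^sup>2)" .
      then show ?thesis by (simp add: inversion_def power_mult_distrib power2_eq_square)
    qed
    then have "(\<integral>\<^sup>+t. f (inversion 0 1 (exp t *\<^sub>R y)) \<partial>lborel)
      = (\<integral>\<^sup>+t. f (exp (- 2 * ln (norm y) + (-1) * t) *\<^sub>R y) \<partial>lborel)" by presburger
    also have "\<dots> = (\<integral>\<^sup>+t. f (exp t *\<^sub>R y) \<partial>lborel)"
      by (subst nn_integral_real_affine[of "\<lambda>t. f (exp t *\<^sub>R y)" "-1" "- 2 * ln (norm y)"]) auto
    finally show ?thesis .
  qed
  have "(\<integral>\<^sup>+y. ennreal (1 / norm y ^ DIM('a)) * indicator {1..exp 1} (norm y)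
          * (\<integral>\<^sup>+t. f (exp t *\<^sub>R y) \<partial>lborel) \<partial>lborel)
      = (\<integral>\<^sup>+y. ennreal (1 / norm y ^ DIM('a)) * indicator {1..exp 1} (norm y)
          * (\<integral>\<^sup>+t. f (inversion 0 1 (exp t *\<^sub>R y)) \<partial>lborel) \<partial>lborel)"
  proof (rule nn_integral_cong)
    fix y :: 'a
    show "ennreal (1 / norm y ^ DIM('a)) * indicator {1..exp 1} (norm y)
          * (\<integral>\<^sup>+t. f (exp t *\<^sub>R y) \<partial>lborel)
        = ennreal (1 / norm y ^ DIM('a)) * indicator {1..exp 1} (norm y)
          * (\<integral>\<^sup>+t. f (inversion 0 1 (exp t *\<^sub>R y)) \<partial>lborel)"
      by (cases "y = 0") (simp_all add: orbit)
  qed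
  then show ?thesis
    by (simp add: nn_integral_dilation_orbits)
qed

lemma ennreal_mult_left_assoc:
  "0 \<le> a \<Longrightarrow> ennreal a * (ennreal b * z) = ennreal (a * b) * z"
  by (simp only: ennreal_mult' mult.assoc)

lemma nn_integral_cong_except:
  fixes c :: "'a::euclidean_space"
  assumes "\<And>x. x \<noteq> c \<Longrightarrow> f x = g x"
  shows "(\<integral>\<^sup>+x. f x \<partial>lborel) = (\<integral>\<^sup>+x. g x \<partial>lborel)"
  using AE_lborel_singleton[of c] assms by (intro nn_integral_cong_AE) (auto elim: eventually_mono)

text \<open>After rescaling to the unit sphere at 0, f is written as |x|^-n times |x|^n f and the
  invariant measure is used. The Jacobian exponent 2n arises in two halves: n from the weight, n
  from the inverted factor |x|^n.\<close>

lemma nn_integral_inversion: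
  fixes f :: "'a::euclidean_space \<Rightarrow> ennreal"
  assumes [measurable]: "f \<in> borel_measurable borel" and r: "r > 0"
  shows "(\<integral>\<^sup>+x. f x \<partial>lborel)
    = (\<integral>\<^sup>+x. ennreal ((r / norm (x - c)) powr (2 * real DIM('a))) * f (inversion c r x) \<partial>lborel)"
proof -
  define g where "g x = f (c + r *\<^sub>R x)" for x
  have [measurable]: "g \<in> borel_measurable borel" unfolding g_def by measurable
  have "(\<integral>\<^sup>+x. f x \<partial>lborel) = ennreal (r ^ DIM('a)) * (\<integral>\<^sup>+x. g x \<partial>lborel)"
    unfolding g_def by (rule nn_integral_affine_euclidean) (use r in auto)
  also have "(\<integral>\<^sup>+x. g x \<partial>lborel)
    = (\<integral>\<^sup>+x. ennreal (1 / norm x ^ DIM('a)) * (ennreal (norm x ^ DIM('a)) * g x) \<partial>lborel)"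
    by (rule nn_integral_cong_except[of 0]) (simp add: ennreal_mult_left_assoc)
  also have "\<dots> = (\<integral>\<^sup>+x. ennreal (1 / norm x ^ DIM('a)) * (ennreal (norm (inversion 0 1 x) ^ DIM('a)) * g (inversion 0 1 x)) \<partial>lborel)"
    by (rule nn_integral_inversion0) measurable
  also have "\<dots> = (\<integral>\<^sup>+x. ennreal ((1 / norm x) powr (2 * real DIM('a))) * g (inversion 0 1 x) \<partial>lborel)"
  proof (rule nn_integral_cong_except[of 0])
    fix x :: 'a assume x: "x \<noteq> 0"
    have "1 / norm x ^ DIM('a) * norm (inversion 0 1 x) ^ DIM('a) = (1 / norm x) ^ (2 * DIM('a))"
      using x norm_inversion[OF x, of 1] by (simp add: power_divide power_mult mult_2 power_add)
    also have "\<dots> = (1 / norm x) powr (2 * real DIM('a))"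
      using x by (subst powr_realpow[symmetric]) auto
    finally show "ennreal (1 / norm x ^ DIM('a)) * (ennreal (norm (inversion 0 1 x) ^ DIM('a)) * g (inversion 0 1 x))
       = ennreal ((1 / norm x) powr (2 * real DIM('a))) * g (inversion 0 1 x)"
      by (simp add: ennreal_mult_left_assoc)
  qed
  also have "\<dots> = (\<integral>\<^sup>+x. ennreal ((r / norm ((c + r *\<^sub>R x) - c)) powr (2 * real DIM('a))) * f (inversion c r (c + r *\<^sub>R x)) \<partial>lborel)"
    using r by (intro nn_integral_cong) (simp add: g_def inversion_def power2_eq_square)
  also have "ennreal (r ^ DIM('a)) * \<dots>
      = (\<integral>\<^sup>+x. ennreal ((r / norm (x - c)) powr (2 * real DIM('a))) * f (inversion c r x) \<partial>lborel)"
    by (rule nn_integral_affine_euclidean[symmetric]) (use r in auto)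
  finally show ?thesis .
qed

lemma dist_inversion:
  fixes x y :: "'a::real_inner"
  assumes "x \<noteq> c" "y \<noteq> c"
  shows "norm (inversion c r x - inversion c r y) = r\<^sup>2 * norm (x - y) / (norm (x - c) * norm (y - c))"
proof -
  define X Y where "X = x - c" and "Y = y - c"
  have X: "norm X \<noteq> 0" "X \<bullet> X \<noteq> 0" and Y: "norm Y \<noteq> 0" "Y \<bullet> Y \<noteq> 0" using assms by (auto simp: X_def Y_def)
  have "(norm (inversion c r x - inversion c r y))\<^sup>2 = (norm ((r\<^sup>2 / (X \<bullet> X)) *\<^sub>R X - (r\<^sup>2 / (Y \<bullet> Y)) *\<^sub>R Y))\<^sup>2"
    by (simp add: inversion_def X_def Y_def power2_norm_eq_inner)
  also have "\<dots> = r^4 * (X \<bullet> X - 2 * (X \<bullet> Y) + Y \<bullet> Y) / ((X \<bullet> X) * (Y \<bullet> Y))"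
    unfolding power2_norm_eq_inner inner_diff inner_scaleR_left inner_scaleR_right inner_commute[of Y X]
    using X Y by (simp add: divide_simps) (simp add: algebra_simps power2_eq_square power4_eq_xxxx)
  also have "X \<bullet> X - 2 * (X \<bullet> Y) + Y \<bullet> Y = (norm (x - y))\<^sup>2"
    by (simp add: X_def Y_def power2_norm_eq_inner inner_diff inner_commute algebra_simps)
  also have "r^4 * (norm (x - y))\<^sup>2 / ((X \<bullet> X) * (Y \<bullet> Y)) = (r\<^sup>2 * norm (x - y) / (norm (x - c) * norm (y - c)))\<^sup>2"
    by (simp add: X_def Y_def power2_norm_eq_inner[symmetric] power_mult_distrib power_divide)
  finally show ?thesis
    by (simp add: power2_eq_iff_nonneg)
qed

text \<open>The excess over |x - y|^2 is the product of the powers of the two points with respect to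
  the sphere, divided by r^2. It is nonnegative when both lie on the same side, and every kernel
  comparison below comes from this sign and size.\<close>

lemma norm_minus_inversion:
  fixes x y :: "'a::real_inner"
  assumes "y \<noteq> c" "r > 0"
  shows "(norm (y - c) / r * norm (x - inversion c r y))\<^sup>2
    = (norm (x - y))\<^sup>2 + ((norm (x - c))\<^sup>2 - r\<^sup>2) * ((norm (y - c))\<^sup>2 - r\<^sup>2) / r\<^sup>2"
proof -
  define X Y where "X = x - c" and "Y = y - c"
  have Y: "norm Y \<noteq> 0" "Y \<bullet> Y \<noteq> 0" using assms by (auto simp: X_def Y_def)
  have 1: "x - inversion c r y = X - (r\<^sup>2 / (Y \<bullet> Y)) *\<^sub>R Y" and 2: "x - y = X - Y"
    by (simp_all add: inversion_def X_def Y_def power2_norm_eq_inner)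
  show ?thesis unfolding 1 2 X_def[symmetric] Y_def[symmetric] power_mult_distrib power_divide
    unfolding power2_norm_eq_inner inner_diff inner_scaleR_left inner_scaleR_right inner_commute[of Y X]
    using Y assms by (simp add: divide_simps) (simp add: algebra_simps power2_eq_square)
qed

section \<open>Riesz potentials and Kelvin transforms\<close>

text \<open>Values are in [0, \<infinity>], so potentials can be folded and added before anything is
  known about their finiteness. At \<open>y = x\<close> the kernel is 0, because
  \<open>0 powr a = 0\<close>.\<close>

definition riesz_potential :: "real \<Rightarrow> ('a::euclidean_space \<Rightarrow> ennreal) \<Rightarrow> 'a \<Rightarrow> ennreal" where
  "riesz_potential \<gamma> f x = (\<integral>\<^sup>+y. ennreal (norm (x - y) powr - \<gamma>) * f y \<partial>lborel)"

definition kelvin :: "real \<Rightarrow> 'a::euclidean_space \<Rightarrow> real \<Rightarrow> ('a \<Rightarrow> ennreal) \<Rightarrow> 'a \<Rightarrow> ennreal" where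
  "kelvin g c r f y = ennreal ((r / norm (y - c)) powr g) * f (inversion c r y)"

text \<open>The factor \<open>|y - c|/r\<close> absorbs the weight of the Kelvin transform and makes the kernel comparable
  with \<open>|x - y|\<^sup>-\<^sup>\<gamma>\<close> through \<open>norm_minus_inversion\<close>.\<close>

definition reflected_kernel :: "real \<Rightarrow> 'a::euclidean_space \<Rightarrow> real \<Rightarrow> 'a \<Rightarrow> 'a \<Rightarrow> real" where
  "reflected_kernel \<gamma> c r x y = (norm (y - c) / r * norm (x - inversion c r y)) powr - \<gamma>"

lemma kelvin_measurable [measurable]:
  assumes [measurable]: "f \<in> borel_measurable borel"
  shows "kelvin g c r f \<in> borel_measurable borel"
  unfolding kelvin_def[abs_def] by measurable

lemma reflected_kernel_measurable [measurable]:
  "reflected_kernel \<gamma> c r x \<in> borel_measurable borel"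
  unfolding reflected_kernel_def[abs_def] by measurable

lemma riesz_potential_measurable [measurable]:
  fixes f :: "'a::euclidean_space \<Rightarrow> ennreal"
  assumes [measurable]: "f \<in> borel_measurable borel"
  shows "riesz_potential \<gamma> f \<in> borel_measurable borel"
  unfolding riesz_potential_def[abs_def] by measurable

lemma riesz_potential_cmult:
  assumes [measurable]: "f \<in> borel_measurable borel"
  shows "riesz_potential \<gamma> (\<lambda>y. a * f y) x = a * riesz_potential \<gamma> f x"
  unfolding riesz_potential_def
  by (subst nn_integral_cmult[symmetric]) (auto simp: mult_ac)

lemma riesz_potential_add:
  assumes [measurable]: "f \<in> borel_measurable borel" "g \<in> borel_measurable borel"
  shows "riesz_potential \<gamma> (\<lambda>y. f y + g y) x = riesz_potential \<gamma> f x + riesz_potential \<gamma> g x"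
  unfolding riesz_potential_def
  by (subst nn_integral_add[symmetric]) (auto simp: distrib_left)

text \<open>By \<open>dist_inversion\<close> the kernel splits into a factor in x, a factor in y and
  the old kernel. The factor in x cancels the Kelvin weight \<gamma>; the factor in y lowers the
  Jacobian exponent 2n to 2n - \<gamma>.\<close>

lemma kelvin_riesz_potential:
  fixes f :: "'a::euclidean_space \<Rightarrow> ennreal"
  assumes [measurable]: "f \<in> borel_measurable borel" and r: "r > 0" and x: "x \<noteq> c"
  shows "kelvin \<gamma> c r (riesz_potential \<gamma> f) x
    = riesz_potential \<gamma> (kelvin (2 * real DIM('a) - \<gamma>) c r f) x"
proof -
  let ?x = "inversion c r x"
  have "kelvin \<gamma> c r (riesz_potential \<gamma> f) x
    = ennreal ((r / norm (x - c)) powr \<gamma>) * (\<integral>\<^sup>+y. ennreal ((r / norm (y - c)) powr (2 * real DIM('a)))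
        * (ennreal (norm (?x - inversion c r y) powr - \<gamma>) * f (inversion c r y)) \<partial>lborel)"
    unfolding kelvin_def riesz_potential_def
    by (subst nn_integral_inversion[OF _ r, of _ c]) auto
  also have "\<dots> = (\<integral>\<^sup>+y. ennreal ((r / norm (x - c)) powr \<gamma>) * (ennreal ((r / norm (y - c)) powr (2 * real DIM('a)))
        * (ennreal (norm (?x - inversion c r y) powr - \<gamma>) * f (inversion c r y))) \<partial>lborel)"
    by (rule nn_integral_cmult[symmetric]) measurable
  also have "\<dots> = (\<integral>\<^sup>+y. ennreal (norm (x - y) powr - \<gamma>) * kelvin (2 * real DIM('a) - \<gamma>) c r f y \<partial>lborel)"
  proof (rule nn_integral_cong_except[of c])
    fix y :: 'a assume y: "y \<noteq> c"
    have "norm (?x - inversion c r y) = r / norm (x - c) * (r / norm (y - c) * norm (x - y))"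
      using dist_inversion[OF x y, of r] by (simp add: power2_eq_square)
    then have "norm (?x - inversion c r y) powr - \<gamma>
      = (r / norm (x - c)) powr - \<gamma> * ((r / norm (y - c)) powr - \<gamma> * norm (x - y) powr - \<gamma>)"
      using r by (simp only: powr_mult)
    moreover have "(r / norm (x - c)) powr \<gamma> * (r / norm (x - c)) powr - \<gamma> = 1"
      using x r by (simp add: powr_minus)
    moreover have "(r / norm (y - c)) powr (2 * real DIM('a)) * (r / norm (y - c)) powr - \<gamma>
        = (r / norm (y - c)) powr (2 * real DIM('a) - \<gamma>)"
      by (simp add: powr_add[symmetric])
    ultimately have "(r / norm (x - c)) powr \<gamma> * ((r / norm (y - c)) powr (2 * real DIM('a)) * norm (?x - inversion c r y) powr - \<gamma>)
      = norm (x - y) powr - \<gamma> * (r / norm (y - c)) powr (2 * real DIM('a) - \<gamma>)"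
      by algebra
    then show "ennreal ((r / norm (x - c)) powr \<gamma>) * (ennreal ((r / norm (y - c)) powr (2 * real DIM('a)))
        * (ennreal (norm (?x - inversion c r y) powr - \<gamma>) * f (inversion c r y)))
      = ennreal (norm (x - y) powr - \<gamma>) * kelvin (2 * real DIM('a) - \<gamma>) c r f y"
      by (simp add: kelvin_def ennreal_mult_left_assoc)
  qed
  finally show ?thesis by (simp add: riesz_potential_def)
qed

lemma kelvin_kelvin:
  assumes "y \<noteq> c" "r > 0"
  shows "kelvin g c r (kelvin g c r f) y = f y"
proof -
  have "(r / norm (y - c)) powr g * (r / norm (inversion c r y - c)) powr g = 1"
    using assms
    by (subst powr_mult[symmetric]) (auto simp: norm_inversion power2_eq_square)
  then show ?thesis
    using assms by (simp add: kelvin_def ennreal_mult_left_assoc inversion_involutive)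
qed

section \<open>Folding a potential along a sphere and comparing the two kernels\<close>

text \<open>The sphere is null and the inversion carries the interior to the exterior. The Jacobian
  exponent 2n splits into \<gamma>, absorbed by the kernel as in \<open>reflected_kernel\<close>,
  and 2n - \<gamma>, which is the Kelvin weight of the density.\<close>

lemma riesz_potential_fold:
  fixes f :: "'a::euclidean_space \<Rightarrow> ennreal"
  assumes [measurable]: "f \<in> borel_measurable borel" and r: "r > 0"
  shows "riesz_potential \<gamma> f x
    = (\<integral>\<^sup>+y. (ennreal (norm (x - y) powr - \<gamma>) * f y
          + ennreal (reflected_kernel \<gamma> c r x y) * kelvin (2 * real DIM('a) - \<gamma>) c r f y)
        * indicator {y. norm (y - c) > r} y \<partial>lborel)"
proof -
  let ?o = "\<lambda>y. indicator {y. norm (y - c) > r} y :: ennreal"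
  let ?i = "\<lambda>y. indicator {y. norm (y - c) < r} y :: ennreal"
  have "AE y in lborel. y \<notin> sphere c r"
    using negligible_sphere[of c r] by (intro AE_not_in) (simp add: negligible_iff_null_sets null_sets_completion_iff)
  then have "AE y in lborel. 1 = ?o y + ?i y"
    by (rule eventually_mono) (auto simp: indicator_def dist_norm norm_minus_commute)
  then have "riesz_potential \<gamma> f x = (\<integral>\<^sup>+y. ennreal (norm (x - y) powr - \<gamma>) * f y * (?o y + ?i y) \<partial>lborel)"
    unfolding riesz_potential_def by (intro nn_integral_cong_AE) (auto elim!: eventually_mono)
  also have "\<dots> = (\<integral>\<^sup>+y. ennreal (norm (x - y) powr - \<gamma>) * f y * ?o y \<partial>lborel)
      + (\<integral>\<^sup>+y. ennreal (norm (x - y) powr - \<gamma>) * f y * ?i y \<partial>lborel)"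
    unfolding distrib_left by (rule nn_integral_add) measurable
  also have "(\<integral>\<^sup>+y. ennreal (norm (x - y) powr - \<gamma>) * f y * ?i y \<partial>lborel)
    = (\<integral>\<^sup>+y. ennreal ((r / norm (y - c)) powr (2 * real DIM('a))) *
        (ennreal (norm (x - inversion c r y) powr - \<gamma>) * f (inversion c r y) * ?i (inversion c r y)) \<partial>lborel)"
    by (rule nn_integral_inversion) (use r in auto)
  also have "\<dots> = (\<integral>\<^sup>+y. ennreal (reflected_kernel \<gamma> c r x y) * kelvin (2 * real DIM('a) - \<gamma>) c r f y * ?o y \<partial>lborel)"
  proof (rule nn_integral_cong_except[of c])
    fix y assume y: "y \<noteq> c"
    have "?i (inversion c r y) = ?o y"
      using y r by (auto simp: indicator_def norm_inversion field_simps power2_eq_square)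
    moreover have "(r / norm (y - c)) powr (2 * real DIM('a)) * norm (x - inversion c r y) powr - \<gamma>
      = reflected_kernel \<gamma> c r x y * (r / norm (y - c)) powr (2 * real DIM('a) - \<gamma>)"
    proof -
      have "norm (y - c) / r = inverse (r / norm (y - c))" by simp
      then have "(norm (y - c) / r) powr - \<gamma> = (r / norm (y - c)) powr \<gamma>"
        by (simp only: powr_minus inverse_powr inverse_inverse_eq)
      then have "reflected_kernel \<gamma> c r x y = (r / norm (y - c)) powr \<gamma> * norm (x - inversion c r y) powr - \<gamma>"
        unfolding reflected_kernel_def by (subst powr_mult) (use r in simp_all)
      then show ?thesis
        by (simp add: mult_ac powr_add[symmetric])
    qed
    ultimately show "ennreal ((r / norm (y - c)) powr (2 * real DIM('a))) *
        (ennreal (norm (x - inversion c r y) powr - \<gamma>) * f (inversion c r y) * ?i (inversion c r y))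
       = ennreal (reflected_kernel \<gamma> c r x y) * kelvin (2 * real DIM('a) - \<gamma>) c r f y * ?o y"
      by (simp add: kelvin_def mult.assoc ennreal_mult_left_assoc reflected_kernel_def)
  qed
  also have "(\<integral>\<^sup>+y. ennreal (norm (x - y) powr - \<gamma>) * f y * ?o y \<partial>lborel) + \<dots>
    = (\<integral>\<^sup>+y. ennreal (norm (x - y) powr - \<gamma>) * f y * ?o y
      + ennreal (reflected_kernel \<gamma> c r x y) * kelvin (2 * real DIM('a) - \<gamma>) c r f y * ?o y \<partial>lborel)"
    by (rule nn_integral_add[symmetric]) measurable
  finally show ?thesis by (simp add: distrib_right)
qed

lemma reflected_kernel_le:
  assumes "r > 0" "\<gamma> > 0" "x \<noteq> y" "norm (x - c) \<ge> r" "norm (y - c) \<ge> r"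
  shows "reflected_kernel \<gamma> c r x y \<le> norm (x - y) powr - \<gamma>"
proof -
  have "r\<^sup>2 \<le> (norm (x - c))\<^sup>2" "r\<^sup>2 \<le> (norm (y - c))\<^sup>2"
    using assms by (auto intro: power_mono)
  then have "((norm (x - c))\<^sup>2 - r\<^sup>2) * ((norm (y - c))\<^sup>2 - r\<^sup>2) / r\<^sup>2 \<ge> 0" by simp
  moreover have "y \<noteq> c" using assms by auto
  ultimately have "(norm (x - y))\<^sup>2 \<le> (norm (y - c) / r * norm (x - inversion c r y))\<^sup>2"
    using norm_minus_inversion[of y c r x] assms by linarith
  then have "norm (x - y) \<le> norm (y - c) / r * norm (x - inversion c r y)"
    by (rule power2_le_imp_le) (use assms in auto)
  then show ?thesis
    unfolding reflected_kernel_def using assms by (intro powr_mono2') auto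
qed

text \<open>For points at distance at least l the excess in \<open>norm_minus_inversion\<close> is
  at least e |x - y|^2: each power |x-c|^2 - r^2 is at least \<kappa> |x-c|^2, while r^2 |x-y|^2
  \<le> 4 |x-c|^2 |y-c|^2. The ratio \<theta> is uniform on an unbounded region, which later
  produces a gap that survives at infinity.\<close>

lemma reflected_kernel_le_strict:
  fixes c :: "'a::euclidean_space"
  assumes "r > 0" "\<gamma> > 0" "l > r"
  obtains \<theta> where "0 < \<theta>" "\<theta> < 1"
    "\<And>x y. x \<noteq> y \<Longrightarrow> norm (x - c) \<ge> l \<Longrightarrow> norm (y - c) \<ge> l \<Longrightarrow>
       reflected_kernel \<gamma> c r x y \<le> \<theta> * norm (x - y) powr - \<gamma>"
proof -
  define \<kappa> where "\<kappa> = 1 - r\<^sup>2 / l\<^sup>2"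
  define e where "e = \<kappa>\<^sup>2 / 4"
  have \<kappa>: "\<kappa> > 0" using assms by (simp add: \<kappa>_def power_strict_mono)
  then have e: "e > 0" by (simp add: e_def)
  define \<theta> where "\<theta> = sqrt (1 + e) powr - \<gamma>"
  have "reflected_kernel \<gamma> c r x y \<le> \<theta> * norm (x - y) powr - \<gamma>"
    if xy: "x \<noteq> y" "norm (x - c) \<ge> l" "norm (y - c) \<ge> l" for x y
  proof -
    let ?a = "norm (x - c)" and ?b = "norm (y - c)"
    have l: "l > 0" using assms by simp
    have a2: "l\<^sup>2 \<le> ?a\<^sup>2" and b2: "l\<^sup>2 \<le> ?b\<^sup>2"
      using xy l by (auto intro: power_mono)
    have ka: "\<kappa> * ?a\<^sup>2 \<le> ?a\<^sup>2 - r\<^sup>2" 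
    proof -
      have "r\<^sup>2 * l\<^sup>2 \<le> r\<^sup>2 * ?a\<^sup>2" using a2 by (intro mult_left_mono) auto
      then show ?thesis using l by (simp add: \<kappa>_def field_simps)
    qed
    have kb: "\<kappa> * ?b\<^sup>2 \<le> ?b\<^sup>2 - r\<^sup>2" 
    proof -
      have "r\<^sup>2 * l\<^sup>2 \<le> r\<^sup>2 * ?b\<^sup>2" using b2 by (intro mult_left_mono) auto
      then show ?thesis using l by (simp add: \<kappa>_def field_simps)
    qed
    have "norm (x - y) \<le> ?a + ?b"
      using norm_triangle_ineq4[of "x - c" "y - c"] by simp
    then have "(norm (x - y))\<^sup>2 \<le> (?a + ?b)\<^sup>2" by (intro power_mono) auto
    also have "\<dots> \<le> 2 * ?a\<^sup>2 + 2 * ?b\<^sup>2"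
      using sum_squares_bound[of ?a ?b] by (simp add: power2_sum)
    finally have d: "(norm (x - y))\<^sup>2 * r\<^sup>2 \<le> (2 * ?a\<^sup>2 + 2 * ?b\<^sup>2) * r\<^sup>2"
      by (intro mult_right_mono) auto
    have rl: "r\<^sup>2 \<le> l\<^sup>2" using assms by (intro power_mono) auto
    have "?a\<^sup>2 * r\<^sup>2 \<le> ?a\<^sup>2 * ?b\<^sup>2" "?b\<^sup>2 * r\<^sup>2 \<le> ?b\<^sup>2 * ?a\<^sup>2"
      using a2 b2 rl by (auto intro!: mult_left_mono)
    with d have "(norm (x - y))\<^sup>2 * r\<^sup>2 \<le> 4 * (?a\<^sup>2 * ?b\<^sup>2)" by (simp add: algebra_simps)
    then have "\<kappa>\<^sup>2 * ((norm (x - y))\<^sup>2 * r\<^sup>2) \<le> \<kappa>\<^sup>2 * (4 * (?a\<^sup>2 * ?b\<^sup>2))"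
      by (intro mult_left_mono) auto
    then have "e * ((norm (x - y))\<^sup>2 * r\<^sup>2) \<le> (\<kappa> * ?a\<^sup>2) * (\<kappa> * ?b\<^sup>2)"
      by (simp add: e_def power2_eq_square[of \<kappa>] mult_ac)
    also have "\<dots> \<le> (?a\<^sup>2 - r\<^sup>2) * (?b\<^sup>2 - r\<^sup>2)"
      using ka kb \<kappa> a2 rl by (intro mult_mono) auto
    finally have "e * (norm (x - y))\<^sup>2 \<le> (?a\<^sup>2 - r\<^sup>2) * (?b\<^sup>2 - r\<^sup>2) / r\<^sup>2"
      using assms by (simp add: field_simps)
    moreover have "y \<noteq> c" using xy l by auto
    ultimately have "(1 + e) * (norm (x - y))\<^sup>2 \<le> (?b / r * norm (x - inversion c r y))\<^sup>2"
      using norm_minus_inversion[of y c r x] assms by (simp add: algebra_simps)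
    then have "(sqrt (1 + e) * norm (x - y))\<^sup>2 \<le> (?b / r * norm (x - inversion c r y))\<^sup>2"
      using e by (simp add: power_mult_distrib)
    then have "sqrt (1 + e) * norm (x - y) \<le> ?b / r * norm (x - inversion c r y)"
      by (rule power2_le_imp_le) (use assms in auto)
    then have "reflected_kernel \<gamma> c r x y \<le> (sqrt (1 + e) * norm (x - y)) powr - \<gamma>"
      unfolding reflected_kernel_def using assms e xy by (intro powr_mono2') auto
    then show ?thesis using e by (simp add: \<theta>_def powr_mult)
  qed
  moreover have "0 < \<theta>" "\<theta> < 1"
    using e assms powr_less_cancel_iff[of "sqrt (1 + e)" "- \<gamma>" 0] by (simp_all add: \<theta>_def)
  ultimately show ?thesis using that by blast
qed

text \<open>This is (k - k')(a - b) \<le> k g with the terms arranged so that only the real kernels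
  are subtracted; a, b and g may be infinite.\<close>

lemma ennreal_kernel_exchange:
  fixes a b g :: ennreal
  assumes "a \<le> b + g" "0 \<le> k'" "k' \<le> k"
  shows "ennreal k * a + ennreal k' * b \<le> (ennreal k * b + ennreal k' * a) + ennreal k * g"
proof -
  define d where "d = k - k'"
  have k: "ennreal k = ennreal k' + ennreal d"
    using assms by (simp add: d_def ennreal_plus[symmetric])
  have "ennreal d * a \<le> ennreal d * (b + g)" using assms(1) by (rule mult_left_mono) simp
  also have "\<dots> \<le> ennreal d * b + ennreal k * g"
    using assms by (auto simp: distrib_left d_def intro!: add_left_mono mult_right_mono ennreal_leI)
  finally have "ennreal k' * a + ennreal k' * b + ennreal d * a
      \<le> ennreal k' * a + ennreal k' * b + (ennreal d * b + ennreal k * g)"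
    by (rule add_left_mono)
  then show ?thesis unfolding k by (simp add: distrib_right add_ac)
qed

text \<open>Exchanging the kernels gains (k - k')(b - a), and k - k' \<ge> (1 - \<theta>) k. The
  subtraction of extended reals is exact because a \<le> b.\<close>

lemma ennreal_kernel_exchange_strict:
  fixes a b :: ennreal
  assumes "a \<le> b" "0 \<le> k" "0 \<le> k'" "k' \<le> \<theta> * k" "\<theta> < 1"
  shows "(ennreal k * a + ennreal k' * b) + ennreal (1 - \<theta>) * (ennreal k * (b - a)) \<le> ennreal k * b + ennreal k' * a"
proof -
  define d where "d = k - k'"
  have "\<theta> * k \<le> 1 * k" using assms by (intro mult_right_mono) auto
  then have k: "ennreal k = ennreal k' + ennreal d" and d: "(1 - \<theta>) * k \<le> d"
    using assms by (simp_all add: d_def ennreal_plus[symmetric] algebra_simps)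
  have "ennreal d * a + ennreal (1 - \<theta>) * (ennreal k * (b - a)) \<le> ennreal d * a + ennreal d * (b - a)"
    using d assms by (intro add_left_mono) (simp add: ennreal_mult_left_assoc mult_right_mono ennreal_leI)
  also have "\<dots> = ennreal d * b"
    using assms(1) by (simp add: distrib_left[symmetric] add_diff_inverse_ennreal)
  finally have "ennreal k' * a + ennreal k' * b + (ennreal d * a + ennreal (1 - \<theta>) * (ennreal k * (b - a)))
      \<le> ennreal k' * a + ennreal k' * b + ennreal d * b"
    by (rule add_left_mono)
  then show ?thesis
    by (simp only: k distrib_right) (simp only: k[symmetric] add_ac)
qed

text \<open>The Kelvin transform is an involution, so folding the transformed density exchanges the
  two densities and keeps the two kernels. Both potentials thus become integrals over the same
  exterior, differing only in which density meets which kernel.\<close>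

lemma riesz_potential_kelvin_fold:
  fixes f :: "'a::euclidean_space \<Rightarrow> ennreal" and c :: 'a and \<gamma> r :: real
  assumes [measurable]: "f \<in> borel_measurable borel" and r: "r > 0"
  defines "f' \<equiv> kelvin (2 * real DIM('a) - \<gamma>) c r f"
  shows "riesz_potential \<gamma> f' x
    = (\<integral>\<^sup>+y. (ennreal (norm (x - y) powr - \<gamma>) * f' y + ennreal (reflected_kernel \<gamma> c r x y) * f y)
        * indicator {y. norm (y - c) > r} y \<partial>lborel)"
  unfolding f'_def using r
  by (subst riesz_potential_fold[OF _ r, of _ _ _ c]) (auto intro!: nn_integral_cong_except[of c] simp: kelvin_kelvin)

text \<open>Comparison principle: in the folded integrals it is favourable to pair the larger kernel
  with the larger density. An order of the densities up to an error g therefore passes to the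
  potentials up to the potential of g.\<close>

lemma riesz_potential_kelvin_le:
  fixes f g :: "'a::euclidean_space \<Rightarrow> ennreal"
  assumes [measurable]: "f \<in> borel_measurable borel" "g \<in> borel_measurable borel"
    and r: "r > 0" and \<gamma>: "\<gamma> > 0" and x: "norm (x - c) > r"
    and le: "\<And>y. norm (y - c) > r \<Longrightarrow> kelvin (2 * real DIM('a) - \<gamma>) c r f y \<le> f y + g y"
  shows "riesz_potential \<gamma> (kelvin (2 * real DIM('a) - \<gamma>) c r f) x
    \<le> riesz_potential \<gamma> f x + riesz_potential \<gamma> g x"
proof -
  let ?o = "\<lambda>y. indicator {y. norm (y - c) > r} y :: ennreal"
  let ?k = "\<lambda>y. ennreal (norm (x - y) powr - \<gamma>)"
  let ?k' = "\<lambda>y. ennreal (reflected_kernel \<gamma> c r x y)"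
  define f' where "f' = kelvin (2 * real DIM('a) - \<gamma>) c r f"
  have [measurable]: "f' \<in> borel_measurable borel" unfolding f'_def by measurable
  have "riesz_potential \<gamma> f' x = (\<integral>\<^sup>+y. (?k y * f' y + ?k' y * f y) * ?o y \<partial>lborel)"
    unfolding f'_def by (rule riesz_potential_kelvin_fold) (use r in auto)
  also have "\<dots> \<le> (\<integral>\<^sup>+y. (?k y * f y + ?k' y * f' y) * ?o y + ?k y * g y \<partial>lborel)"
  proof (rule nn_integral_mono_AE, rule eventually_mono[OF AE_lborel_singleton[of x]])
    fix y assume y: "y \<noteq> x"
    show "(?k y * f' y + ?k' y * f y) * ?o y \<le> (?k y * f y + ?k' y * f' y) * ?o y + ?k y * g y"
    proof (cases "norm (y - c) > r")
      case True
      then show ?thesis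
        using ennreal_kernel_exchange[of "f' y" "f y" "g y" "reflected_kernel \<gamma> c r x y" "norm (x - y) powr - \<gamma>"]
          le[OF True] reflected_kernel_le[of r \<gamma> x y c] y r \<gamma> x
        by (simp add: f'_def reflected_kernel_def)
    qed simp
  qed
  also have "\<dots> = riesz_potential \<gamma> f x + riesz_potential \<gamma> g x"
    unfolding riesz_potential_fold[OF assms(1) r, of \<gamma> x c] riesz_potential_def[of \<gamma> g]
    by (subst nn_integral_add[symmetric]) (auto simp: f'_def)
  finally show ?thesis by (simp add: f'_def)
qed

text \<open>On D the kernels are separated by the factor \<theta>, and the exchange leaves a
  definite gain there; on the rest of the exterior the weak kernel inequality suffices.\<close>

lemma riesz_potential_kelvin_le_strict:
  fixes f :: "'a::euclidean_space \<Rightarrow> ennreal"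
  assumes [measurable]: "f \<in> borel_measurable borel" "D \<in> sets borel"
    and r: "r > 0" and \<gamma>: "\<gamma> > 0" and x: "norm (x - c) > r"
    and le: "\<And>y. norm (y - c) > r \<Longrightarrow> kelvin (2 * real DIM('a) - \<gamma>) c r f y \<le> f y"
    and \<theta>: "\<theta> < 1" "\<And>y. y \<noteq> x \<Longrightarrow> y \<in> D \<Longrightarrow> reflected_kernel \<gamma> c r x y \<le> \<theta> * norm (x - y) powr - \<gamma>"
    and D: "D \<subseteq> {y. norm (y - c) > r}"
  shows "riesz_potential \<gamma> (kelvin (2 * real DIM('a) - \<gamma>) c r f) x
    + ennreal (1 - \<theta>) * riesz_potential \<gamma> (\<lambda>y. (f y - kelvin (2 * real DIM('a) - \<gamma>) c r f y) * indicator D y) x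
    \<le> riesz_potential \<gamma> f x"
proof -
  let ?o = "\<lambda>y. indicator {y. norm (y - c) > r} y :: ennreal"
  let ?k = "\<lambda>y. ennreal (norm (x - y) powr - \<gamma>)"
  let ?k' = "\<lambda>y. ennreal (reflected_kernel \<gamma> c r x y)"
  define f' where "f' = kelvin (2 * real DIM('a) - \<gamma>) c r f"
  have [measurable]: "f' \<in> borel_measurable borel" unfolding f'_def by measurable
  have "riesz_potential \<gamma> f' x + ennreal (1 - \<theta>) * riesz_potential \<gamma> (\<lambda>y. (f y - f' y) * indicator D y) x
    = (\<integral>\<^sup>+y. (?k y * f' y + ?k' y * f y) * ?o y + ennreal (1 - \<theta>) * (?k y * ((f y - f' y) * indicator D y)) \<partial>lborel)"
    unfolding f'_def riesz_potential_kelvin_fold[OF assms(1) r]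
    unfolding f'_def[symmetric] riesz_potential_def
    by (subst nn_integral_cmult[symmetric], measurable, subst nn_integral_add[symmetric]) auto
  also have "\<dots> \<le> (\<integral>\<^sup>+y. (?k y * f y + ?k' y * f' y) * ?o y \<partial>lborel)"
  proof (rule nn_integral_mono_AE, rule eventually_mono[OF AE_lborel_singleton[of x]])
    fix y assume y: "y \<noteq> x"
    show "(?k y * f' y + ?k' y * f y) * ?o y + ennreal (1 - \<theta>) * (?k y * ((f y - f' y) * indicator D y))
      \<le> (?k y * f y + ?k' y * f' y) * ?o y"
    proof (cases "y \<in> D")
      case True
      then have "norm (y - c) > r" using D by auto
      then show ?thesis
        using ennreal_kernel_exchange_strict[of "f' y" "f y" "norm (x - y) powr - \<gamma>" "reflected_kernel \<gamma> c r x y" \<theta>]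
          le[of y] \<theta>(2)[OF y True] \<theta>(1) True
        by (simp add: f'_def reflected_kernel_def)
    next
      case False
      show ?thesis
      proof (cases "norm (y - c) > r")
        case True
        then show ?thesis
          using ennreal_kernel_exchange[of "f' y" "f y" 0 "reflected_kernel \<gamma> c r x y" "norm (x - y) powr - \<gamma>"]
            le[OF True] reflected_kernel_le[of r \<gamma> x y c] y r \<gamma> x False
          by (simp add: f'_def reflected_kernel_def)
      qed (use False in simp)
    qed
  qed
  also have "\<dots> = riesz_potential \<gamma> f x"
    unfolding riesz_potential_fold[OF assms(1) r, of \<gamma> x c] by (simp add: f'_def)
  finally show ?thesis by (simp add: f'_def)
qed

section \<open>Decay from below and smallness on small sets\<close>

text \<open>Points of the unit ball around c are within |x-c| + 1 of x. This gives the yardstick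
  (|x-c| + 1)^-\<gamma> against which the potential of a small set is measured at every x.\<close>

lemma riesz_potential_lower_bound:
  fixes f :: "'a::euclidean_space \<Rightarrow> ennreal"
  assumes "\<gamma> > 0" and m: "m \<ge> 0" "\<And>y. y \<in> ball c 1 \<Longrightarrow> ennreal m \<le> f y"
  shows "ennreal (m * unit_ball_vol (real DIM('a)) * (norm (x - c) + 1) powr - \<gamma>) \<le> riesz_potential \<gamma> f x"
proof -
  have "ennreal (m * unit_ball_vol (real DIM('a)) * (norm (x - c) + 1) powr - \<gamma>)
    = ennreal (m * (norm (x - c) + 1) powr - \<gamma>) * emeasure lborel (ball c 1)"
    using m by (simp add: emeasure_ball ennreal_mult'[symmetric] mult_ac)
  also have "\<dots> = (\<integral>\<^sup>+y. ennreal (m * (norm (x - c) + 1) powr - \<gamma>) * indicator (ball c 1) y \<partial>lborel)"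
    by (simp add: nn_integral_cmult_indicator)
  also have "\<dots> \<le> (\<integral>\<^sup>+y. ennreal (norm (x - y) powr - \<gamma>) * f y \<partial>lborel)"
  proof (rule nn_integral_mono_AE, rule eventually_mono[OF AE_lborel_singleton[of x]])
    fix y assume y: "y \<noteq> x"
    show "ennreal (m * (norm (x - c) + 1) powr - \<gamma>) * indicator (ball c 1) y \<le> ennreal (norm (x - y) powr - \<gamma>) * f y"
    proof (cases "y \<in> ball c 1")
      case True
      have "norm (x - y) \<le> norm (x - c) + norm (c - y)"
        using norm_triangle_ineq[of "x - c" "c - y"] by simp
      then have "norm (x - y) \<le> norm (x - c) + 1" using True by (simp add: dist_norm)
      then have "(norm (x - c) + 1) powr - \<gamma> \<le> norm (x - y) powr - \<gamma>"
        using y assms by (intro powr_mono2') auto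
      then have "ennreal ((norm (x - c) + 1) powr - \<gamma>) * ennreal m \<le> ennreal (norm (x - y) powr - \<gamma>) * f y"
        using m(2)[OF True] by (intro mult_mono ennreal_leI) auto
      then show ?thesis using True m by (simp add: ennreal_mult'[symmetric] mult.commute)
    qed simp
  qed
  finally show ?thesis by (simp add: riesz_potential_def)
qed

lemma ball_in_borel [measurable]: "ball x \<rho> \<in> sets borel"
  by simp

lemma nn_integral_kernel_ball:
  fixes x :: "'a::euclidean_space"
  assumes \<rho>: "\<rho> > 0"
  shows "(\<integral>\<^sup>+y. ennreal (norm (x - y) powr - \<gamma>) * indicator (ball x \<rho>) y \<partial>lborel)
    = ennreal (\<rho> powr (real DIM('a) - \<gamma>)) * (\<integral>\<^sup>+y. ennreal (norm y powr - \<gamma>) * indicator (ball (0::'a) 1) y \<partial>lborel)"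
proof -
  have "(\<integral>\<^sup>+y. ennreal (norm (x - y) powr - \<gamma>) * indicator (ball x \<rho>) y \<partial>lborel)
    = ennreal (\<rho> ^ DIM('a)) * (\<integral>\<^sup>+y. ennreal (norm (x - (x + \<rho> *\<^sub>R y)) powr - \<gamma>) * indicator (ball x \<rho>) (x + \<rho> *\<^sub>R y) \<partial>lborel)"
    by (rule nn_integral_affine_euclidean) (use \<rho> in auto)
  also have "\<dots> = ennreal (\<rho> powr real DIM('a)) * (\<integral>\<^sup>+y. ennreal (\<rho> powr - \<gamma>) * (ennreal (norm y powr - \<gamma>) * indicator (ball (0::'a) 1) y) \<partial>lborel)"
  proof -
    have "ennreal (norm (x - (x + \<rho> *\<^sub>R y)) powr - \<gamma>) * indicator (ball x \<rho>) (x + \<rho> *\<^sub>R y)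
      = ennreal (\<rho> powr - \<gamma>) * (ennreal (norm y powr - \<gamma>) * indicator (ball (0::'a) 1) y)" for y
    proof -
      have "indicator (ball x \<rho>) (x + \<rho> *\<^sub>R y) = (indicator (ball (0::'a) 1) y :: ennreal)"
        using \<rho> by (auto simp: indicator_def dist_norm)
      moreover have "norm (x - (x + \<rho> *\<^sub>R y)) = \<rho> * norm y" using \<rho> by simp
      then have "norm (x - (x + \<rho> *\<^sub>R y)) powr - \<gamma> = \<rho> powr - \<gamma> * norm y powr - \<gamma>"
        by (simp only: powr_mult)
      ultimately show ?thesis by (simp only: ennreal_mult_left_assoc powr_ge_zero)
    qed
    moreover have "\<rho> ^ DIM('a) = \<rho> powr real DIM('a)" using \<rho> by (simp add: powr_realpow)
    ultimately show ?thesis by presburger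
  qed
  also have "\<dots> = ennreal (\<rho> powr real DIM('a)) * (ennreal (\<rho> powr - \<gamma>) * (\<integral>\<^sup>+y. (ennreal (norm y powr - \<gamma>) * indicator (ball (0::'a) 1) y) \<partial>lborel))"
    by (subst nn_integral_cmult) auto
  finally show ?thesis
    by (simp add: ennreal_mult_left_assoc powr_add[symmetric])
qed

text \<open>Integrability of the kernel at its singularity is extracted from one finite potential
  whose density is bounded below near the evaluation point, followed by rescaling.\<close>

lemma nn_integral_kernel_ball_finite:
  fixes f :: "'a::euclidean_space \<Rightarrow> ennreal"
  assumes "riesz_potential \<gamma> f x < \<infinity>" "m > 0" "\<rho> > 0" and f: "\<And>y. y \<in> ball x \<rho> \<Longrightarrow> ennreal m \<le> f y"
  shows "(\<integral>\<^sup>+y. ennreal (norm y powr - \<gamma>) * indicator (ball (0::'a) 1) y \<partial>lborel) < \<infinity>"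
proof -
  have "ennreal m * (\<integral>\<^sup>+y. ennreal (norm (x - y) powr - \<gamma>) * indicator (ball x \<rho>) y \<partial>lborel)
    = (\<integral>\<^sup>+y. ennreal m * (ennreal (norm (x - y) powr - \<gamma>) * indicator (ball x \<rho>) y) \<partial>lborel)"
    by (rule nn_integral_cmult[symmetric]) measurable
  also have "\<dots> \<le> riesz_potential \<gamma> f x"
    unfolding riesz_potential_def
    by (intro nn_integral_mono) (auto simp: indicator_def mult.commute[of "ennreal m"] intro!: mult_left_mono f)
  also have "\<dots> < \<infinity>" by fact
  finally have "ennreal m * (ennreal (\<rho> powr (real DIM('a) - \<gamma>)) * (\<integral>\<^sup>+y. ennreal (norm y powr - \<gamma>) * indicator (ball (0::'a) 1) y \<partial>lborel)) < \<infinity>"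
    unfolding nn_integral_kernel_ball[OF \<open>\<rho> > 0\<close>] .
  then show ?thesis using assms by (auto simp: ennreal_mult_less_top less_top)
qed

text \<open>Put w = (|x-c| + 1)^-\<gamma>. On \<open>ball c R\<close> the kernel seen from x is at
  most B w (1 + |x-y|^-\<gamma>), and the full potential is at least m V w. The factor w cancels,
  which makes the estimate uniform in x. What remains is the integral of 1 + |x-y|^-\<gamma> over A:
  its singular part near x is small through \<rho>, the rest through the measure of A.\<close>

lemma riesz_potential_small_set:
  fixes f :: "'a::euclidean_space \<Rightarrow> ennreal"
  assumes [measurable]: "f \<in> borel_measurable borel" and \<gamma>: "0 < \<gamma>" "\<gamma> < real DIM('a)"
    and fin: "(\<integral>\<^sup>+y. ennreal (norm y powr - \<gamma>) * indicator (ball (0::'a) 1) y \<partial>lborel) < \<infinity>"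
    and M: "\<And>y. y \<in> ball c R \<Longrightarrow> f y \<le> ennreal M" and R: "R > 0" "M > 0"
    and m: "m > 0" "\<And>y. y \<in> ball c 1 \<Longrightarrow> ennreal m \<le> f y" and \<epsilon>: "\<epsilon> > 0"
  obtains \<eta> where "\<eta> > 0" "\<And>A x. A \<in> sets borel \<Longrightarrow> A \<subseteq> ball c R \<Longrightarrow> emeasure lborel A \<le> ennreal \<eta> \<Longrightarrow>
     riesz_potential \<gamma> (\<lambda>y. f y * indicator A y) x \<le> ennreal \<epsilon> * riesz_potential \<gamma> f x"
proof -
  obtain j where j: "j \<ge> 0" "(\<integral>\<^sup>+y. ennreal (norm y powr - \<gamma>) * indicator (ball (0::'a) 1) y \<partial>lborel) = ennreal j"
    using fin by (metis enn2real_nonneg ennreal_enn2real infinity_ennreal_def)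
  define V where "V = unit_ball_vol (real DIM('a))"
  have V: "V > 0" by (simp add: V_def unit_ball_vol_pos)
  define B where "B = 2 powr \<gamma> * (1 + (R + 1) powr \<gamma>)"
  have B: "B > 0" using R by (simp add: B_def add_pos_nonneg)
  \<comment> \<open>Chosen so that M B (\<delta> + \<delta>) = \<epsilon> m V: one share for the
    ball of radius \<rho> around x, one for the set A away from the singularity.\<close>
  define \<delta> where "\<delta> = \<epsilon> * m * V / (2 * M * B)"
  have \<delta>: "\<delta> > 0" using B V m \<epsilon> R by (simp add: \<delta>_def)
  define \<rho> where "\<rho> = (\<delta> / (j + 1)) powr (1 / (real DIM('a) - \<gamma>))"
  have \<rho>: "\<rho> > 0" using \<delta> j by (simp add: \<rho>_def)
  have "\<rho> powr (real DIM('a) - \<gamma>) = \<delta> / (j + 1)"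
    using \<gamma> \<delta> j by (simp add: \<rho>_def powr_powr)
  then have \<rho>j: "\<rho> powr (real DIM('a) - \<gamma>) * j \<le> \<delta>" using j \<delta> by (simp add: divide_le_eq mult_left_mono)
  define \<eta> where "\<eta> = \<delta> / (1 + \<rho> powr - \<gamma>)"
  have pos: "1 + \<rho> powr - \<gamma> > 0" by (simp add: add_pos_nonneg)
  then have \<eta>: "\<eta> > 0" and \<eta>2: "(1 + \<rho> powr - \<gamma>) * \<eta> = \<delta>" using \<delta> by (simp_all add: \<eta>_def)
  have "riesz_potential \<gamma> (\<lambda>y. f y * indicator A y) x \<le> ennreal \<epsilon> * riesz_potential \<gamma> f x"
    if A [measurable]: "A \<in> sets borel" and AR: "A \<subseteq> ball c R" and A\<eta>: "emeasure lborel A \<le> ennreal \<eta>" for A x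
  proof -
    define w where "w = (norm (x - c) + 1) powr - \<gamma>"
    have nz: "norm (x - c) + 1 \<noteq> 0" using norm_ge_zero[of "x - c"] by linarith
    then have w: "w > 0" by (simp add: w_def)
    have "riesz_potential \<gamma> (\<lambda>y. f y * indicator A y) x
      \<le> (\<integral>\<^sup>+y. ennreal (M * B * w) * (ennreal (1 + \<rho> powr - \<gamma>) * indicator A y
          + ennreal (norm (x - y) powr - \<gamma>) * indicator (ball x \<rho>) y) \<partial>lborel)"
      unfolding riesz_potential_def
    proof (rule nn_integral_mono_AE, rule eventually_mono[OF AE_lborel_singleton[of x]])
      fix y assume y: "y \<noteq> x"
      show "ennreal (norm (x - y) powr - \<gamma>) * (f y * indicator A y)
        \<le> ennreal (M * B * w) * (ennreal (1 + \<rho> powr - \<gamma>) * indicator A y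
          + ennreal (norm (x - y) powr - \<gamma>) * indicator (ball x \<rho>) y)"
      proof (cases "y \<in> A")
        case True
        let ?d = "norm (x - y)"
        have d: "?d > 0" using y by simp
        have yR: "norm (y - c) < R" using True AR by (auto simp: dist_norm norm_minus_commute)
        have "norm (x - c) \<le> ?d + norm (y - c)" using norm_triangle_ineq[of "x - y" "y - c"] by simp
        then have "norm (x - c) + 1 \<le> 2 * max ?d (R + 1)"
          using yR by (smt (verit) max_def)
        then have "(norm (x - c) + 1) powr \<gamma> \<le> (2 * max ?d (R + 1)) powr \<gamma>"
          using \<gamma> by (intro powr_mono2) auto
        also have "\<dots> \<le> 2 powr \<gamma> * (?d powr \<gamma> + (R + 1) powr \<gamma>)"
          by (simp add: powr_mult max_def)
        finally have 1: "(norm (x - c) + 1) powr \<gamma> \<le> 2 powr \<gamma> * (?d powr \<gamma> + (R + 1) powr \<gamma>)" .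
        have dd: "?d powr \<gamma> * ?d powr - \<gamma> = 1" using d by (simp add: powr_minus)
        have ww: "(norm (x - c) + 1) powr \<gamma> * w = 1"
          using nz by (simp add: w_def powr_minus)
        have "?d powr - \<gamma> = (norm (x - c) + 1) powr \<gamma> * (?d powr - \<gamma> * w)" using ww by algebra
        also have "\<dots> \<le> (2 powr \<gamma> * (?d powr \<gamma> + (R + 1) powr \<gamma>)) * (?d powr - \<gamma> * w)"
          using 1 w by (intro mult_right_mono) auto
        also have "\<dots> = (2 powr \<gamma> * (1 + (R + 1) powr \<gamma> * ?d powr - \<gamma>)) * w"
          using dd by algebra
        also have "\<dots> \<le> B * (1 + ?d powr - \<gamma>) * w"
        proof -
          have "1 + (R + 1) powr \<gamma> * ?d powr - \<gamma> \<le> (1 + (R + 1) powr \<gamma>) * (1 + ?d powr - \<gamma>)"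
            by (simp add: algebra_simps)
          then show ?thesis unfolding B_def using w by (simp add: mult.assoc mult_le_cancel_left_pos)
        qed
        finally have 2: "?d powr - \<gamma> \<le> B * w * (1 + ?d powr - \<gamma>)" by (simp add: mult_ac)
        have 3: "1 + ?d powr - \<gamma> \<le> 1 + \<rho> powr - \<gamma> + ?d powr - \<gamma> * indicator (ball x \<rho>) y"
        proof (cases "y \<in> ball x \<rho>")
          case False
          then have "?d powr - \<gamma> \<le> \<rho> powr - \<gamma>" using \<rho> \<gamma> by (intro powr_mono2') (auto simp: dist_norm)
          then show ?thesis using False by simp
        qed simp
        have "?d powr - \<gamma> * M \<le> (B * w * (1 + ?d powr - \<gamma>)) * M" using 2 R by (intro mult_right_mono) auto
        also have "\<dots> \<le> (B * w * (1 + \<rho> powr - \<gamma> + ?d powr - \<gamma> * indicator (ball x \<rho>) y)) * M"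
          using 3 R B w by (intro mult_right_mono mult_left_mono) auto
        finally have 4: "?d powr - \<gamma> * M \<le> M * B * w * (1 + \<rho> powr - \<gamma> + ?d powr - \<gamma> * indicator (ball x \<rho>) y)"
          by (simp add: mult_ac)
        have "ennreal (?d powr - \<gamma>) * (f y * indicator A y) \<le> ennreal (?d powr - \<gamma>) * ennreal M"
          using True AR M[of y] by (intro mult_left_mono) auto
        also have "\<dots> \<le> ennreal (M * B * w * (1 + \<rho> powr - \<gamma> + ?d powr - \<gamma> * indicator (ball x \<rho>) y))"
          using 4 R by (subst ennreal_mult'[symmetric]) (auto intro: ennreal_leI)
        also have "\<dots> = ennreal (M * B * w) * (ennreal (1 + \<rho> powr - \<gamma>) * indicator A y
          + ennreal (norm (x - y) powr - \<gamma>) * indicator (ball x \<rho>) y)"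
          using True R B w pos by (auto simp: ennreal_mult' ennreal_plus indicator_def)
        finally show ?thesis .
      qed simp
    qed
    also have "\<dots> = ennreal (M * B * w) * (ennreal (1 + \<rho> powr - \<gamma>) * emeasure lborel A
          + ennreal (\<rho> powr (real DIM('a) - \<gamma>)) * ennreal j)"
      using nn_integral_kernel_ball[OF \<rho>, of x \<gamma>] unfolding j(2)
      by (subst nn_integral_cmult, measurable, subst nn_integral_add) (auto simp: nn_integral_cmult_indicator)
    also have "\<dots> \<le> ennreal (M * B * w) * (ennreal (1 + \<rho> powr - \<gamma>) * ennreal \<eta> + ennreal (\<rho> powr (real DIM('a) - \<gamma>)) * ennreal j)"
      using A\<eta> by (intro mult_left_mono add_right_mono) auto
    also have "\<dots> = ennreal (M * B * w * (\<delta> + \<rho> powr (real DIM('a) - \<gamma>) * j))"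
      using R B w pos j \<eta> \<delta>
      by (simp add: ennreal_mult'[symmetric] ennreal_plus[symmetric] \<eta>2 del: ennreal_plus)
    also have "\<dots> \<le> ennreal (M * B * w * (\<delta> + \<delta>))"
      using \<rho>j R B w by (intro ennreal_leI mult_left_mono) auto
    also have "M * B * w * (\<delta> + \<delta>) = \<epsilon> * (m * V * w)" using R B by (simp add: \<delta>_def field_simps)
    also have "ennreal \<dots> = ennreal \<epsilon> * ennreal (m * V * w)" using \<epsilon> by (simp add: ennreal_mult')
    also have "\<dots> \<le> ennreal \<epsilon> * riesz_potential \<gamma> f x"
      unfolding V_def w_def using m \<gamma> by (intro mult_left_mono riesz_potential_lower_bound) auto
    finally show ?thesis .
  qed
  with \<eta> show ?thesis using that by blast
qed

section \<open>Positive solutions\<close>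

text \<open>Mean value theorem. Since \<xi> > 1, the factor \<xi>^(a-1) may be replaced by
  \<Theta>^a for every a > 0, without separating a < 1 from a \<ge> 1. It makes the improvement of
  the comparison linear in \<theta> - 1.\<close>

lemma powr_minus_one_le:
  fixes \<theta> \<Theta> a :: real
  assumes "1 \<le> \<theta>" "\<theta> \<le> \<Theta>" "a > 0"
  shows "\<theta> powr a - 1 \<le> a * \<Theta> powr a * (\<theta> - 1)"
proof (cases "\<theta> = 1")
  case False
  then have "1 < \<theta>" using assms by simp
  then have "\<exists>\<xi>>1. \<xi> < \<theta> \<and> \<theta> powr a - 1 powr a = (\<theta> - 1) * (a * \<xi> powr (a - 1))"
    by (intro MVT2) (auto intro!: derivative_eq_intros)
  then obtain \<xi> where \<xi>: "1 < \<xi>" "\<xi> < \<theta>" "\<theta> powr a - 1 = (\<theta> - 1) * (a * \<xi> powr (a - 1))"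
    by auto
  have "\<xi> powr (a - 1) \<le> \<xi> powr a" using \<xi> by (intro powr_mono) auto
  also have "\<dots> \<le> \<Theta> powr a" using \<xi> assms by (intro powr_mono2) auto
  finally have "(\<theta> - 1) * (a * \<xi> powr (a - 1)) \<le> (\<theta> - 1) * (a * \<Theta> powr a)"
    using assms by (intro mult_left_mono) auto
  then show ?thesis using \<xi>(3) by (simp add: mult_ac)
qed simp

lemma AE_lborel_ex:
  "(AE y in (lborel :: 'a::euclidean_space measure). Q y) \<Longrightarrow> \<exists>y. Q y"
  using eventually_happens[of Q "ae_filter (lborel :: 'a measure)"] by (simp add: ae_filter_eq_bot_iff)

text \<open>Positive solutions only, so that the ratio u_r/u makes sense. The bounds on p and q are
  multiplied out because 2n - \<sigma> - p\<nu> and 2n - \<nu> - \<sigma> - q\<nu> are the powers of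
  r/|y-c| left over when the densities are Kelvin transformed: nonnegative, and zero in the critical
  case.\<close>

locale hartree =
  fixes u :: "'a::euclidean_space \<Rightarrow> real" and \<nu> \<sigma> p q K :: real
  assumes cont: "continuous_on UNIV u" and pos: "u x > 0"
    and nu: "0 < \<nu>" "\<nu> < real DIM('a)" and sig: "0 < \<sigma>" "\<sigma> < real DIM('a)"
    and p: "0 < p" "p * \<nu> \<le> 2 * real DIM('a) - \<sigma>"
    and q: "0 < q" "q * \<nu> \<le> 2 * real DIM('a) - \<nu> - \<sigma>"
    and K: "0 < K"
    and eq: "ennreal (u x) = ennreal K * riesz_potential \<nu>
      (\<lambda>y. riesz_potential \<sigma> (\<lambda>z. ennreal (u z powr p)) y * ennreal (u y powr q)) x"
begin

definition up :: "'a \<Rightarrow> ennreal" where "up z = ennreal (u z powr p)"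

definition P :: "'a \<Rightarrow> ennreal" where "P = riesz_potential \<sigma> up"

definition F :: "'a \<Rightarrow> ennreal" where "F y = P y * ennreal (u y powr q)"

text \<open>Real-valued counterpart of \<open>kelvin\<close>, linked to it by
  \<open>kelvin_u\<close>; quotients, suprema and continuity are handled on this side.\<close>

definition ukelvin :: "'a \<Rightarrow> real \<Rightarrow> 'a \<Rightarrow> real" where
  "ukelvin c r y = (r / norm (y - c)) powr \<nu> * u (inversion c r y)"

lemma u_measurable [measurable]: "u \<in> borel_measurable borel"
  using cont by (rule borel_measurable_continuous_onI)

lemma up_measurable [measurable]: "up \<in> borel_measurable borel"
  unfolding up_def[abs_def] by measurable

lemma P_measurable [measurable]: "P \<in> borel_measurable borel"
  unfolding P_def by measurable

lemma F_measurable [measurable]: "F \<in> borel_measurable borel"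
  unfolding F_def[abs_def] by measurable

lemma ukelvin_measurable [measurable]: "ukelvin c r \<in> borel_measurable borel"
  unfolding ukelvin_def[abs_def] by measurable

lemma integral_equation: "ennreal (u x) = ennreal K * riesz_potential \<nu> F x"
  by (subst eq) (simp add: F_def[abs_def] P_def up_def[abs_def])

lemma riesz_potential_F_finite: "riesz_potential \<nu> F x < \<infinity>"
proof -
  have "ennreal K * riesz_potential \<nu> F x < \<infinity>" by (simp add: integral_equation[symmetric])
  then show ?thesis using K by (auto simp: ennreal_mult_less_top less_top)
qed

lemma u_bounds:
  obtains m M where "0 < m" "0 < M" "\<And>y. y \<in> cball c R \<Longrightarrow> m \<le> u y" "\<And>y. y \<in> cball c R \<Longrightarrow> u y \<le> M"
proof -
  have ct: "continuous_on (cball c R) u" using cont by (rule continuous_on_subset) simp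
  show ?thesis
  proof (cases "cball c R = {}")
    case True
    then show ?thesis using that[of 1 1] by simp
  next
    case False
    obtain y0 where "y0 \<in> cball c R" "\<And>y. y \<in> cball c R \<Longrightarrow> u y0 \<le> u y"
      using continuous_attains_inf[OF compact_cball False ct] by blast
    moreover obtain y1 where "y1 \<in> cball c R" "\<And>y. y \<in> cball c R \<Longrightarrow> u y \<le> u y1"
      using continuous_attains_sup[OF compact_cball False ct] by blast
    ultimately show ?thesis using that[of "u y0" "u y1"] pos by blast
  qed
qed

text \<open>A finite outer potential makes F finite almost everywhere, and the factor u^q > 0 cannot
  hide an infinite value of P.\<close>

lemma P_finite_somewhere: "\<exists>y. P y < \<infinity>"
proof -
  have "AE y in lborel. ennreal (norm (0 - y) powr - \<nu>) * F y \<noteq> \<infinity>"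
    using riesz_potential_F_finite[of 0] unfolding riesz_potential_def
    by (intro nn_integral_PInf_AE) auto
  moreover have "AE y in lborel. y \<noteq> (0::'a)" by (rule AE_lborel_singleton)
  ultimately have "AE y in lborel. y \<noteq> (0::'a) \<and> ennreal (norm (0 - y) powr - \<nu>) * F y \<noteq> \<infinity>" by simp
  then obtain y :: 'a where y: "y \<noteq> 0" "ennreal (norm (0 - y) powr - \<nu>) * F y \<noteq> \<infinity>"
    using AE_lborel_ex by blast
  then have "F y \<noteq> \<infinity>" by (auto simp: ennreal_mult_eq_top_iff)
  then have "P y \<noteq> \<infinity>" using pos[of y] by (auto simp: F_def ennreal_mult_eq_top_iff)
  then show ?thesis by (auto simp: less_top)
qed

lemma up_bounds:
  obtains m M where "0 < m" "0 < M" "\<And>y. y \<in> cball c R \<Longrightarrow> ennreal m \<le> up y" "\<And>y. y \<in> cball c R \<Longrightarrow> up y \<le> ennreal M"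
proof -
  obtain m M where b: "0 < m" "0 < M" "\<And>y. y \<in> cball c R \<Longrightarrow> m \<le> u y" "\<And>y. y \<in> cball c R \<Longrightarrow> u y \<le> M"
    by (rule u_bounds[of c R]) (rule that)
  have "ennreal (m powr p) \<le> up y" "up y \<le> ennreal (M powr p)" if "y \<in> cball c R" for y
    using b(3,4)[OF that] b(1) p pos[of y] by (auto simp: up_def intro!: ennreal_leI powr_mono2)
  then show ?thesis using that[of "m powr p" "M powr p"] b by auto
qed

lemma kernel_integrable_sigma: "(\<integral>\<^sup>+y. ennreal (norm y powr - \<sigma>) * indicator (ball (0::'a) 1) y \<partial>lborel) < \<infinity>"
proof -
  obtain y where "riesz_potential \<sigma> up y < \<infinity>" using P_finite_somewhere by (auto simp: P_def)
  moreover obtain m M where "0 < m" "0 < M" "\<And>z. z \<in> cball y 1 \<Longrightarrow> ennreal m \<le> up z"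
      "\<And>z. z \<in> cball y 1 \<Longrightarrow> up z \<le> ennreal M" by (rule up_bounds[of y 1]) (rule that)
  ultimately show ?thesis by (intro nn_integral_kernel_ball_finite[of \<sigma> up y m 1]) auto
qed

lemma P_lower: obtains m where "0 < m" "\<And>y. ennreal (m * (norm (y - c) + 1) powr - \<sigma>) \<le> P y"
proof -
  obtain m M where m: "0 < m" "0 < M" "\<And>z. z \<in> cball c 1 \<Longrightarrow> ennreal m \<le> up z"
      "\<And>z. z \<in> cball c 1 \<Longrightarrow> up z \<le> ennreal M" by (rule up_bounds[of c 1]) (rule that)
  have "ennreal (m * unit_ball_vol (real DIM('a)) * (norm (y - c) + 1) powr - \<sigma>) \<le> P y" for y
    unfolding P_def using m sig by (intro riesz_potential_lower_bound) auto
  then show ?thesis using m by (intro that[of "m * unit_ball_vol (real DIM('a))"]) auto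
qed

text \<open>Finiteness at one point y0 spreads to local boundedness. Close to y the density is
  bounded and the kernel integrable; far from y the kernel seen from y is at most 2^\<sigma> times
  the kernel seen from y0.\<close>

lemma P_upper: obtains M where "0 < M" "\<And>y. y \<in> cball c R \<Longrightarrow> P y \<le> ennreal M"
proof -
  obtain j where j: "j \<ge> 0" "(\<integral>\<^sup>+y. ennreal (norm y powr - \<sigma>) * indicator (ball (0::'a) 1) y \<partial>lborel) = ennreal j"
    using kernel_integrable_sigma by (metis enn2real_nonneg ennreal_enn2real infinity_ennreal_def)
  obtain y0 where y0: "P y0 < \<infinity>" using P_finite_somewhere by blast
  then obtain P0 where P0: "P0 \<ge> 0" "P y0 = ennreal P0" by (metis enn2real_nonneg ennreal_enn2real infinity_ennreal_def)
  \<comment> \<open>If |y-z| \<ge> \<rho>, then |y0-z| \<le> (\<rho> - 1) + |y-z| \<le> 2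
    |y-z|.\<close>
  define \<rho> where "\<rho> = \<bar>R\<bar> + norm (y0 - c) + 1"
  have \<rho>: "\<rho> > 0" by (simp add: \<rho>_def add_nonneg_pos)
  obtain m M where "0 < m" and M: "0 < M" and "\<And>z. z \<in> cball c (\<bar>R\<bar> + \<rho>) \<Longrightarrow> ennreal m \<le> up z"
      and upM: "\<And>z. z \<in> cball c (\<bar>R\<bar> + \<rho>) \<Longrightarrow> up z \<le> ennreal M" by (rule up_bounds[of c "\<bar>R\<bar> + \<rho>"]) (rule that)
  \<comment> \<open>The summand 1 makes the bound strictly positive, as the conclusion
    demands.\<close>
  have "P y \<le> ennreal (M * (\<rho> powr (real DIM('a) - \<sigma>) * j) + 2 powr \<sigma> * P0 + 1)" if y: "y \<in> cball c R" for y
  proof -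
    have yR: "norm (y - c) \<le> \<bar>R\<bar>" using y by (auto simp: dist_norm norm_minus_commute)
    have "P y \<le> (\<integral>\<^sup>+z. ennreal M * (ennreal (norm (y - z) powr - \<sigma>) * indicator (ball y \<rho>) z)
        + ennreal (2 powr \<sigma>) * (ennreal (norm (y0 - z) powr - \<sigma>) * up z) \<partial>lborel)"
      unfolding P_def riesz_potential_def
    proof (rule nn_integral_mono_AE, rule eventually_mono[OF AE_lborel_singleton[of y0]])
      fix z assume z: "z \<noteq> y0"
      show "ennreal (norm (y - z) powr - \<sigma>) * up z \<le> ennreal M * (ennreal (norm (y - z) powr - \<sigma>) * indicator (ball y \<rho>) z)
        + ennreal (2 powr \<sigma>) * (ennreal (norm (y0 - z) powr - \<sigma>) * up z)"
      proof (cases "z \<in> ball y \<rho>")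
        case True
        have "norm (z - c) \<le> norm (z - y) + norm (y - c)" using norm_triangle_ineq[of "z - y" "y - c"] by simp
        then have "z \<in> cball c (\<bar>R\<bar> + \<rho>)" using True yR by (auto simp: dist_norm norm_minus_commute)
        then have "ennreal (norm (y - z) powr - \<sigma>) * up z \<le> ennreal (norm (y - z) powr - \<sigma>) * ennreal M"
          by (intro mult_left_mono upM) auto
        then show ?thesis using True by (simp add: mult.commute[of _ "ennreal M"] add_increasing2)
      next
        case False
        then have d: "norm (y - z) \<ge> \<rho>" by (simp add: dist_norm)
        have "norm (y0 - z) \<le> norm (y0 - c) + norm (y - c) + norm (y - z)"
          using norm_triangle_ineq[of "y0 - c" "c - z"] norm_triangle_ineq[of "c - y" "y - z"]
          by (simp add: norm_minus_commute)
        then have "norm (y0 - z) \<le> 2 * norm (y - z)" using d yR by (simp add: \<rho>_def)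
        then have "(2 * norm (y - z)) powr - \<sigma> \<le> norm (y0 - z) powr - \<sigma>"
          using z sig by (intro powr_mono2') auto
        then have "2 powr \<sigma> * (2 powr - \<sigma> * norm (y - z) powr - \<sigma>) \<le> 2 powr \<sigma> * norm (y0 - z) powr - \<sigma>"
          by (simp add: powr_mult)
        then have "norm (y - z) powr - \<sigma> \<le> 2 powr \<sigma> * norm (y0 - z) powr - \<sigma>"
          by (simp add: mult.assoc[symmetric] powr_add[symmetric])
        then have "ennreal (norm (y - z) powr - \<sigma>) * up z \<le> ennreal (2 powr \<sigma> * norm (y0 - z) powr - \<sigma>) * up z"
          by (intro mult_right_mono ennreal_leI) auto
        then show ?thesis using False by (simp add: ennreal_mult_left_assoc)
      qed
    qed
    also have "\<dots> = ennreal M * (ennreal (\<rho> powr (real DIM('a) - \<sigma>)) * ennreal j) + ennreal (2 powr \<sigma>) * P y0"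
      unfolding P_def riesz_potential_def j(2)[symmetric] nn_integral_kernel_ball[OF \<rho>, of y \<sigma>, symmetric]
      by (subst nn_integral_add, measurable, subst nn_integral_cmult, measurable, subst nn_integral_cmult) auto
    also have "\<dots> = ennreal (M * (\<rho> powr (real DIM('a) - \<sigma>) * j) + 2 powr \<sigma> * P0)"
      using M j P0 by (simp add: ennreal_mult'[symmetric])
    also have "\<dots> \<le> ennreal (M * (\<rho> powr (real DIM('a) - \<sigma>) * j) + 2 powr \<sigma> * P0 + 1)"
      by (intro ennreal_leI) simp
    finally show ?thesis .
  qed
  moreover have "M * (\<rho> powr (real DIM('a) - \<sigma>) * j) + 2 powr \<sigma> * P0 + 1 > 0"
    using M j P0 by (intro add_nonneg_pos add_nonneg_nonneg mult_nonneg_nonneg) auto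
  ultimately show ?thesis using that by blast
qed

lemma P_finite: "P y < \<infinity>"
  using P_upper[of y 0] by (metis centre_in_cball ennreal_less_top infinity_ennreal_def order_le_less_trans order.refl)

lemma P_pos: "P y > 0"
proof -
  obtain m where "0 < m" "\<And>y. ennreal (m * (norm (y - 0) + 1) powr - \<sigma>) \<le> P y" by (rule P_lower[of 0]) (rule that)
  moreover have "norm y + 1 \<noteq> 0" using norm_ge_zero[of y] by linarith
  ultimately have "0 < ennreal (m * (norm (y - 0) + 1) powr - \<sigma>)" by simp
  also have "\<dots> \<le> P y" by fact
  finally show ?thesis .
qed

lemma F_bounds:
  obtains m M where "0 < m" "0 < M" "\<And>y. y \<in> cball c R \<Longrightarrow> ennreal m \<le> F y" "\<And>y. y \<in> cball c R \<Longrightarrow> F y \<le> ennreal M"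
proof -
  obtain m M where b: "0 < m" "0 < M" "\<And>y. y \<in> cball c R \<Longrightarrow> m \<le> u y" "\<And>y. y \<in> cball c R \<Longrightarrow> u y \<le> M"
    by (rule u_bounds[of c R]) (rule that)
  obtain m' where m': "0 < m'" "\<And>y. ennreal (m' * (norm (y - c) + 1) powr - \<sigma>) \<le> P y" by (rule P_lower[of c]) (rule that)
  obtain M' where M': "0 < M'" "\<And>y. y \<in> cball c R \<Longrightarrow> P y \<le> ennreal M'" by (rule P_upper[of c R]) (rule that)
  define l where "l = m' * (\<bar>R\<bar> + 1) powr - \<sigma>"
  have l: "l > 0" using m' by (simp add: l_def)
  have "ennreal (l * m powr q) \<le> F y" "F y \<le> ennreal (M' * M powr q)" if y: "y \<in> cball c R" for y
  proof -
    have uq: "m powr q \<le> u y powr q" "u y powr q \<le> M powr q"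
      using b(3,4)[OF y] b(1) q pos[of y] by (auto intro!: powr_mono2)
    have yc: "norm (y - c) + 1 > 0" "norm (y - c) \<le> \<bar>R\<bar>"
      using y norm_ge_zero[of "y - c"] by (auto simp: dist_norm norm_minus_commute add_nonneg_pos simp del: norm_ge_zero)
    then have "l \<le> m' * (norm (y - c) + 1) powr - \<sigma>"
      unfolding l_def using m' sig by (intro mult_left_mono powr_mono2') auto
    then have "ennreal l \<le> P y" using m'(2)[of y] by (meson ennreal_leI order_trans)
    then have "ennreal l * ennreal (m powr q) \<le> F y"
      unfolding F_def using uq by (intro mult_mono ennreal_leI) auto
    then show "ennreal (l * m powr q) \<le> F y" using l by (simp add: ennreal_mult')
    have "F y \<le> ennreal M' * ennreal (M powr q)"
      unfolding F_def using uq M'(2)[OF y] by (intro mult_mono ennreal_leI) auto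
    then show "F y \<le> ennreal (M' * M powr q)" using M' by (simp add: ennreal_mult')
  qed
  then show ?thesis using that[of "l * m powr q" "M' * M powr q"] l b M' by simp
qed

lemma F_finite: "F y < \<infinity>"
  using P_finite[of y] by (simp add: F_def ennreal_mult_less_top)

lemma kernel_integrable_nu: "(\<integral>\<^sup>+y. ennreal (norm y powr - \<nu>) * indicator (ball (0::'a) 1) y \<partial>lborel) < \<infinity>"
proof -
  obtain m M where "0 < m" "0 < M" "\<And>z. z \<in> cball 0 1 \<Longrightarrow> ennreal m \<le> F z"
    "\<And>z. z \<in> cball 0 1 \<Longrightarrow> F z \<le> ennreal M" by (rule F_bounds[of 0 1]) (rule that)
  then show ?thesis by (intro nn_integral_kernel_ball_finite[of \<nu> F 0 m 1] riesz_potential_F_finite) auto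
qed

text \<open>The equation transfers the decay bound of potentials to u. It keeps the bad points of a
  small sphere close to its centre.\<close>

lemma u_lower: obtains m where "0 < m" "\<And>y. m * (norm (y - c) + 1) powr - \<nu> \<le> u y"
proof -
  obtain m M where m: "0 < m" "0 < M" "\<And>z. z \<in> cball c 1 \<Longrightarrow> ennreal m \<le> F z"
    "\<And>z. z \<in> cball c 1 \<Longrightarrow> F z \<le> ennreal M" by (rule F_bounds[of c 1]) (rule that)
  have "K * (m * unit_ball_vol (real DIM('a))) * (norm (y - c) + 1) powr - \<nu> \<le> u y" for y
  proof -
    have "ennreal (m * unit_ball_vol (real DIM('a)) * (norm (y - c) + 1) powr - \<nu>) \<le> riesz_potential \<nu> F y"
      using m nu by (intro riesz_potential_lower_bound) auto
    then have "ennreal K * ennreal (m * unit_ball_vol (real DIM('a)) * (norm (y - c) + 1) powr - \<nu>) \<le> ennreal (u y)"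
      unfolding integral_equation by (rule mult_left_mono) simp
    then show ?thesis using K pos[of y] by (simp add: ennreal_mult'[symmetric] mult.assoc)
  qed
  then show ?thesis using m K by (intro that[of "K * (m * unit_ball_vol (real DIM('a)))"]) auto
qed

text \<open>One threshold \<eta> for both layers of the equation, so that a single measure bound on
  the bad set controls the inner and the outer error.\<close>

lemma small_sets:
  assumes R: "R > 0" and \<epsilon>: "\<epsilon> > 0"
  obtains \<eta> where "\<eta> > 0"
    "\<And>A x. A \<in> sets borel \<Longrightarrow> A \<subseteq> ball c R \<Longrightarrow> emeasure lborel A \<le> ennreal \<eta> \<Longrightarrow>
      riesz_potential \<sigma> (\<lambda>y. up y * indicator A y) x \<le> ennreal \<epsilon> * P x"
    "\<And>A x. A \<in> sets borel \<Longrightarrow> A \<subseteq> ball c R \<Longrightarrow> emeasure lborel A \<le> ennreal \<eta> \<Longrightarrow>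
      riesz_potential \<nu> (\<lambda>y. F y * indicator A y) x \<le> ennreal \<epsilon> * riesz_potential \<nu> F x"
proof -
  obtain m m' where up1: "0 < m" "0 < m'" "\<And>y. y \<in> cball c 1 \<Longrightarrow> ennreal m \<le> up y"
    "\<And>y. y \<in> cball c 1 \<Longrightarrow> up y \<le> ennreal m'" by (rule up_bounds[of c 1]) (rule that)
  obtain M' M where up2: "0 < M'" "0 < M" "\<And>y. y \<in> cball c R \<Longrightarrow> ennreal M' \<le> up y"
    "\<And>y. y \<in> cball c R \<Longrightarrow> up y \<le> ennreal M" by (rule up_bounds[of c R]) (rule that)
  obtain \<eta>1 where 1: "\<eta>1 > 0" "\<And>A x. A \<in> sets borel \<Longrightarrow> A \<subseteq> ball c R \<Longrightarrow> emeasure lborel A \<le> ennreal \<eta>1 \<Longrightarrow>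
      riesz_potential \<sigma> (\<lambda>y. up y * indicator A y) x \<le> ennreal \<epsilon> * P x"
    unfolding P_def
    by (rule riesz_potential_small_set[of up \<sigma> c R M m \<epsilon>])
       (use up1 up2 sig kernel_integrable_sigma R \<epsilon> in auto)
  obtain k k' where F1: "0 < k" "0 < k'" "\<And>y. y \<in> cball c 1 \<Longrightarrow> ennreal k \<le> F y"
    "\<And>y. y \<in> cball c 1 \<Longrightarrow> F y \<le> ennreal k'" by (rule F_bounds[of c 1]) (rule that)
  obtain L' L where F2: "0 < L'" "0 < L" "\<And>y. y \<in> cball c R \<Longrightarrow> ennreal L' \<le> F y"
    "\<And>y. y \<in> cball c R \<Longrightarrow> F y \<le> ennreal L" by (rule F_bounds[of c R]) (rule that)
  obtain \<eta>2 where 2: "\<eta>2 > 0" "\<And>A x. A \<in> sets borel \<Longrightarrow> A \<subseteq> ball c R \<Longrightarrow> emeasure lborel A \<le> ennreal \<eta>2 \<Longrightarrow>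
      riesz_potential \<nu> (\<lambda>y. F y * indicator A y) x \<le> ennreal \<epsilon> * riesz_potential \<nu> F x"
    by (rule riesz_potential_small_set[of F \<nu> c R L k \<epsilon>])
       (use F1 F2 nu kernel_integrable_nu R \<epsilon> in auto)
  show ?thesis
  proof (rule that[of "min \<eta>1 \<eta>2"])
    show "min \<eta>1 \<eta>2 > 0" using 1 2 by simp
  next
    fix A x assume A: "A \<in> sets borel" "A \<subseteq> ball c R" "emeasure lborel A \<le> ennreal (min \<eta>1 \<eta>2)"
    have "emeasure lborel A \<le> ennreal \<eta>1" "emeasure lborel A \<le> ennreal \<eta>2"
      by (rule order_trans[OF A(3)], rule ennreal_leI, simp)+
    then show "riesz_potential \<sigma> (\<lambda>y. up y * indicator A y) x \<le> ennreal \<epsilon> * P x"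
      and "riesz_potential \<nu> (\<lambda>y. F y * indicator A y) x \<le> ennreal \<epsilon> * riesz_potential \<nu> F x"
      using 1(2)[OF A(1,2)] 2(2)[OF A(1,2)] by blast+
  qed
qed

lemma kelvin_u: "kelvin \<nu> c r (\<lambda>x. ennreal (u x)) y = ennreal (ukelvin c r y)"
  by (simp add: kelvin_def ukelvin_def ennreal_mult')

lemma ukelvin_pos: "y \<noteq> c \<Longrightarrow> r > 0 \<Longrightarrow> ukelvin c r y > 0"
  using pos by (simp add: ukelvin_def)

text \<open>To fit its potential the density must be transformed with weight 2n - \<sigma>, whereas
  u^p carries weight p\<nu>. The mismatch is the leftover power of r/|y-c|, at most 1 outside the
  sphere.\<close>

lemma kelvin_up:
  assumes "y \<noteq> c" "r > 0"
  shows "kelvin (2 * real DIM('a) - \<sigma>) c r up y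
    = ennreal ((r / norm (y - c)) powr (2 * real DIM('a) - \<sigma> - p * \<nu>) * ukelvin c r y powr p)"
proof -
  have "(r / norm (y - c)) powr (2 * real DIM('a) - \<sigma>)
    = (r / norm (y - c)) powr (2 * real DIM('a) - \<sigma> - p * \<nu>) * ((r / norm (y - c)) powr \<nu>) powr p"
    by (simp add: powr_powr powr_add[symmetric] mult.commute)
  then show ?thesis
    using assms pos[of "inversion c r y"]
    by (simp add: kelvin_def up_def ukelvin_def powr_mult ennreal_mult'[symmetric] mult.assoc)
qed

lemma kelvin_F:
  assumes "y \<noteq> c" "r > 0"
  shows "kelvin (2 * real DIM('a) - \<nu>) c r F y = kelvin \<sigma> c r P y
    * ennreal ((r / norm (y - c)) powr (2 * real DIM('a) - \<nu> - \<sigma> - q * \<nu>) * ukelvin c r y powr q)"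
proof -
  have "(r / norm (y - c)) powr (2 * real DIM('a) - \<nu>)
    = (r / norm (y - c)) powr \<sigma> * ((r / norm (y - c)) powr (2 * real DIM('a) - \<nu> - \<sigma> - q * \<nu>) * ((r / norm (y - c)) powr \<nu>) powr q)"
    by (simp add: powr_powr powr_add[symmetric] mult.commute)
  then show ?thesis
    using assms pos[of "inversion c r y"]
    by (simp add: kelvin_def F_def ukelvin_def powr_mult ennreal_mult' mult_ac)
qed

lemma kelvin_P:
  assumes "y \<noteq> c" "r > 0"
  shows "kelvin \<sigma> c r P y = riesz_potential \<sigma> (kelvin (2 * real DIM('a) - \<sigma>) c r up) y"
  unfolding P_def using assms by (intro kelvin_riesz_potential) auto

lemma kelvin_integral_equation:
  assumes "y \<noteq> c" "r > 0"
  shows "ennreal (ukelvin c r y) = ennreal K * riesz_potential \<nu> (kelvin (2 * real DIM('a) - \<nu>) c r F) y"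
proof -
  have "ennreal (ukelvin c r y) = kelvin \<nu> c r (\<lambda>x. ennreal K * riesz_potential \<nu> F x) y"
    by (simp add: kelvin_u[symmetric] integral_equation[symmetric])
  also have "\<dots> = ennreal K * kelvin \<nu> c r (riesz_potential \<nu> F) y" by (simp add: kelvin_def mult_ac)
  finally show ?thesis using assms by (simp add: kelvin_riesz_potential)
qed

end

section \<open>Moving spheres\<close>

context hartree
begin

definition bad :: "'a \<Rightarrow> real \<Rightarrow> 'a set" where
  "bad c r = {y. r < norm (y - c) \<and> u y < ukelvin c r y}"

lemma bad_borel [measurable]: "bad c r \<in> sets borel"
  unfolding bad_def by measurable

lemma kelvin_weight_le:
  "0 < r \<Longrightarrow> r \<le> norm (y - c) \<Longrightarrow> 0 \<le> a \<Longrightarrow> (r / norm (y - c)) powr a \<le> 1"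
  by (rule powr_le1) (auto simp: divide_le_eq)

text \<open>The comparison is multiplicative: if \<open>u\<^sub>r \<le> \<theta> u\<close> on the bad set with the least possible \<open>\<theta>\<close>,
  then the integral equation improves this to \<open>u\<^sub>r \<le> (1 + (\<theta> - 1) / 2) u\<close>.\<close>

lemma kelvin_bound_improve:
  assumes r: "r > 0" and \<theta>: "1 \<le> \<theta>" and \<epsilon>: "0 < \<epsilon>" "\<epsilon> \<le> 1"
    and le: "\<And>y. y \<in> bad c r \<Longrightarrow> ukelvin c r y \<le> \<theta> * u y"
    and small_P: "\<And>x. riesz_potential \<sigma> (\<lambda>y. up y * indicator (bad c r) y) x \<le> ennreal \<epsilon> * P x"
    and small_F: "\<And>x. riesz_potential \<nu> (\<lambda>y. F y * indicator (bad c r) y) x \<le> ennreal \<epsilon> * riesz_potential \<nu> F x"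
    and x: "norm (x - c) > r"
  shows "ukelvin c r x \<le> u x * (1 + 2 * \<epsilon> * (\<theta> powr (p + q) - 1))"
proof -
  let ?B = "bad c r"
  let ?s = "\<theta> powr p - 1" and ?t = "\<theta> powr (p + q) - 1"
  have \<theta>p: "1 \<le> \<theta> powr p" and \<theta>q: "1 \<le> \<theta> powr q" and \<theta>pq: "\<theta> powr p \<le> \<theta> powr (p + q)"
    using \<theta> p q by (auto intro: ge_one_powr_ge_zero powr_mono)
  have in_bad: "ukelvin c r y \<le> u y" if "norm (y - c) > r" "y \<notin> ?B" for y
    using that by (auto simp: bad_def)
  have up_le: "kelvin (2 * real DIM('a) - \<sigma>) c r up y \<le> up y + ennreal ?s * (up y * indicator ?B y)"
    if y: "norm (y - c) > r" for y
  proof -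
    have yc: "y \<noteq> c" using y r by auto
    have "kelvin (2 * real DIM('a) - \<sigma>) c r up y \<le> ennreal (ukelvin c r y powr p)"
      unfolding kelvin_up[OF yc r] using kelvin_weight_le[of r y c "2 * real DIM('a) - \<sigma> - p * \<nu>"] r y p
      by (intro ennreal_leI mult_left_le_one_le) auto
    also have "\<dots> \<le> up y + ennreal ?s * (up y * indicator ?B y)"
    proof (cases "y \<in> ?B")
      case True
      have "ukelvin c r y powr p \<le> (\<theta> * u y) powr p"
        using le[OF True] ukelvin_pos[OF yc r] p by (intro powr_mono2) auto
      also have "\<dots> = u y powr p + ?s * u y powr p"
        by (simp add: powr_mult algebra_simps)
      finally have "ennreal (ukelvin c r y powr p) \<le> ennreal (u y powr p + ?s * u y powr p)" by (rule ennreal_leI)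
      then show ?thesis using True \<theta>p by (simp add: up_def ennreal_mult')
    next
      case False
      then have "ukelvin c r y powr p \<le> u y powr p"
        using in_bad[OF y False] ukelvin_pos[OF yc r] p by (intro powr_mono2) auto
      then show ?thesis using False by (simp add: up_def ennreal_leI)
    qed
    finally show ?thesis .
  qed
  have P_le: "kelvin \<sigma> c r P y \<le> ennreal (1 + \<epsilon> * ?s) * P y" if y: "norm (y - c) > r" for y
  proof -
    have yc: "y \<noteq> c" using y r by auto
    have "kelvin \<sigma> c r P y \<le> riesz_potential \<sigma> up y + riesz_potential \<sigma> (\<lambda>y. ennreal ?s * (up y * indicator ?B y)) y"
      unfolding kelvin_P[OF yc r]
      by (rule riesz_potential_kelvin_le) (use up_le y r sig in auto)
    also have "\<dots> = P y + ennreal ?s * riesz_potential \<sigma> (\<lambda>y. up y * indicator ?B y) y"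
      by (subst riesz_potential_cmult) (auto simp: P_def)
    also have "\<dots> \<le> P y + ennreal ?s * (ennreal \<epsilon> * P y)"
      using small_P by (intro add_left_mono mult_left_mono) auto
    also have "\<dots> = ennreal (1 + \<epsilon> * ?s) * P y"
      using \<theta>p \<epsilon> by (simp add: ennreal_mult' distrib_left mult_ac)
    finally show ?thesis .
  qed
  \<comment> \<open>The enlarged inner potential affects F at every exterior point, but with a
    factor \<epsilon> already in front. The full error \<theta>^(p+q) - 1 occurs on the bad set
    only.\<close>
  have F_le: "kelvin (2 * real DIM('a) - \<nu>) c r F y
      \<le> F y + (ennreal (\<epsilon> * ?s) * F y + ennreal ?t * (F y * indicator ?B y))"
    if y: "norm (y - c) > r" for y
  proof -
    have yc: "y \<noteq> c" using y r by auto
    have "kelvin (2 * real DIM('a) - \<nu>) c r F y \<le> kelvin \<sigma> c r P y * ennreal (ukelvin c r y powr q)"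
      unfolding kelvin_F[OF yc r] using kelvin_weight_le[of r y c "2 * real DIM('a) - \<nu> - \<sigma> - q * \<nu>"] r y q
      by (intro mult_left_mono ennreal_leI mult_left_le_one_le) auto
    also have "\<dots> \<le> ennreal (1 + \<epsilon> * ?s) * P y * ennreal (ukelvin c r y powr q)"
      by (rule mult_right_mono[OF P_le[OF y]]) simp
    also have "\<dots> \<le> F y + (ennreal (\<epsilon> * ?s) * F y + ennreal ?t * (F y * indicator ?B y))"
    proof (cases "y \<in> ?B")
      case True
      have "ukelvin c r y powr q \<le> (\<theta> * u y) powr q"
        using le[OF True] ukelvin_pos[OF yc r] q by (intro powr_mono2) auto
      then have "ukelvin c r y powr q \<le> \<theta> powr q * u y powr q" by (simp add: powr_mult)
      then have "ennreal (1 + \<epsilon> * ?s) * P y * ennreal (ukelvin c r y powr q)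
        \<le> ennreal (1 + \<epsilon> * ?s) * P y * ennreal (\<theta> powr q * u y powr q)"
        by (intro mult_left_mono ennreal_leI) auto
      also have "\<dots> = ennreal ((1 + \<epsilon> * ?s) * \<theta> powr q) * F y"
        using \<theta>p \<epsilon> by (simp add: F_def ennreal_mult' mult_ac)
      also have "\<dots> \<le> ennreal (1 + ?t) * F y"
      proof (intro mult_right_mono ennreal_leI)
        have "1 + \<epsilon> * ?s \<le> \<theta> powr p" using \<epsilon> \<theta>p mult_right_mono[of \<epsilon> 1 ?s] by simp
        then have "(1 + \<epsilon> * ?s) * \<theta> powr q \<le> \<theta> powr p * \<theta> powr q" by (rule mult_right_mono) simp
        then show "(1 + \<epsilon> * ?s) * \<theta> powr q \<le> 1 + ?t" by (simp add: powr_add)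
      qed simp
      also have "\<dots> = F y + ennreal ?t * F y"
        using \<theta>p \<theta>pq by (simp only: ennreal_plus distrib_right) (simp add: distrib_right)
      also have "\<dots> \<le> F y + (ennreal (\<epsilon> * ?s) * F y + ennreal ?t * (F y * indicator ?B y))"
        using True by (intro add_left_mono) simp
      finally show ?thesis .
    next
      case False
      then have "ukelvin c r y powr q \<le> u y powr q"
        using in_bad[OF y False] ukelvin_pos[OF yc r] q by (intro powr_mono2) auto
      then have "ennreal (1 + \<epsilon> * ?s) * P y * ennreal (ukelvin c r y powr q) \<le> ennreal (1 + \<epsilon> * ?s) * P y * ennreal (u y powr q)"
        by (intro mult_left_mono ennreal_leI) auto
      also have "\<dots> = ennreal (1 + \<epsilon> * ?s) * F y" by (simp add: F_def mult.assoc)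
      also have "\<dots> = F y + ennreal (\<epsilon> * ?s) * F y"
        using \<theta>p \<epsilon> by (subst ennreal_plus) (auto simp: distrib_right)
      finally show ?thesis using False by simp
    qed
    finally show ?thesis .
  qed
  have xc: "x \<noteq> c" using x r by auto
  let ?V = "riesz_potential \<nu> F x"
  have "riesz_potential \<nu> (kelvin (2 * real DIM('a) - \<nu>) c r F) x
    \<le> ?V + riesz_potential \<nu> (\<lambda>y. ennreal (\<epsilon> * ?s) * F y + ennreal ?t * (F y * indicator ?B y)) x"
    by (rule riesz_potential_kelvin_le) (use F_le x r nu in auto)
  also have "riesz_potential \<nu> (\<lambda>y. ennreal (\<epsilon> * ?s) * F y + ennreal ?t * (F y * indicator ?B y)) x
    = ennreal (\<epsilon> * ?s) * ?V + ennreal ?t * riesz_potential \<nu> (\<lambda>y. F y * indicator ?B y) x"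
    by (subst riesz_potential_add, measurable, subst riesz_potential_cmult, measurable, subst riesz_potential_cmult) auto
  also have "?V + (ennreal (\<epsilon> * ?s) * ?V + ennreal ?t * riesz_potential \<nu> (\<lambda>y. F y * indicator ?B y) x)
    \<le> ?V + (ennreal (\<epsilon> * ?t) * ?V + ennreal ?t * (ennreal \<epsilon> * ?V))"
    using small_F \<theta>pq \<epsilon> by (intro add_left_mono add_mono mult_right_mono mult_left_mono ennreal_leI) auto
  \<comment> \<open>The factor 2 collects one \<epsilon> from the inner layer and one from the
    smallness of the bad set in the outer layer.\<close>
  also have "\<dots> = ennreal (1 + 2 * \<epsilon> * ?t) * ?V"
  proof -
    have "1 + 2 * \<epsilon> * ?t = 1 + (\<epsilon> * ?t + ?t * \<epsilon>)" by simp
    moreover have "0 \<le> ?t" using \<theta>p \<theta>pq by simp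
    ultimately show ?thesis using \<epsilon>
      by (simp only: ennreal_plus ennreal_mult' distrib_right mult.assoc mult_nonneg_nonneg add_nonneg_nonneg
          less_imp_le zero_le_one ennreal_1 mult_1)
  qed
  finally have "ennreal K * riesz_potential \<nu> (kelvin (2 * real DIM('a) - \<nu>) c r F) x
    \<le> ennreal K * (ennreal (1 + 2 * \<epsilon> * ?t) * ?V)" by (rule mult_left_mono) simp
  then have "ennreal (ukelvin c r x) \<le> ennreal (1 + 2 * \<epsilon> * ?t) * ennreal (u x)"
    unfolding kelvin_integral_equation[OF xc r] integral_equation by (simp only: mult.left_commute)
  also have "\<dots> = ennreal (u x * (1 + 2 * \<epsilon> * ?t))"
    using pos[of x] by (simp only: ennreal_mult' less_imp_le mult.commute)
  finally show ?thesis
    using pos[of x] \<theta>p \<theta>pq \<epsilon> by (subst (asm) ennreal_le_iff) auto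
qed

text \<open>The least \<theta> is finite: reflected points lie in \<open>cball c \<Lambda>\<close>,
  so u_r \<le> M, while u \<ge> m on the ball containing the bad set. If it exceeded 1, the
  improvement would bound all ratios by 1 + (\<theta> - 1)/2 < \<theta>, so the supremum need not be
  attained. The threshold \<eta> is chosen before r and can be kept fixed while the sphere
  moves.\<close>

lemma bad_empty_if_small:
  assumes \<Lambda>: "\<Lambda> > 0" and R: "R > 0"
  obtains \<eta> where "\<eta> > 0"
    "\<And>r. 0 < r \<Longrightarrow> r \<le> \<Lambda> \<Longrightarrow> bad c r \<subseteq> ball c R \<Longrightarrow> emeasure lborel (bad c r) \<le> ennreal \<eta> \<Longrightarrow> bad c r = {}"
proof -
  obtain m1 M where M: "0 < m1" "0 < M" "\<And>y. y \<in> cball c \<Lambda> \<Longrightarrow> m1 \<le> u y" "\<And>y. y \<in> cball c \<Lambda> \<Longrightarrow> u y \<le> M"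
    by (rule u_bounds[of c \<Lambda>]) (rule that)
  obtain m M1 where m: "0 < m" "0 < M1" "\<And>y. y \<in> cball c R \<Longrightarrow> m \<le> u y" "\<And>y. y \<in> cball c R \<Longrightarrow> u y \<le> M1"
    by (rule u_bounds[of c R]) (rule that)
  define \<Theta> where "\<Theta> = M / m"
  have \<Theta>: "\<Theta> > 0" using M m by (simp add: \<Theta>_def)
  define C where "C = (p + q) * \<Theta> powr (p + q)"
  have C: "C > 0" using \<Theta> p q by (simp add: C_def)
  \<comment> \<open>Gives 2 \<epsilon> C \<le> 1/2, the halving of \<theta> - 1; the bound
    \<epsilon> \<le> 1 is demanded by \<open>kelvin_bound_improve\<close>.\<close>
  define \<epsilon> where "\<epsilon> = min 1 (1 / (4 * C))"
  have \<epsilon>: "0 < \<epsilon>" "\<epsilon> \<le> 1" and \<epsilon>C: "\<epsilon> * C \<le> 1 / 4"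
    using C by (auto simp: \<epsilon>_def min_def field_simps)
  obtain \<eta> where \<eta>: "\<eta> > 0"
    "\<And>A x. A \<in> sets borel \<Longrightarrow> A \<subseteq> ball c R \<Longrightarrow> emeasure lborel A \<le> ennreal \<eta> \<Longrightarrow>
      riesz_potential \<sigma> (\<lambda>y. up y * indicator A y) x \<le> ennreal \<epsilon> * P x"
    "\<And>A x. A \<in> sets borel \<Longrightarrow> A \<subseteq> ball c R \<Longrightarrow> emeasure lborel A \<le> ennreal \<eta> \<Longrightarrow>
      riesz_potential \<nu> (\<lambda>y. F y * indicator A y) x \<le> ennreal \<epsilon> * riesz_potential \<nu> F x"
    by (rule small_sets[OF R \<epsilon>(1), of c]) (rule that)
  have "bad c r = {}"
    if r: "0 < r" "r \<le> \<Lambda>" and sub: "bad c r \<subseteq> ball c R" and meas: "emeasure lborel (bad c r) \<le> ennreal \<eta>" for r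
  proof (rule ccontr)
    assume ne: "bad c r \<noteq> {}"
    define \<theta> where "\<theta> = (SUP y\<in>bad c r. ukelvin c r y / u y)"
    have bound: "ukelvin c r y / u y \<le> \<Theta>" if y: "y \<in> bad c r" for y
    proof -
      have yr: "norm (y - c) > r" using y by (simp add: bad_def)
      then have yc: "y \<noteq> c" using r by auto
      have "r * r \<le> r * norm (y - c)" using yr r by (intro mult_left_mono) auto
      then have "norm (inversion c r y - c) \<le> r" using yr r yc by (simp add: norm_inversion divide_le_eq power2_eq_square)
      then have "u (inversion c r y) \<le> M" using r by (intro M) (auto simp: dist_norm norm_minus_commute)
      moreover have "(r / norm (y - c)) powr \<nu> \<le> 1" using yr r nu by (intro kelvin_weight_le) auto
      ultimately have "ukelvin c r y \<le> 1 * M"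
        unfolding ukelvin_def using pos less_imp_le by (intro mult_mono) auto
      moreover have "m \<le> u y" using y sub by (intro m) (auto simp: subset_iff)
      ultimately show ?thesis unfolding \<Theta>_def using m M by (intro frac_le) auto
    qed
    then have bdd: "bdd_above ((\<lambda>y. ukelvin c r y / u y) ` bad c r)" by (intro bdd_aboveI2)
    have le_\<theta>: "ukelvin c r y / u y \<le> \<theta>" if "y \<in> bad c r" for y
      unfolding \<theta>_def using that bdd by (intro cSUP_upper)
    obtain y0 where y0: "y0 \<in> bad c r" using ne by blast
    then have "1 < ukelvin c r y0 / u y0" using pos[of y0] by (simp add: bad_def)
    then have \<theta>1: "1 < \<theta>" using le_\<theta>[OF y0] by simp
    have \<theta>\<Theta>: "\<theta> \<le> \<Theta>" unfolding \<theta>_def using ne bound by (intro cSUP_least)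
    have improve: "ukelvin c r y / u y \<le> 1 + (\<theta> - 1) / 2" if y: "y \<in> bad c r" for y
    proof -
      have "ukelvin c r y \<le> u y * (1 + 2 * \<epsilon> * (\<theta> powr (p + q) - 1))"
      proof (rule kelvin_bound_improve)
        show "ukelvin c r z \<le> \<theta> * u z" if "z \<in> bad c r" for z
          using le_\<theta>[OF that] pos[of z] by (simp add: divide_le_eq)
      qed (use y r \<epsilon> \<theta>1 \<eta>(2,3)[OF bad_borel sub meas] in \<open>auto simp: bad_def\<close>)
      also have "\<dots> \<le> u y * (1 + 2 * \<epsilon> * (C * (\<theta> - 1)))"
        using powr_minus_one_le[of \<theta> \<Theta> "p + q"] \<theta>1 \<theta>\<Theta> p q \<epsilon> pos[of y]
        by (intro mult_left_mono add_left_mono) (auto simp: C_def)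
      also have "2 * \<epsilon> * (C * (\<theta> - 1)) \<le> (\<theta> - 1) / 2"
        proof -
          have "2 * \<epsilon> * (C * (\<theta> - 1)) = (\<epsilon> * C) * (2 * (\<theta> - 1))" by simp
          also have "\<dots> \<le> (1 / 4) * (2 * (\<theta> - 1))" using \<epsilon>C \<theta>1 by (intro mult_right_mono) auto
          finally show ?thesis by simp
        qed
      finally show ?thesis using pos[of y] by (simp add: divide_le_eq mult.commute)
    qed
    then have "\<theta> \<le> 1 + (\<theta> - 1) / 2" unfolding \<theta>_def[symmetric] by (subst (1) \<theta>_def, intro cSUP_least ne)
    then show False using \<theta>1 by (simp add: field_simps)
  qed
  then show ?thesis using that \<eta>(1) by blast
qed

end

text \<open>Sets of full measure are dense; together with continuity this turns almost everywhere
  equalities into pointwise ones.\<close>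

lemma AE_lborel_ex_ball:
  fixes c :: "'a::euclidean_space"
  assumes "AE y in lborel. Q y" "r > 0"
  shows "\<exists>y\<in>ball c r. Q y"
proof (rule ccontr)
  assume "\<not> ?thesis"
  then have "AE y in lborel. y \<notin> ball c r" using assms(1) by (auto elim!: eventually_mono)
  then have "emeasure lborel (ball c r) = 0" by (subst (asm) AE_iff_measurable[of "ball c r"]) auto
  moreover have "0 < unit_ball_vol (real DIM('a)) * r ^ DIM('a)" using assms(2) by (simp add: unit_ball_vol_pos)
  ultimately show False using assms(2) by (simp only: emeasure_ball less_imp_le ennreal_eq_0_iff not_le[symmetric]) blast
qed

context hartree
begin

lemma tendsto_ukelvin_radius:
  assumes "y \<noteq> c" "r > 0"
  shows "((\<lambda>t. ukelvin c t y) \<longlongrightarrow> ukelvin c r y) (at r)"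
proof -
  have "continuous_on {0<..} (\<lambda>t. ukelvin c t y)"
    unfolding ukelvin_def inversion_def using assms
    by (intro continuous_intros continuous_on_compose2[OF cont]) auto
  then have "isCont (\<lambda>t. ukelvin c t y) r"
    using assms by (simp add: continuous_on_eq_continuous_at)
  then show ?thesis by (simp add: isCont_def)
qed

lemma continuous_on_ukelvin: "r > 0 \<Longrightarrow> continuous_on (- {c}) (ukelvin c r)"
  unfolding ukelvin_def[abs_def] inversion_def
  by (intro continuous_intros continuous_on_compose2[OF cont]) auto

text \<open>For fixed y the inequality u_t(y) \<le> u(y) is closed in t, and a point outside the
  sphere of radius r is outside all smaller ones, so t may tend to r from below.\<close>

lemma bad_empty_limit:
  assumes "\<And>t. 0 < t \<Longrightarrow> t < r \<Longrightarrow> bad c t = {}" "r > 0"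
  shows "bad c r = {}"
proof -
  have "ukelvin c r y \<le> u y" if y: "norm (y - c) > r" for y
  proof (rule tendsto_upperbound)
    show "((\<lambda>t. ukelvin c t y) \<longlongrightarrow> ukelvin c r y) (at_left r)"
      using y assms(2) by (intro tendsto_within_subset[OF tendsto_ukelvin_radius]) auto
    have "\<forall>\<^sub>F t in at_left r. 0 < t \<and> t < r"
      using assms(2) eventually_at_left_field by fastforce
    then show "\<forall>\<^sub>F t in at_left r. ukelvin c t y \<le> u y"
    proof (rule eventually_mono)
      fix t assume t: "0 < t \<and> t < r"
      then have "y \<notin> bad c t" using assms(1) by auto
      then show "ukelvin c t y \<le> u y" using y t by (auto simp: bad_def)
    qed
  qed simp
  then show ?thesis by (fastforce simp: bad_def)
qed

section \<open>Starting the spheres\<close>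

text \<open>At a bad point with d = |y-c| the bounds for u give m (d+1)^-\<nu> < (r/d)^\<nu> M, that
  is d < r C (d+1). For r C \<le> 1/2 the term r C d is absorbed and d \<le> 2 C r, so the bad set
  shrinks to the centre with r.\<close>

lemma bad_empty_small_radius: "\<exists>r0>0. \<forall>r. 0 < r \<and> r \<le> r0 \<longrightarrow> bad c r = {}"
proof -
  obtain m1 M where M: "0 < m1" "0 < M" "\<And>y. y \<in> cball c 1 \<Longrightarrow> m1 \<le> u y" "\<And>y. y \<in> cball c 1 \<Longrightarrow> u y \<le> M"
    by (rule u_bounds[of c 1]) (rule that)
  obtain m where m: "0 < m" "\<And>y. m * (norm (y - c) + 1) powr - \<nu> \<le> u y"
    by (rule u_lower[of c]) (rule that)
  obtain \<eta> where \<eta>: "\<eta> > 0"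
    "\<And>r. 0 < r \<Longrightarrow> r \<le> 1 \<Longrightarrow> bad c r \<subseteq> ball c 2 \<Longrightarrow> emeasure lborel (bad c r) \<le> ennreal \<eta> \<Longrightarrow> bad c r = {}"
    by (rule bad_empty_if_small[of 1 2 c]) (use that in auto)
  define V where "V = unit_ball_vol (real DIM('a))"
  have V: "V > 0" by (simp add: V_def unit_ball_vol_pos)
  define C where "C = (M / m) powr (1 / \<nu>)"
  have C: "C > 0" using M m by (simp add: C_def)
  \<comment> \<open>In order: r \<le> 1 keeps reflected points in the unit ball, where u \<le> M; r
    C \<le> 1/2 allows the absorption and, since then 2 C r \<le> 1, permits dropping the power n in
    the volume; the last term makes the volume at most \<eta>.\<close>
  define r0 where "r0 = min (min 1 (1 / (2 * C))) (\<eta> / (2 * C * V))"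
  have r0: "r0 > 0" using C V \<eta> by (simp add: r0_def)
  have "bad c r = {}" if r: "0 < r" "r \<le> r0" for r
  proof -
    have r1: "r \<le> 1" "r * C \<le> 1 / 2" "V * (2 * C * r) \<le> \<eta>"
      using r C V by (auto simp: r0_def field_simps)
    have near: "norm (y - c) \<le> 2 * C * r" if y: "y \<in> bad c r" for y
    proof -
      let ?d = "norm (y - c)"
      have d: "r < ?d" "u y < ukelvin c r y" using y by (auto simp: bad_def)
      then have yc: "y \<noteq> c" using r by auto
      have "r * r \<le> 1 * ?d" using d r r1 by (intro mult_mono) auto
      then have "norm (inversion c r y - c) \<le> 1" using yc by (simp add: norm_inversion divide_le_eq power2_eq_square)
      then have "u (inversion c r y) \<le> M" by (intro M) (auto simp: dist_norm norm_minus_commute)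
      then have "ukelvin c r y \<le> (r / ?d) powr \<nu> * M" unfolding ukelvin_def by (intro mult_left_mono) auto
      with m(2)[of y] d have lt: "m * (?d + 1) powr - \<nu> < (r / ?d) powr \<nu> * M" by linarith
      have "((?d / r) / (?d + 1)) powr \<nu> = (?d / r) powr \<nu> * (?d + 1) powr - \<nu>"
        using d r by (subst powr_divide) (auto simp: powr_minus divide_inverse)
      also have "\<dots> * m < (?d / r) powr \<nu> * ((r / ?d) powr \<nu> * M)"
      proof -
        have "(?d / r) powr \<nu> > 0" using d r yc by simp
        from mult_strict_left_mono[OF lt this] show ?thesis by (simp add: mult_ac)
      qed
      also have "\<dots> = M"
      proof -
        have "(?d / r) powr \<nu> * (r / ?d) powr \<nu> = ((?d / r) * (r / ?d)) powr \<nu>"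
          by (simp only: powr_mult)
        also have "(?d / r) * (r / ?d) = 1" using d r yc by simp
        finally show ?thesis by (simp only: mult.assoc[symmetric]) simp
      qed
      finally have "((?d / r) / (?d + 1)) powr \<nu> < M / m" using m by (simp add: less_divide_eq)
      also have "M / m = C powr \<nu>" using nu M m by (simp add: C_def powr_powr)
      finally have "(?d / r) / (?d + 1) < C" by (rule powr_less_cancel2[rotated -1]) (use nu C d r in \<open>auto simp: yc intro!: divide_pos_pos mult_pos_pos add_nonneg_pos\<close>)
      then have "?d < r * C * (?d + 1)" using d r by (simp add: divide_less_eq mult_ac)
      also have "\<dots> \<le> r * C + 1 / 2 * ?d" using mult_right_mono[OF r1(2), of ?d] by (simp add: distrib_left)
      finally show ?thesis by (simp add: mult_ac)
    qed
    have "bad c r \<subseteq> ball c 2"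
    proof
      fix y assume "y \<in> bad c r"
      from near[OF this] r1(2) have "norm (y - c) < 2" by (simp add: mult_ac)
      then show "y \<in> ball c 2" by (simp add: dist_norm norm_minus_commute)
    qed
    moreover have "emeasure lborel (bad c r) \<le> ennreal \<eta>"
    proof -
      have "bad c r \<subseteq> cball c (2 * C * r)" using near by (auto simp: dist_norm norm_minus_commute)
      then have "emeasure lborel (bad c r) \<le> emeasure lborel (cball c (2 * C * r))"
        by (intro emeasure_mono) auto
      also have "\<dots> = ennreal (V * (2 * C * r) ^ DIM('a))" using C r by (simp add: emeasure_cball V_def)
      also have "\<dots> \<le> ennreal (V * (2 * C * r))"
        using power_decreasing[of 1 "DIM('a)" "2 * C * r"] r1(2) C r V
        by (intro ennreal_leI mult_left_mono) (auto simp: mult_ac DIM_ge_Suc0)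
      also have "\<dots> \<le> ennreal \<eta>" using r1(3) by (rule ennreal_leI)
      finally show ?thesis .
    qed
    ultimately show ?thesis using \<eta>(2) r r1 by blast
  qed
  then show ?thesis using r0 by blast
qed

section \<open>One-sided comparison on a sphere without bad points\<close>

context
  fixes c r assumes bad: "bad c r = {}" and r: "r > 0"
begin

lemma ukelvin_le: "norm (y - c) > r \<Longrightarrow> ukelvin c r y \<le> u y"
  using bad by (force simp: bad_def)

lemma kelvin_up_le: assumes y: "norm (y - c) > r" shows "kelvin (2 * real DIM('a) - \<sigma>) c r up y \<le> up y"
proof -
  have yc: "y \<noteq> c" using y r by auto
  have "kelvin (2 * real DIM('a) - \<sigma>) c r up y \<le> ennreal (ukelvin c r y powr p)"
    unfolding kelvin_up[OF yc r] using kelvin_weight_le[of r y c "2 * real DIM('a) - \<sigma> - p * \<nu>"] r y p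
    by (intro ennreal_leI mult_left_le_one_le) auto
  also have "\<dots> \<le> up y"
    unfolding up_def using ukelvin_le[OF y] ukelvin_pos[OF yc r] p by (intro ennreal_leI powr_mono2) auto
  finally show ?thesis .
qed

lemma kelvin_P_le: assumes y: "norm (y - c) > r" shows "kelvin \<sigma> c r P y \<le> P y"
proof -
  have yc: "y \<noteq> c" using y r by auto
  have "kelvin \<sigma> c r P y \<le> riesz_potential \<sigma> up y + riesz_potential \<sigma> (\<lambda>_. 0) y"
    unfolding kelvin_P[OF yc r] by (rule riesz_potential_kelvin_le) (use kelvin_up_le y r sig in auto)
  then show ?thesis by (simp add: P_def riesz_potential_def)
qed

lemma kelvin_F_le: assumes y: "norm (y - c) > r" shows "kelvin (2 * real DIM('a) - \<nu>) c r F y \<le> F y"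
proof -
  have yc: "y \<noteq> c" using y r by auto
  have "(r / norm (y - c)) powr (2 * real DIM('a) - \<nu> - \<sigma> - q * \<nu>) * ukelvin c r y powr q \<le> ukelvin c r y powr q"
    using kelvin_weight_le[of r y c "2 * real DIM('a) - \<nu> - \<sigma> - q * \<nu>"] r y q by (intro mult_left_le_one_le) auto
  also have "\<dots> \<le> u y powr q" using ukelvin_le[OF y] ukelvin_pos[OF yc r] q by (intro powr_mono2) auto
  finally show ?thesis
    unfolding kelvin_F[OF yc r] F_def using kelvin_P_le[OF y] by (intro mult_mono ennreal_leI) auto
qed

end

section \<open>Moving past a sphere on which equality fails\<close>

text \<open>The sets D j exhaust the part of the exterior where the transformed F is strictly
  smaller, so one of them has positive measure. Distance from the sphere is required for the uniform
  kernel ratio, boundedness for estimating the kernel from far away.\<close>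

lemma kelvin_F_gap:
  assumes bad: "bad c r = {}" and r: "r > 0"
    and neq: "\<not> (AE y in lborel. norm (y - c) > r \<longrightarrow> kelvin (2 * real DIM('a) - \<nu>) c r F y = F y)"
  obtains l k \<kappa> D where "l > r" "k > 0" "\<kappa> > 0" "D \<in> sets borel"
    "\<And>y. y \<in> D \<Longrightarrow> l \<le> norm (y - c) \<and> norm (y - c) \<le> k"
    "ennreal \<kappa> \<le> (\<integral>\<^sup>+y. (F y - kelvin (2 * real DIM('a) - \<nu>) c r F y) * indicator D y \<partial>lborel)"
proof -
  let ?kF = "kelvin (2 * real DIM('a) - \<nu>) c r F"
  define D where "D j = {y. r + 1 / real (Suc j) \<le> norm (y - c) \<and> norm (y - c) \<le> real (Suc j) \<and> ?kF y < F y}" for j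
  have D [measurable]: "D j \<in> sets borel" for j unfolding D_def by measurable
  have "\<exists>j. emeasure lborel (D j) \<noteq> 0"
  proof (rule ccontr)
    assume "\<not> ?thesis"
    then have "AE y in lborel. \<forall>j. y \<notin> D j"
      by (intro AE_all_countable[THEN iffD2] allI AE_not_in) (auto simp: null_sets_def)
    then have "AE y in lborel. norm (y - c) > r \<longrightarrow> ?kF y = F y"
    proof (rule eventually_mono)
      fix y assume y: "\<forall>j. y \<notin> D j"
      show "norm (y - c) > r \<longrightarrow> ?kF y = F y"
      proof
        assume yr: "norm (y - c) > r"
        show "?kF y = F y"
        proof (rule ccontr)
          assume "?kF y \<noteq> F y"
          then have lt: "?kF y < F y" using kelvin_F_le[OF bad r yr] by simp
          obtain i where i: "1 / real (Suc i) < norm (y - c) - r"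
            using reals_Archimedean[of "norm (y - c) - r"] yr by (auto simp: inverse_eq_divide)
          obtain j where j: "norm (y - c) < real j" using reals_Archimedean2 by blast
          have "1 / real (Suc (max i j)) \<le> 1 / real (Suc i)" by (intro divide_left_mono) auto
          then have "r + 1 / real (Suc (max i j)) \<le> norm (y - c)" using i by linarith
          moreover have "norm (y - c) \<le> real (Suc (max i j))" using j by linarith
          ultimately have "y \<in> D (max i j)" using lt by (simp add: D_def)
          then show False using y by blast
        qed
      qed
    qed
    then show False using neq by contradiction
  qed
  then obtain j where j: "emeasure lborel (D j) \<noteq> 0" by blast
  let ?I = "\<integral>\<^sup>+y. (F y - ?kF y) * indicator (D j) y \<partial>lborel"
  have "?I \<noteq> 0"
  proof
    assume "?I = 0"
    then have "AE y in lborel. (F y - ?kF y) * indicator (D j) y = 0"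
      by (subst (asm) nn_integral_0_iff_AE) auto
    then have "AE y in lborel. y \<notin> D j"
    proof (rule eventually_mono)
      fix y assume 0: "(F y - ?kF y) * indicator (D j) y = 0"
      show "y \<notin> D j"
      proof
        assume y: "y \<in> D j"
        then have "F y - ?kF y = 0" using 0 by simp
        then have "F y \<le> ?kF y" using F_finite[of y] by (simp add: diff_eq_0_iff_ennreal)
        then show False using y by (auto simp: D_def dest: leD)
      qed
    qed
    then show False using j by (subst (asm) AE_iff_measurable[of "D j"]) auto
  qed
  \<comment> \<open>Finiteness of the integral is left undecided; a positive real lower bound is
    enough, and 1 serves in the infinite case.\<close>
  then obtain \<kappa> where \<kappa>: "\<kappa> > 0" "ennreal \<kappa> \<le> ?I"
  proof (cases "?I = \<infinity>")
    case True
    then show ?thesis using that[of 1] by simp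
  next
    case False
    then have "ennreal (enn2real ?I) = ?I" by (simp add: less_top)
    moreover have "enn2real ?I > 0" using \<open>?I \<noteq> 0\<close> False by (simp add: enn2real_positive_iff less_top zero_less_iff_neq_zero)
    ultimately show ?thesis using that[of "enn2real ?I"] by simp
  qed
  show ?thesis
    by (rule that[of "r + 1 / real (Suc j)" "real (Suc j)" \<kappa> "D j"]) (use \<kappa> in \<open>auto simp: D_def\<close>)
qed

text \<open>Strict folding bounds u - u_r below by a multiple of (|x-c| + k)^-\<nu>. Multiplied by
  |x-c|^\<nu> this stays away from 0 as x goes to infinity, unlike the difference itself, so it can
  absorb a perturbation of the radius at all far points at once.\<close>

lemma u_minus_ukelvin_lower:
  assumes bad: "bad c r = {}" and r: "r > 0"
    and neq: "\<not> (AE y in lborel. norm (y - c) > r \<longrightarrow> kelvin (2 * real DIM('a) - \<nu>) c r F y = F y)"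
    and \<delta>: "\<delta> > 0"
  obtains \<kappa> where "\<kappa> > 0" "\<And>x. norm (x - c) \<ge> r + \<delta> \<Longrightarrow> norm (x - c) powr \<nu> * ukelvin c r x + \<kappa> \<le> norm (x - c) powr \<nu> * u x"
proof -
  let ?kF = "kelvin (2 * real DIM('a) - \<nu>) c r F"
  obtain l k I D where D: "l > r" "k > 0" "I > 0" "D \<in> sets borel"
    "\<And>y. y \<in> D \<Longrightarrow> l \<le> norm (y - c) \<and> norm (y - c) \<le> k"
    "ennreal I \<le> (\<integral>\<^sup>+y. (F y - ?kF y) * indicator D y \<partial>lborel)"
    by (rule kelvin_F_gap[OF bad r neq]) (rule that)
  note [measurable] = D(4)
  \<comment> \<open>One \<theta> has to serve both the points of D and the evaluation point, hence
    the smaller of the two distances.\<close>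
  define l' where "l' = min l (r + \<delta>)"
  have l': "l' > r" using D \<delta> by (simp add: l'_def)
  obtain \<theta> where \<theta>: "0 < \<theta>" "\<theta> < 1" "\<And>x y. x \<noteq> y \<Longrightarrow> norm (x - c) \<ge> l' \<Longrightarrow> norm (y - c) \<ge> l' \<Longrightarrow>
       reflected_kernel \<nu> c r x y \<le> \<theta> * norm (x - y) powr - \<nu>"
    by (rule reflected_kernel_le_strict[OF r nu(1) l', of c]) (rule that)
  \<comment> \<open>The factor d/(d+k) increases with d = |x-c|, so its value at d = r is a lower
    bound throughout the exterior.\<close>
  define \<kappa> where "\<kappa> = K * ((1 - \<theta>) * ((r / (r + k)) powr \<nu> * I))"
  have \<kappa>: "\<kappa> > 0" using K \<theta> D r by (simp add: \<kappa>_def)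
  have "norm (x - c) powr \<nu> * ukelvin c r x + \<kappa> \<le> norm (x - c) powr \<nu> * u x" if x: "norm (x - c) \<ge> r + \<delta>" for x
  proof -
    let ?d = "norm (x - c)"
    have d: "?d > r" "?d > 0" using x \<delta> r by auto
    then have xc: "x \<noteq> c" by auto
    have "ennreal ((?d + k) powr - \<nu>) * ennreal I
      \<le> ennreal ((?d + k) powr - \<nu>) * (\<integral>\<^sup>+y. (F y - ?kF y) * indicator D y \<partial>lborel)"
      by (rule mult_left_mono[OF D(6)]) simp
    also have "\<dots> = (\<integral>\<^sup>+y. ennreal ((?d + k) powr - \<nu>) * ((F y - ?kF y) * indicator D y) \<partial>lborel)"
      by (rule nn_integral_cmult[symmetric]) measurable
    also have "\<dots> \<le> riesz_potential \<nu> (\<lambda>y. (F y - ?kF y) * indicator D y) x"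
      unfolding riesz_potential_def
    proof (rule nn_integral_mono_AE, rule eventually_mono[OF AE_lborel_singleton[of x]])
      fix y assume y: "y \<noteq> x"
      show "ennreal ((?d + k) powr - \<nu>) * ((F y - ?kF y) * indicator D y)
        \<le> ennreal (norm (x - y) powr - \<nu>) * ((F y - ?kF y) * indicator D y)"
      proof (cases "y \<in> D")
        case True
        have "norm (x - y) \<le> ?d + norm (y - c)" using norm_triangle_ineq4[of "x - c" "y - c"] by simp
        then have "norm (x - y) \<le> ?d + k" using D(5)[OF True] by linarith
        then have "(?d + k) powr - \<nu> \<le> norm (x - y) powr - \<nu>" using y nu by (intro powr_mono2') auto
        then show ?thesis by (intro mult_right_mono ennreal_leI) auto
      qed simp
    qed
    finally have low: "ennreal ((?d + k) powr - \<nu> * I) \<le> riesz_potential \<nu> (\<lambda>y. (F y - ?kF y) * indicator D y) x"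
      using D by (simp add: ennreal_mult')
    have "riesz_potential \<nu> ?kF x + ennreal (1 - \<theta>) * riesz_potential \<nu> (\<lambda>y. (F y - ?kF y) * indicator D y) x
      \<le> riesz_potential \<nu> F x"
    proof (rule riesz_potential_kelvin_le_strict)
      show "reflected_kernel \<nu> c r x y \<le> \<theta> * norm (x - y) powr - \<nu>" if "y \<noteq> x" "y \<in> D" for y
        using \<theta>(3)[of x y] that D(5)[of y] x by (auto simp: l'_def)
      show "D \<subseteq> {y. r < norm (y - c)}" using D(1,5) by force
    qed (use kelvin_F_le[OF bad r] r nu d \<theta> in auto)
    with low have "riesz_potential \<nu> ?kF x + ennreal (1 - \<theta>) * ennreal ((?d + k) powr - \<nu> * I) \<le> riesz_potential \<nu> F x"
      by (meson add_left_mono mult_left_mono order_trans zero_le)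
    then have "ennreal K * (riesz_potential \<nu> ?kF x + ennreal (1 - \<theta>) * ennreal ((?d + k) powr - \<nu> * I)) \<le> ennreal (u x)"
      unfolding integral_equation by (rule mult_left_mono) simp
    then have "ennreal (ukelvin c r x) + ennreal (K * ((1 - \<theta>) * ((?d + k) powr - \<nu> * I))) \<le> ennreal (u x)"
      using K \<theta> D by (simp add: distrib_left kelvin_integral_equation[OF xc r] ennreal_mult')
    then have "ukelvin c r x + K * ((1 - \<theta>) * ((?d + k) powr - \<nu> * I)) \<le> u x"
      using K \<theta> D pos[of x] ukelvin_pos[OF xc r] by (simp flip: ennreal_plus)
    then have "?d powr \<nu> * (ukelvin c r x + K * ((1 - \<theta>) * ((?d + k) powr - \<nu> * I))) \<le> ?d powr \<nu> * u x"
      by (rule mult_left_mono) simp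
    moreover have "\<kappa> \<le> ?d powr \<nu> * (K * ((1 - \<theta>) * ((?d + k) powr - \<nu> * I)))"
    proof -
      have "r / (r + k) \<le> ?d / (?d + k)" using r d D by (simp add: field_simps)
      then have "(r / (r + k)) powr \<nu> \<le> (?d / (?d + k)) powr \<nu>" using nu r D by (intro powr_mono2) auto
      also have "\<dots> = ?d powr \<nu> * (?d + k) powr - \<nu>" using d D by (subst powr_divide) (auto simp: powr_minus divide_inverse)
      finally have "K * ((1 - \<theta>) * ((r / (r + k)) powr \<nu> * I)) \<le> K * ((1 - \<theta>) * (?d powr \<nu> * (?d + k) powr - \<nu> * I))"
        using K \<theta> D by (intro mult_left_mono mult_right_mono) auto
      then show ?thesis by (simp add: \<kappa>_def mult_ac)
    qed
    ultimately show ?thesis by (simp add: distrib_left)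
  qed
  with \<kappa> show ?thesis using that by blast
qed

text \<open>Bad points of a slightly larger sphere are confined to a shell of width \<delta>, thin
  enough for its volume to stay below \<eta>; further out the weighted gap \<kappa> exceeds the
  change caused by the radius. The constants are chosen in the order \<eta>, \<delta>, \<kappa>,
  then the admissible increase of the radius.\<close>

lemma bad_empty_continue:
  assumes bad: "bad c r = {}" and r: "r > 0"
    and neq: "\<not> (AE y in lborel. norm (y - c) > r \<longrightarrow> kelvin (2 * real DIM('a) - \<nu>) c r F y = F y)"
  shows "\<exists>\<epsilon>>0. \<forall>t. r \<le> t \<and> t \<le> r + \<epsilon> \<longrightarrow> bad c t = {}"
proof -
  obtain \<eta> where \<eta>: "\<eta> > 0"
    "\<And>t. 0 < t \<Longrightarrow> t \<le> r + 1 \<Longrightarrow> bad c t \<subseteq> ball c (r + 2) \<Longrightarrow> emeasure lborel (bad c t) \<le> ennreal \<eta> \<Longrightarrow> bad c t = {}"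
    by (rule bad_empty_if_small[of "r + 1" "r + 2" c]) (use r that in auto)
  define V where "V = unit_ball_vol (real DIM('a))"
  have V: "V > 0" by (simp add: V_def unit_ball_vol_pos)
  have "((\<lambda>\<delta>. V * ((r + \<delta>) ^ DIM('a) - r ^ DIM('a))) \<longlongrightarrow> V * ((r + 0) ^ DIM('a) - r ^ DIM('a))) (at_right 0)"
    by (intro tendsto_intros)
  then have "\<forall>\<^sub>F \<delta> in at_right 0. V * ((r + \<delta>) ^ DIM('a) - r ^ DIM('a)) < \<eta>"
    using \<eta>(1) by (intro order_tendstoD) auto
  moreover have "\<forall>\<^sub>F \<delta> in at_right 0. (0::real) < \<delta> \<and> \<delta> < 1"
    using eventually_at_right_field zero_less_one by blast
  ultimately have "\<forall>\<^sub>F \<delta> in at_right 0. V * ((r + \<delta>) ^ DIM('a) - r ^ DIM('a)) < \<eta> \<and> 0 < \<delta> \<and> \<delta> < 1"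
    by (rule eventually_conj)
  then obtain \<delta> where \<delta>: "V * ((r + \<delta>) ^ DIM('a) - r ^ DIM('a)) < \<eta>" "0 < \<delta>" "\<delta> < 1"
    using eventually_happens trivial_limit_at_right_real by blast
  obtain \<kappa> where \<kappa>: "\<kappa> > 0" "\<And>x. norm (x - c) \<ge> r + \<delta> \<Longrightarrow> norm (x - c) powr \<nu> * ukelvin c r x + \<kappa> \<le> norm (x - c) powr \<nu> * u x"
    by (rule u_minus_ukelvin_lower[OF bad r neq \<delta>(2)]) (rule that)
  \<comment> \<open>G(t, z) is |y-c|^\<nu> u_t(y) in the coordinate z = (y-c)/|y-c|^2. The domain is
    compact and z = 0 stands for infinity, so uniform continuity bounds the effect of t for all
    distant y simultaneously.\<close>
  define G where "G = (\<lambda>(t, z). t powr \<nu> * u (c + (t\<^sup>2) *\<^sub>R z))"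
  let ?S = "{r..r + 1} \<times> cball (0::'a) (1 / r)"
  have "continuous_on ?S G"
    unfolding G_def split_beta using r
    by (intro continuous_intros continuous_on_compose2[OF cont]) auto
  then have "uniformly_continuous_on ?S G"
    by (intro compact_uniformly_continuous compact_Times) auto
  then obtain \<epsilon> where \<epsilon>: "\<epsilon> > 0" "\<And>a b. a \<in> ?S \<Longrightarrow> b \<in> ?S \<Longrightarrow> dist b a < \<epsilon> \<Longrightarrow> dist (G b) (G a) < \<kappa>"
    unfolding uniformly_continuous_on_def using \<kappa>(1) by metis
  define e where "e = min (min (\<epsilon> / 2) \<delta>) 1"
  have e: "e > 0" "e < \<epsilon>" "e \<le> \<delta>" "e \<le> 1" using \<epsilon> \<delta> by (auto simp: e_def)
  have "bad c t = {}" if t: "r \<le> t" "t \<le> r + e" for t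
  proof -
    have near: "norm (y - c) < r + \<delta>" if y: "y \<in> bad c t" for y
    proof (rule ccontr)
      assume "\<not> norm (y - c) < r + \<delta>"
      then have d: "norm (y - c) \<ge> r + \<delta>" by simp
      let ?d = "norm (y - c)"
      have d0: "?d > 0" "?d \<ge> r" using d r \<delta> by auto
      define z where "z = (1 / ?d\<^sup>2) *\<^sub>R (y - c)"
      have "norm z = 1 / ?d" using d0 by (simp add: z_def power2_eq_square)
      also have "\<dots> \<le> 1 / r" using d0 r by (intro divide_left_mono) auto
      finally have z: "z \<in> cball 0 (1 / r)" by simp
      have uG: "?d powr \<nu> * ukelvin c s y = G (s, z)" if "s > 0" for s
      proof -
        have "?d powr \<nu> * (s / ?d) powr \<nu> = (?d * (s / ?d)) powr \<nu>" by (simp only: powr_mult)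
        also have "?d * (s / ?d) = s" using d0 by simp
        finally show ?thesis by (simp add: G_def ukelvin_def inversion_def z_def mult.assoc[symmetric])
      qed
      have "dist (G (t, z)) (G (r, z)) < \<kappa>"
        using z t e r by (intro \<epsilon>) (auto simp: dist_Pair_Pair dist_real_def)
      then have "G (t, z) < G (r, z) + \<kappa>" by (auto simp: dist_real_def)
      also have "\<dots> \<le> ?d powr \<nu> * u y" using \<kappa>(2)[OF d] uG[OF r] by simp
      finally have "?d powr \<nu> * ukelvin c t y < ?d powr \<nu> * u y" using uG[of t] t r by simp
      then have "ukelvin c t y < u y" using d0 by simp
      then show False using y by (simp add: bad_def)
    qed
    have "bad c t \<subseteq> ball c (r + \<delta>) - ball c r"
      using near t by (fastforce simp: bad_def dist_norm norm_minus_commute)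
    then have sub: "bad c t \<subseteq> ball c (r + 2)" and "emeasure lborel (bad c t) \<le> emeasure lborel (ball c (r + \<delta>) - ball c r)"
      using \<delta> by (auto intro!: emeasure_mono simp: subset_iff)
    note this(2)
    also have "\<dots> = emeasure lborel (ball c (r + \<delta>)) - emeasure lborel (ball c r)"
      using \<delta> by (intro emeasure_Diff) (use r in \<open>auto simp: emeasure_ball\<close>)
    also have "\<dots> = ennreal (V * ((r + \<delta>) ^ DIM('a) - r ^ DIM('a)))"
      using r \<delta> V by (simp add: emeasure_ball V_def[symmetric] ennreal_minus right_diff_distrib)
    also have "\<dots> \<le> ennreal \<eta>" using \<delta>(1) by (intro ennreal_leI) simp
    finally show ?thesis using \<eta>(2)[of t] sub t r e by simp
  qed
  then show ?thesis using e(1) by blast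
qed

end

lemma ex_norm_eq: "l \<ge> 0 \<Longrightarrow> \<exists>y::'a::euclidean_space. norm (y - c) = l"
  using vector_choose_size[of l] by (metis add_diff_cancel_left')

lemma powr_less_one_base: "0 < x \<Longrightarrow> x < 1 \<Longrightarrow> 0 < a \<Longrightarrow> x powr a < (1::real)"
  using powr_less_mono2[of a x 1] by simp

context hartree
begin

section \<open>Equality on a sphere and the stopping alternative\<close>

text \<open>The transformed F is a product of the transformed P, a leftover weight and u_r^q, none
  larger than its counterpart, so equality forces equality of each factor; this settles q. The
  weight belonging to p is hidden inside P: equality of P at one point forces, by strict folding,
  equality of \<open>up\<close> almost everywhere away from the sphere, where a nontrivial weight
  would be below 1.\<close>

lemma kelvin_equality_critical:
  assumes bad: "bad c r = {}" and r: "r > 0"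
    and ae: "AE y in lborel. norm (y - c) > r \<longrightarrow> kelvin (2 * real DIM('a) - \<nu>) c r F y = F y"
  shows "p * \<nu> = 2 * real DIM('a) - \<sigma> \<and> q * \<nu> = 2 * real DIM('a) - \<nu> - \<sigma> \<and> (\<forall>y. y \<noteq> c \<longrightarrow> ukelvin c r y = u y)"
proof -
  let ?a = "2 * real DIM('a) - \<nu> - \<sigma> - q * \<nu>" and ?b = "2 * real DIM('a) - \<sigma> - p * \<nu>"
  let ?w = "\<lambda>y. r / norm (y - c)"
  have split: "kelvin \<sigma> c r P y = P y \<and> ukelvin c r y = u y \<and> ?a = 0"
    if y: "norm (y - c) > r" and eq: "kelvin (2 * real DIM('a) - \<nu>) c r F y = F y" for y
  proof -
    have yc: "y \<noteq> c" using y r by auto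
    have w: "0 < ?w y" "?w y < 1" using y r yc by (auto simp: divide_less_eq)
    obtain P' where P': "P y = ennreal P'" "P' > 0"
      using P_finite[of y] P_pos[of y] by (cases "P y" rule: ennreal_cases) auto
    obtain k where k: "kelvin \<sigma> c r P y = ennreal k" "k \<ge> 0" "k \<le> P'"
      using kelvin_P_le[OF bad r y] P' by (cases "kelvin \<sigma> c r P y" rule: ennreal_cases) (auto simp: top_unique)
    define b where "b = ?w y powr ?a * ukelvin c r y powr q"
    have uk: "ukelvin c r y \<le> u y" "0 < ukelvin c r y" using ukelvin_le[OF bad r y] ukelvin_pos[OF yc r] by auto
    have w1: "?w y powr ?a \<le> 1" using kelvin_weight_le[of r y c ?a] r y q by simp
    have b0: "b > 0" unfolding b_def using uk yc r by (intro mult_pos_pos) auto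
    have b1: "b \<le> ?w y powr ?a * u y powr q" unfolding b_def using uk q by (intro mult_left_mono powr_mono2) auto
    have b2: "b \<le> ukelvin c r y powr q" unfolding b_def using w1 by (intro mult_left_le_one_le) auto
    have b3: "?w y powr ?a * u y powr q \<le> u y powr q" using w1 by (intro mult_left_le_one_le) auto
    have "k * b = P' * u y powr q"
      using eq k P' b0 by (simp add: kelvin_F[OF yc r] F_def b_def[symmetric] ennreal_mult'[symmetric] ennreal_inj)
    moreover have "k * b \<le> P' * b" using k b0 by (intro mult_right_mono) auto
    ultimately have "P' * u y powr q \<le> P' * b" by simp
    then have be: "b = u y powr q" using P' b1 b3 by simp
    then have "k = P'" using \<open>k * b = P' * u y powr q\<close> b0 by simp
    moreover have "ukelvin c r y = u y"
    proof (rule ccontr)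
      assume "ukelvin c r y \<noteq> u y"
      then have "ukelvin c r y powr q < u y powr q" using uk q by (intro powr_less_mono2) auto
      then show False using b2 be by simp
    qed
    moreover have "?a = 0"
    proof (rule ccontr)
      assume "?a \<noteq> 0"
      then have "?w y powr ?a < 1" using w q by (intro powr_less_one_base) auto
      then have "?w y powr ?a * u y powr q < 1 * u y powr q" using pos[of y] by (intro mult_strict_right_mono) auto
      then show False using b1 be by simp
    qed
    ultimately show ?thesis using k P' by simp
  qed
  have near: "\<exists>y\<in>ball y0 \<epsilon>. norm (y - c) > r \<and> kelvin (2 * real DIM('a) - \<nu>) c r F y = F y"
    if y0: "norm (y0 - c) > r" and \<epsilon>: "\<epsilon> > 0" for y0 \<epsilon>
  proof -
    define e where "e = min \<epsilon> (norm (y0 - c) - r)"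
    have e: "e > 0" using that by (simp add: e_def)
    obtain y where y: "y \<in> ball y0 e" "norm (y - c) > r \<longrightarrow> kelvin (2 * real DIM('a) - \<nu>) c r F y = F y"
      using AE_lborel_ex_ball[OF ae e] by blast
    have "norm (y0 - c) \<le> norm (y0 - y) + norm (y - c)" using norm_triangle_ineq[of "y0 - y" "y - c"] by simp
    then have "norm (y - c) > r" using y(1) by (auto simp: e_def dist_norm)
    then show ?thesis using y by (auto simp: e_def)
  qed
  obtain y0 where "norm (y0 - c) = r + 1" using ex_norm_eq[of "r + 1" c] r by auto
  then obtain y1 where y1: "norm (y1 - c) > r" "kelvin (2 * real DIM('a) - \<nu>) c r F y1 = F y1"
    using near[of y0 1] by auto
  have "?a = 0" using split[OF y1] by simp
  moreover have "?b = 0"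
  proof (rule ccontr)
    assume b: "?b \<noteq> 0"
    \<comment> \<open>Strictly between r and |y1-c|: the region avoids the sphere and still contains
      a ball around y1, in which a point of equality can be picked.\<close>
    define l where "l = (r + norm (y1 - c)) / 2"
    have l: "l > r" "l < norm (y1 - c)" using y1 by (simp_all add: l_def)
    obtain \<theta> where \<theta>: "0 < \<theta>" "\<theta> < 1" "\<And>x y. x \<noteq> y \<Longrightarrow> norm (x - c) \<ge> l \<Longrightarrow> norm (y - c) \<ge> l \<Longrightarrow>
       reflected_kernel \<sigma> c r x y \<le> \<theta> * norm (x - y) powr - \<sigma>"
      by (rule reflected_kernel_le_strict[OF r sig(1) l(1), of c]) (rule that)
    let ?D = "{y. l \<le> norm (y - c)}" and ?ku = "kelvin (2 * real DIM('a) - \<sigma>) c r up"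
    have [measurable]: "?D \<in> sets borel" by measurable
    have y1c: "y1 \<noteq> c" using y1 r by auto
    have "riesz_potential \<sigma> ?ku y1 + ennreal (1 - \<theta>) * riesz_potential \<sigma> (\<lambda>y. (up y - ?ku y) * indicator ?D y) y1
      \<le> riesz_potential \<sigma> up y1"
      by (rule riesz_potential_kelvin_le_strict) (use kelvin_up_le[OF bad r] r sig y1 \<theta> l in auto)
    moreover have "riesz_potential \<sigma> ?ku y1 = P y1"
      using split[OF y1] kelvin_P[OF y1c r] by simp
    ultimately have "P y1 + ennreal (1 - \<theta>) * riesz_potential \<sigma> (\<lambda>y. (up y - ?ku y) * indicator ?D y) y1 \<le> P y1 + 0"
      unfolding P_def by simp
    then have "ennreal (1 - \<theta>) * riesz_potential \<sigma> (\<lambda>y. (up y - ?ku y) * indicator ?D y) y1 \<le> 0"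
      using P_finite[of y1] by (subst (asm) ennreal_add_left_cancel_le) auto
    then have "riesz_potential \<sigma> (\<lambda>y. (up y - ?ku y) * indicator ?D y) y1 = 0"
      using \<theta> by (auto simp: ennreal_eq_0_iff)
    then have "AE y in lborel. ennreal (norm (y1 - y) powr - \<sigma>) * ((up y - ?ku y) * indicator ?D y) = 0"
      unfolding riesz_potential_def by (subst (asm) nn_integral_0_iff_AE) auto
    then have "AE y in lborel. y \<noteq> y1 \<longrightarrow> l \<le> norm (y - c) \<longrightarrow> up y - ?ku y = 0"
      by (rule eventually_mono) auto
    then have "AE y in lborel. y \<noteq> y1 \<and> (y \<noteq> y1 \<longrightarrow> l \<le> norm (y - c) \<longrightarrow> up y - ?ku y = 0)"
      using AE_lborel_singleton[of y1] by eventually_elim simp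
    from AE_lborel_ex_ball[OF this, of "norm (y1 - c) - l" y1] l
    obtain y where y: "y \<in> ball y1 (norm (y1 - c) - l)" "l \<le> norm (y - c) \<Longrightarrow> up y - ?ku y = 0"
      by auto
    have "norm (y1 - c) \<le> norm (y1 - y) + norm (y - c)" using norm_triangle_ineq[of "y1 - y" "y - c"] by simp
    then have yl: "l \<le> norm (y - c)" using y(1) by (auto simp: dist_norm)
    then have yr: "norm (y - c) > r" using l by simp
    then have yc: "y \<noteq> c" using r by auto
    have w: "0 < ?w y" "?w y < 1" using yr r yc by (auto simp: divide_less_eq)
    have "up y \<le> ?ku y" using y(2)[OF yl] by (simp add: diff_eq_0_iff_ennreal up_def)
    then have "u y powr p \<le> ?w y powr ?b * ukelvin c r y powr p"
      by (simp add: kelvin_up[OF yc r] up_def)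
    also have "\<dots> \<le> ?w y powr ?b * u y powr p"
      using ukelvin_le[OF bad r yr] ukelvin_pos[OF yc r] p by (intro mult_left_mono powr_mono2) auto
    also have "\<dots> < 1 * u y powr p"
      using w b p pos[of y] by (intro mult_strict_right_mono powr_less_one_base) auto
    finally show False by simp
  qed
  moreover have out: "ukelvin c r y = u y" if y: "norm (y - c) > r" for y
  proof (rule ccontr)
    assume ne: "ukelvin c r y \<noteq> u y"
    have yc: "y \<noteq> c" using y r by auto
    have "continuous_on (- {c}) (\<lambda>y. ukelvin c r y - u y)"
      using r by (intro continuous_on_diff continuous_on_ukelvin continuous_on_subset[OF cont]) auto
    then have "isCont (\<lambda>y. ukelvin c r y - u y) y"
      using yc by (simp add: continuous_on_eq_continuous_at open_Compl)
    then obtain \<epsilon> where \<epsilon>: "\<epsilon> > 0" "\<And>z. dist y z < \<epsilon> \<Longrightarrow> ukelvin c r z - u z \<noteq> 0"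
      using continuous_at_avoid[of y "\<lambda>y. ukelvin c r y - u y" 0] ne by auto
    obtain z where "z \<in> ball y \<epsilon>" "norm (z - c) > r" "kelvin (2 * real DIM('a) - \<nu>) c r F z = F z"
      using near[OF y \<epsilon>(1)] by blast
    then show False using split[of z] \<epsilon>(2)[of z] by simp
  qed
  \<comment> \<open>On the sphere the inversion is the identity; equality inside is equality outside
    read at the reflected point.\<close>
  moreover have "ukelvin c r y = u y" if yc: "y \<noteq> c" for y
  proof -
    consider "norm (y - c) > r" | "norm (y - c) = r" | "norm (y - c) < r" by linarith
    then show ?thesis
    proof cases
      case 2
      then have "inversion c r y = y" using r by (simp add: inversion_def)
      then show ?thesis using 2 r by (simp add: ukelvin_def)
    next
      case 3
      let ?z = "inversion c r y"
      have nz: "norm (?z - c) = r\<^sup>2 / norm (y - c)" using yc by (rule norm_inversion)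
      have "r * norm (y - c) < r * r" using 3 r by (intro mult_strict_left_mono) auto
      then have "norm (?z - c) > r" unfolding nz using yc by (simp add: less_divide_eq power2_eq_square)
      from out[OF this] have "u ?z = (r / norm (?z - c)) powr \<nu> * u y"
        using yc r by (simp add: ukelvin_def inversion_involutive)
      then have "ukelvin c r y = ((r / norm (y - c)) powr \<nu> * (r / norm (?z - c)) powr \<nu>) * u y"
        by (simp add: ukelvin_def)
      also have "(r / norm (y - c)) powr \<nu> * (r / norm (?z - c)) powr \<nu> = ((r / norm (y - c)) * (r / norm (?z - c))) powr \<nu>"
        by (simp only: powr_mult)
      also have "(r / norm (y - c)) * (r / norm (?z - c)) = 1" unfolding nz using yc r by (simp add: power2_eq_square)
      finally show ?thesis by simp
    qed (rule out)
  qed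
  ultimately show ?thesis by simp
qed

text \<open>If some sphere has bad points, the radii up to which there are none have a finite
  supremum L, and the sphere of radius L has none by closedness. Unless equality holds at L, the
  spheres move beyond L, against its choice.\<close>

lemma moving_spheres_dichotomy:
  "(\<forall>r>0. bad c r = {}) \<or>
   (p * \<nu> = 2 * real DIM('a) - \<sigma> \<and> q * \<nu> = 2 * real DIM('a) - \<nu> - \<sigma> \<and> (\<exists>r>0. \<forall>y. y \<noteq> c \<longrightarrow> ukelvin c r y = u y))"
proof (rule ccontr)
  assume "\<not> ?thesis"
  then obtain r1 where r1: "r1 > 0" "bad c r1 \<noteq> {}"
    and no: "\<And>r. r > 0 \<Longrightarrow> \<not> (p * \<nu> = 2 * real DIM('a) - \<sigma> \<and> q * \<nu> = 2 * real DIM('a) - \<nu> - \<sigma> \<and> (\<forall>y. y \<noteq> c \<longrightarrow> ukelvin c r y = u y))"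
    by blast
  define S where "S = {r. 0 < r \<and> (\<forall>t. 0 < t \<and> t \<le> r \<longrightarrow> bad c t = {})}"
  obtain r0 where r0: "r0 > 0" "r0 \<in> S" using bad_empty_small_radius[of c] by (auto simp: S_def)
  have bdd: "bdd_above S"
  proof (rule bdd_aboveI)
    fix r assume "r \<in> S"
    then show "r \<le> r1" using r1 by (auto simp: S_def intro: leI)
  qed
  define L where "L = Sup S"
  have "r0 \<le> L" unfolding L_def using r0 bdd by (intro cSup_upper)
  then have L: "L > 0" using r0 by simp
  have below: "bad c t = {}" if t: "0 < t" "t < L" for t
  proof -
    obtain r where "r \<in> S" "t < r"
      by (rule less_cSupE[of t S]) (use t r0 in \<open>auto simp: L_def\<close>)
    then show ?thesis using t by (auto simp: S_def)
  qed
  have badL: "bad c L = {}" by (rule bad_empty_limit[OF below L])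
  have "\<not> (AE y in lborel. norm (y - c) > L \<longrightarrow> kelvin (2 * real DIM('a) - \<nu>) c L F y = F y)"
    using kelvin_equality_critical[OF badL L] no[OF L] by blast
  then obtain \<epsilon> where \<epsilon>: "\<epsilon> > 0" "\<And>t. L \<le> t \<Longrightarrow> t \<le> L + \<epsilon> \<Longrightarrow> bad c t = {}"
    using bad_empty_continue[OF badL L] by blast
  have "bad c t = {}" if "0 < t" "t \<le> L + \<epsilon>" for t
    using below[of t] \<epsilon>(2)[of t] that by (cases "t < L") simp_all
  then have "L + \<epsilon> \<in> S" using \<epsilon>(1) L by (simp add: S_def)
  then have "L + \<epsilon> \<le> L" unfolding L_def using bdd by (intro cSup_upper)
  then show False using \<epsilon> by simp
qed

text \<open>For \<open>y \<noteq> z\<close>, spheres centred far away on the line through both points exchange them, with a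
  conformal factor tending to 1.\<close>

lemma bad_empty_all_imp_le:
  assumes all: "\<And>c r. r > 0 \<Longrightarrow> bad c r = {}"
  shows "u z \<le> u y"
proof (cases "y = z")
  case False
  let ?D = "norm (y - z)"
  have D: "?D > 0" using False by simp
  have le: "(t / (1 + t)) powr (\<nu> / 2) * u z \<le> u y" if t: "t > 0" for t
  proof -
    \<comment> \<open>Here |z-c| = t |y-z| and |y-c| = (1+t) |y-z|. The inversion exchanges y and z
      since r^2 is the product of these distances, and y lies outside the sphere.\<close>
    define c where "c = z - t *\<^sub>R (y - z)"
    define r where "r = sqrt (t * (1 + t)) * ?D"
    have yc: "y - c = (1 + t) *\<^sub>R (y - z)" by (simp add: c_def algebra_simps)
    have nyc: "norm (y - c) = (1 + t) * ?D" unfolding yc using t by simp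
    have r0: "r > 0" using t D by (simp add: r_def)
    have r2: "r\<^sup>2 = t * (1 + t) * ?D\<^sup>2" using t by (simp add: r_def power_mult_distrib)
    have "t * (1 + t) < (1 + t)\<^sup>2" using t by (simp add: power2_eq_square)
    then have "sqrt (t * (1 + t)) < 1 + t" using t real_sqrt_less_mono[of "t * (1 + t)" "(1 + t)\<^sup>2"] by simp
    then have "r < norm (y - c)" unfolding nyc r_def using D by (rule mult_strict_right_mono)
    then have "ukelvin c r y \<le> u y" using ukelvin_le[OF all[OF r0] r0] by blast
    moreover have "inversion c r y = z"
    proof -
      have "r\<^sup>2 / (norm (y - c))\<^sup>2 = t / (1 + t)"
        unfolding r2 nyc using t D by (simp add: power2_eq_square)
      then have "inversion c r y = c + (t / (1 + t)) *\<^sub>R ((1 + t) *\<^sub>R (y - z))" by (simp only: inversion_def yc)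
      also have "\<dots> = c + t *\<^sub>R (y - z)" using t by simp
      finally show ?thesis by (simp add: c_def)
    qed
    moreover have "(r / norm (y - c)) powr \<nu> = (t / (1 + t)) powr (\<nu> / 2)"
    proof -
      have "r / norm (y - c) = sqrt (t * (1 + t)) / (1 + t)" unfolding nyc using D by (simp add: r_def)
      also have "\<dots> = sqrt (t * (1 + t) / (1 + t)\<^sup>2)" using t by (simp add: real_sqrt_divide)
      also have "t * (1 + t) / (1 + t)\<^sup>2 = t / (1 + t)" using t by (simp add: power2_eq_square)
      finally have "r / norm (y - c) = (t / (1 + t)) powr (1 / 2)" using t by (simp add: powr_half_sqrt)
      then show ?thesis by (simp add: powr_powr)
    qed
    ultimately show ?thesis by (simp add: ukelvin_def)
  qed
  have "((\<lambda>t::real. 1 - 1 / (1 + t)) \<longlongrightarrow> 1 - 0) at_top"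
    by (intro tendsto_intros tendsto_divide_0[OF tendsto_const] filterlim_at_top_imp_at_infinity filterlim_tendsto_add_at_top[OF tendsto_const] filterlim_ident)
  moreover have "\<forall>\<^sub>F t::real in at_top. 1 - 1 / (1 + t) = t / (1 + t)"
    by (rule eventually_mono[OF eventually_gt_at_top[of 0]]) (simp add: field_simps)
  ultimately have "((\<lambda>t::real. (t / (1 + t))) \<longlongrightarrow> 1) at_top"
    by (simp add: tendsto_cong)
  then have "((\<lambda>t::real. (t / (1 + t)) powr (\<nu> / 2) * u z) \<longlongrightarrow> 1 powr (\<nu> / 2) * u z) at_top"
    by (intro tendsto_intros) auto
  then have "1 powr (\<nu> / 2) * u z \<le> u y"
    by (rule tendsto_upperbound) (auto intro!: eventually_mono[OF eventually_gt_at_top[of 0]] le)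
  then show ?thesis by simp
qed simp

text \<open>For constant u the value P 0 is a positive multiple of the integral of |y|^-\<sigma>
  over the whole space, which would be finite and positive. Dilation by 2 multiplies that integral
  by 2^(n-\<sigma>), which is not 1.\<close>

lemma not_bad_empty_all: "\<exists>c r. r > 0 \<and> bad c r \<noteq> {}"
proof (rule ccontr)
  assume "\<not> ?thesis"
  then have none: "bad c r = {}" if "r > 0" for c r using that by blast
  have le: "u z \<le> u y" for y z by (rule bad_empty_all_imp_le[OF none])
  define k where "k = u 0"
  have const: "u y = k" for y unfolding k_def by (intro antisym le)
  let ?J = "\<integral>\<^sup>+y. ennreal (norm (y::'a) powr - \<sigma>) \<partial>lborel"
  have PJ: "P 0 = ennreal (k powr p) * ?J"
  proof -
    have "P 0 = (\<integral>\<^sup>+y. ennreal (k powr p) * ennreal (norm (y::'a) powr - \<sigma>) \<partial>lborel)"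
      unfolding P_def riesz_potential_def up_def by (simp add: const mult.commute)
    then show ?thesis by (simp add: nn_integral_cmult)
  qed
  have "?J \<noteq> \<infinity>" "?J \<noteq> 0" using PJ P_finite[of 0] P_pos[of 0] pos[of 0] by (auto simp: ennreal_mult_less_top)
  then obtain j where j: "?J = ennreal j" "j > 0"
    by (cases ?J rule: ennreal_cases) (auto simp: less_le)
  have "?J = ennreal (2 ^ DIM('a)) * (\<integral>\<^sup>+y. ennreal (norm (0 + 2 *\<^sub>R (y::'a)) powr - \<sigma>) \<partial>lborel)"
    by (rule nn_integral_affine_euclidean) auto
  also have "(\<integral>\<^sup>+y. ennreal (norm (0 + 2 *\<^sub>R (y::'a)) powr - \<sigma>) \<partial>lborel) = ennreal (2 powr - \<sigma>) * ?J"
    by (simp add: powr_mult ennreal_mult' nn_integral_cmult)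
  finally have "ennreal j = ennreal (2 ^ DIM('a) * (2 powr - \<sigma> * j))"
    unfolding j(1) by (simp add: ennreal_mult')
  then have "j = 2 ^ DIM('a) * (2 powr - \<sigma> * j)" using j by (subst (asm) ennreal_inj) auto
  then have "1 = 2 powr real DIM('a) * 2 powr - \<sigma>" using j by (simp add: powr_realpow)
  also have "\<dots> = 2 powr (real DIM('a) - \<sigma>)" by (simp add: powr_add[symmetric])
  finally show False using sig by simp
qed

text \<open>One stopping sphere decides both exponents, so in the subcritical cases no positive
  solution exists.\<close>

lemma critical: "p * \<nu> = 2 * real DIM('a) - \<sigma> \<and> q * \<nu> = 2 * real DIM('a) - \<nu> - \<sigma>"
  using not_bad_empty_all moving_spheres_dichotomy by meson

end

section \<open>Bubbles\<close>

lemma norm_add_scaleR_sq: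
  fixes a b :: "'a::real_inner"
  shows "(norm (a + k *\<^sub>R b))\<^sup>2 = (norm a)\<^sup>2 + 2 * k * (a \<bullet> b) + k\<^sup>2 * (norm b)\<^sup>2"
  unfolding power2_norm_eq_inner by (simp add: inner_add inner_commute[of b a] power2_eq_square[of k] algebra_simps)

text \<open>Difference quotients are bounded by |z|, so the derivative vanishes everywhere.\<close>

lemma quadratic_oscillation_imp_constant:
  fixes \<psi> :: "'a::real_inner \<Rightarrow> real"
  assumes "\<And>x z. \<bar>\<psi> (x + z) - \<psi> x\<bar> \<le> (norm z)\<^sup>2"
  shows "\<psi> x = \<psi> y"
proof -
  have "(\<psi> has_derivative (\<lambda>_. 0)) (at x)" for x
  proof -
    have "((\<lambda>h. norm h) \<longlongrightarrow> 0) (at (0::'a))" by (rule tendsto_norm_zero) (rule tendsto_ident_at)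
    then have "((\<lambda>h. norm (\<psi> (x + h) - \<psi> x - 0) / norm h) \<longlongrightarrow> 0) (at 0)"
    proof (rule Lim_null_comparison[rotated])
      show "\<forall>\<^sub>F h in at 0. norm (norm (\<psi> (x + h) - \<psi> x - 0) / norm h) \<le> norm h"
        unfolding eventually_at_filter using assms[of x]
        by (intro always_eventually allI impI) (simp add: divide_le_eq power2_eq_square)
    qed
    then show ?thesis by (simp add: has_derivative_at)
  qed
  then have "\<exists>c. \<forall>x. \<psi> x = c"
    using has_derivative_zero_constant[of UNIV \<psi>] by auto
  then show ?thesis by metis
qed

text \<open>Let \<open>x\<^sub>0\<close> be a minimum point and \<open>\<psi> x = \<phi> x - |x - x\<^sub>0|\<^sup>2\<close>. Centring the equation at \<open>x\<^sub>0\<close> gives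
  \<open>\<psi> \<ge> 0\<close>; inserting this at an arbitrary centre bounds the oscillation of \<open>\<psi>\<close> quadratically.\<close>

lemma conformal_functional_equation:
  fixes \<phi> :: "'a::euclidean_space \<Rightarrow> real"
  assumes pos: "\<And>x. \<phi> x > 0" and cont: "continuous_on UNIV \<phi>"
    and feq: "\<And>x y. y \<noteq> x \<Longrightarrow> \<phi> x * \<phi> y = (norm (y - x))\<^sup>2 * \<phi> (x + (\<phi> x / (norm (y - x))\<^sup>2) *\<^sub>R (y - x))"
  shows "\<exists>x\<^sub>0 d. d > 0 \<and> (\<forall>x. \<phi> x = d + (norm (x - x\<^sub>0))\<^sup>2)"
proof -
  have "isCont \<phi> 0" using cont by (simp add: continuous_on_eq_continuous_at)
  then have "\<forall>\<^sub>F z in nhds 0. \<phi> z > \<phi> 0 / 2"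
    using pos[of 0] by (intro order_tendstoD(1)[of _ "\<phi> 0"]) (auto simp: isCont_def tendsto_at_iff_tendsto_nhds)
  then obtain \<delta> where \<delta>: "\<delta> > 0" "\<And>z. norm z < \<delta> \<Longrightarrow> \<phi> z > \<phi> 0 / 2"
    by (auto simp: eventually_nhds_metric)
  \<comment> \<open>For |y| > R the reflection of y about 0 lies within \<delta> of 0, where \<phi>
    > \<phi>(0)/2. The functional equation then gives \<phi>(y) > |y|^2/2 \<ge> |y|/2 > \<phi>(0),
    so a minimum over the ball is a global one.\<close>
  define R where "R = \<phi> 0 / \<delta> + 2 * \<phi> 0 + 1"
  have R: "R \<ge> 1" "R \<ge> 2 * \<phi> 0" "R > \<phi> 0 / \<delta>" using \<delta>(1) pos[of 0] by (auto simp: R_def)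
  have large: "\<phi> y > \<phi> 0" if y: "norm y > R" for y
  proof -
    have y0: "y \<noteq> 0" using y R by auto
    let ?z = "0 + (\<phi> 0 / (norm (y - 0))\<^sup>2) *\<^sub>R (y - 0)"
    have "norm ?z = \<phi> 0 / norm y" using y0 pos[of 0] by (simp add: power2_eq_square)
    also have "\<dots> < \<delta>"
    proof -
      have "\<phi> 0 < norm y * \<delta>" using R(3) y \<delta>(1) by (smt (verit) pos_divide_less_eq)
      then show ?thesis using y0 by (simp add: divide_less_eq mult.commute)
    qed
    finally have "\<phi> ?z > \<phi> 0 / 2" by (rule \<delta>(2))
    then have "(norm y)\<^sup>2 * (\<phi> 0 / 2) < (norm y)\<^sup>2 * \<phi> ?z" using y0 by simp
    also have "\<dots> = \<phi> 0 * \<phi> y" using feq[OF y0] by simp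
    finally have "\<phi> 0 * ((norm y)\<^sup>2 / 2) < \<phi> 0 * \<phi> y" by (simp add: mult_ac)
    then have "(norm y)\<^sup>2 / 2 < \<phi> y" using pos[of 0] by (simp only: mult_less_cancel_left_pos)
    moreover have "norm y * 1 \<le> (norm y)\<^sup>2" unfolding power2_eq_square using y R by (intro mult_left_mono) auto
    ultimately show ?thesis using y R by linarith
  qed
  have "cball (0::'a) R \<noteq> {}" using R by auto
  then obtain x0 where x0: "x0 \<in> cball 0 R" "\<And>y. y \<in> cball 0 R \<Longrightarrow> \<phi> x0 \<le> \<phi> y"
    using continuous_attains_inf[OF compact_cball _ continuous_on_subset[OF cont]] by (metis top_greatest)
  have min: "\<phi> x0 \<le> \<phi> y" for y
  proof (cases "norm y > R")
    case True
    then show ?thesis using large[OF True] x0(2)[of 0] R by simp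
  next
    case False
    then show ?thesis by (intro x0) simp
  qed
  have lower: "(norm (y - x0))\<^sup>2 \<le> \<phi> y" for y
  proof (cases "y = x0")
    case True
    then show ?thesis using pos[of x0] by simp
  next
    case False
    have "(norm (y - x0))\<^sup>2 * \<phi> x0 \<le> \<phi> x0 * \<phi> y" unfolding feq[OF False] by (intro mult_left_mono min) simp
    then have "\<phi> x0 * (norm (y - x0))\<^sup>2 \<le> \<phi> x0 * \<phi> y" by (simp add: mult.commute)
    then show ?thesis using pos[of x0] by (simp only: mult_le_cancel_left_pos)
  qed
  define \<psi> where "\<psi> x = \<phi> x - (norm (x - x0))\<^sup>2" for x
  have incr: "\<psi> x - (norm z)\<^sup>2 \<le> \<psi> (x + z)" for x z
  proof (cases "z = 0")
    case False
    let ?X = "x - x0"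
    \<comment> \<open>With this factor, y = x + c z is the point whose reflection about x is x +
      z.\<close>
    define c where "c = \<phi> x / (norm z)\<^sup>2"
    have c: "c > 0" using False pos[of x] by (simp add: c_def)
    have cz: "c * (norm z)\<^sup>2 = \<phi> x" using False by (simp add: c_def)
    define y where "y = x + c *\<^sub>R z"
    have yx: "y \<noteq> x" using False c by (simp add: y_def)
    have n: "(norm (y - x))\<^sup>2 = c\<^sup>2 * (norm z)\<^sup>2" by (simp add: y_def power_mult_distrib)
    have "(norm (y - x))\<^sup>2 = c * \<phi> x" unfolding n cz[symmetric] by (simp add: power2_eq_square)
    moreover have "\<phi> x / (c * \<phi> x) * c = 1" using c less_imp_neq[OF pos[of x]] by simp
    ultimately have "\<phi> x / (norm (y - x))\<^sup>2 * c = 1" by (simp only:)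
    moreover have "y - x = c *\<^sub>R z" by (simp add: y_def)
    ultimately have "x + (\<phi> x / (norm (y - x))\<^sup>2) *\<^sub>R (y - x) = x + z" by (metis scaleR_scaleR scaleR_one)
    then have "\<phi> x * \<phi> y = c\<^sup>2 * (norm z)\<^sup>2 * \<phi> (x + z)" using feq[OF yx] n by simp
    also have "\<dots> = \<phi> x * (c * \<phi> (x + z))" unfolding cz[symmetric] by (simp add: power2_eq_square)
    finally have py: "\<phi> y = c * \<phi> (x + z)" using pos[of x] by simp
    have "(norm (y - x0))\<^sup>2 = (norm ?X)\<^sup>2 + 2 * c * (?X \<bullet> z) + c\<^sup>2 * (norm z)\<^sup>2"
    proof -
      have "y - x0 = ?X + c *\<^sub>R z" by (simp add: y_def)
      then show ?thesis by (simp only: norm_add_scaleR_sq)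
    qed
    then have "(norm ?X)\<^sup>2 + 2 * c * (?X \<bullet> z) + c\<^sup>2 * (norm z)\<^sup>2 \<le> c * \<phi> (x + z)" using lower[of y] py by simp
    moreover have "c\<^sup>2 * (norm z)\<^sup>2 = c * \<phi> x" by (simp add: cz[symmetric] power2_eq_square)
    ultimately have "2 * c * (?X \<bullet> z) + c * \<phi> x \<le> c * \<phi> (x + z)"
      using zero_le_power2[of "norm ?X"] by linarith
    then have "c * (2 * (?X \<bullet> z) + \<phi> x) \<le> c * \<phi> (x + z)" by (simp add: distrib_left mult_ac)
    then have "2 * (?X \<bullet> z) + \<phi> x \<le> \<phi> (x + z)" using c by simp
    moreover have "(norm (x + z - x0))\<^sup>2 = (norm ?X)\<^sup>2 + 2 * (?X \<bullet> z) + (norm z)\<^sup>2"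
    proof -
      have "x + z - x0 = ?X + 1 *\<^sub>R z" by simp
      then show ?thesis by (simp only: norm_add_scaleR_sq) simp
    qed
    ultimately show ?thesis by (simp add: \<psi>_def)
  qed simp
  have "\<bar>\<psi> (x + z) - \<psi> x\<bar> \<le> (norm z)\<^sup>2" for x z
    using incr[of x z] incr[of "x + z" "- z"] by (simp add: abs_le_iff)
  then have const: "\<psi> x = \<psi> x0" for x by (rule quadratic_oscillation_imp_constant)
  have "\<phi> x = \<phi> x0 + (norm (x - x0))\<^sup>2" for x using const[of x] by (simp add: \<psi>_def)
  then show ?thesis using pos by blast
qed

section \<open>Gaussian, Gamma and bubble integrals\<close>

text \<open>Total mass of the normal density with variance 1/(2t).\<close>

lemma nn_integral_gaussian:
  assumes t: "t > (0::real)"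
  shows "(\<integral>\<^sup>+x. ennreal (exp (- t * x\<^sup>2)) \<partial>lborel) = ennreal (sqrt (pi / t))"
proof -
  define s where "s = 1 / sqrt (2 * t)"
  have s: "s > 0" "2 * s\<^sup>2 = 1 / t" using t by (simp_all add: s_def power_divide)
  have sp: "sqrt (2 * pi * s\<^sup>2) = sqrt (pi / t)"
    by (rule arg_cong[where f=sqrt]) (use s(2) in \<open>simp add: mult_ac\<close>)
  have "exp (- t * x\<^sup>2) = sqrt (pi / t) * normal_density 0 s x" for x
  proof -
    have "- (x - 0)\<^sup>2 / (2 * s\<^sup>2) = - t * x\<^sup>2" unfolding s(2) by simp
    then show ?thesis unfolding normal_density_def sp using t by (simp add: mult_ac)
  qed
  then have "(\<integral>\<^sup>+x. ennreal (exp (- t * x\<^sup>2)) \<partial>lborel)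
    = (\<integral>\<^sup>+x. ennreal (sqrt (pi / t)) * ennreal (normal_density 0 s x) \<partial>lborel)"
    using t by (intro nn_integral_cong) (simp add: ennreal_mult')
  also have "\<dots> = ennreal (sqrt (pi / t)) * (\<integral>\<^sup>+x. ennreal (normal_density 0 s x) \<partial>lborel)"
    by (rule nn_integral_cmult) measurable
  also have "(\<integral>\<^sup>+x. ennreal (normal_density 0 s x) \<partial>lborel) = 1"
    using s by (subst nn_integral_eq_integral) auto
  finally show ?thesis by simp
qed

lemma nn_integral_gaussian_euclidean:
  assumes t: "t > (0::real)"
  shows "(\<integral>\<^sup>+x. ennreal (exp (- t * (norm (x - c :: 'a::euclidean_space))\<^sup>2)) \<partial>lborel)
    = ennreal ((pi / t) powr (real DIM('a) / 2))"
proof -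
  have "(\<integral>\<^sup>+x. ennreal (exp (- t * (norm (x - c))\<^sup>2)) \<partial>lborel)
    = (\<integral>\<^sup>+x. ennreal (exp (- t * (norm (x::'a))\<^sup>2)) \<partial>lborel)"
    by (subst nn_integral_affine_euclidean[where c=1 and t=c]) auto
  also have "\<dots> = (\<integral>\<^sup>+x. (\<Prod>b\<in>Basis. ennreal (exp (- t * (x \<bullet> b)\<^sup>2))) \<partial>(lborel :: 'a measure))"
  proof (intro nn_integral_cong)
    fix x :: 'a
    have "- t * (norm x)\<^sup>2 = (\<Sum>b\<in>Basis. - t * (x \<bullet> b)\<^sup>2)"
      unfolding power2_norm_eq_inner by (subst euclidean_inner) (simp add: sum_distrib_left power2_eq_square sum_negf)
    then have "exp (- t * (norm x)\<^sup>2) = (\<Prod>b\<in>Basis. exp (- t * (x \<bullet> b)\<^sup>2))" by (simp only: exp_sum finite_Basis)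
    then show "ennreal (exp (- t * (norm x)\<^sup>2)) = (\<Prod>b\<in>Basis. ennreal (exp (- t * (x \<bullet> b)\<^sup>2)))"
      by (simp only: prod_ennreal exp_ge_zero)
  qed
  also have "\<dots> = (\<Prod>b\<in>(Basis::'a set). \<integral>\<^sup>+x. ennreal (exp (- t * x\<^sup>2)) \<partial>lborel)"
    by (rule nn_integral_lborel_prod) auto
  also have "\<dots> = ennreal (sqrt (pi / t) ^ DIM('a))"
    unfolding nn_integral_gaussian[OF t] using t by (simp add: ennreal_power)
  also have "sqrt (pi / t) ^ DIM('a) = (pi / t) powr (real DIM('a) / 2)"
    using t by (simp add: powr_half_sqrt[symmetric] powr_realpow[symmetric] powr_powr)
  finally show ?thesis .
qed

lemma nn_integral_Gamma:
  assumes a: "a > 0" and d: "d > 0"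
  shows "(\<integral>\<^sup>+t. ennreal (t powr (a - 1) * exp (- d * t)) * indicator {0<..} t \<partial>lborel) = ennreal (Gamma a * d powr - a)"
proof -
  let ?f = "\<lambda>t::real. if t \<in> {0..} then t powr (a - 1) / exp t else 0"
  have I: "(\<integral>\<^sup>+t. ennreal (?f t) \<partial>lborel) = ennreal (Gamma a)"
  proof (rule nn_integral_has_integral_lborel)
    show "(?f has_integral Gamma a) UNIV"
      unfolding has_integral_restrict_UNIV by (rule Gamma_integral_real[OF a])
  qed auto
  have "ennreal (Gamma a) = ennreal d * (\<integral>\<^sup>+t. ennreal (?f (0 + d * t)) \<partial>lborel)"
    unfolding I[symmetric] using d by (subst nn_integral_real_affine[of _ d 0]) auto
  also have "\<dots> = (\<integral>\<^sup>+t. ennreal d * ennreal (?f (0 + d * t)) \<partial>lborel)"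
    by (rule nn_integral_cmult[symmetric]) measurable
  also have "\<dots> = (\<integral>\<^sup>+t. ennreal (d powr a) * (ennreal (t powr (a - 1) * exp (- d * t)) * indicator {0<..} t) \<partial>lborel)"
  proof (rule nn_integral_cong_except[of 0])
    fix t :: real assume t: "t \<noteq> 0"
    show "ennreal d * ennreal (?f (0 + d * t)) = ennreal (d powr a) * (ennreal (t powr (a - 1) * exp (- d * t)) * indicator {0<..} t)"
    proof (cases "t > 0")
      case True
      have "d * d powr (a - 1) = d powr a" using d by (simp add: powr_mult_base)
      then have "d * (d powr (a - 1) * t powr (a - 1) / exp (d * t)) = d powr a * (t powr (a - 1) * exp (- d * t))"
        by (simp add: exp_minus divide_inverse)
      then show ?thesis using True d by (simp add: powr_mult ennreal_mult'[symmetric])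
    next
      case False
      then have "\<not> 0 \<le> d * t" using d t by (simp add: zero_le_mult_iff)
      then show ?thesis using False by simp
    qed
  qed
  also have "\<dots> = ennreal (d powr a) * (\<integral>\<^sup>+t. (ennreal (t powr (a - 1) * exp (- d * t)) * indicator {0<..} t) \<partial>lborel)"
    by (rule nn_integral_cmult) measurable
  finally have "ennreal (d powr - a) * ennreal (Gamma a)
    = ennreal (d powr - a * d powr a) * (\<integral>\<^sup>+t. (ennreal (t powr (a - 1) * exp (- d * t)) * indicator {0<..} t) \<partial>lborel)"
    by (simp add: ennreal_mult_left_assoc)
  moreover have "d powr - a * d powr a = 1" using d by (simp add: powr_minus)
  ultimately show ?thesis using Gamma_real_pos[OF a] by (simp add: ennreal_mult'[symmetric] mult.commute)
qed

text \<open>Multiplied by Gamma a, the power (d + |y-c|^2)^-a is an integral of Gaussians in y over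
  a parameter t. Tonelli and the Gaussian integral lower the exponent of t by n/2 and leave a Gamma
  integral at a - n/2.\<close>

lemma nn_integral_bubble:
  assumes a: "a > real DIM('a::euclidean_space) / 2" and d: "d > 0"
  shows "(\<integral>\<^sup>+y. ennreal ((d + (norm (y - c :: 'a))\<^sup>2) powr - a) \<partial>lborel)
    = ennreal (pi powr (real DIM('a) / 2) * Gamma (a - real DIM('a) / 2) / Gamma a * d powr (real DIM('a) / 2 - a))"
proof -
  let ?n = "real DIM('a) / 2"
  have a0: "a > 0" by (rule le_less_trans[OF _ a]) simp
  let ?g = "\<lambda>t. ennreal (t powr (a - 1) * exp (- d * t)) * indicator {0<..} t"
  have split: "exp (- (d + z) * t) = exp (- d * t) * exp (- t * z)" for z t :: real
    by (simp add: exp_add[symmetric] algebra_simps)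
  have "ennreal (Gamma a) * (\<integral>\<^sup>+y. ennreal ((d + (norm (y - c))\<^sup>2) powr - a) \<partial>lborel)
    = (\<integral>\<^sup>+y. ennreal (Gamma a) * ennreal ((d + (norm (y - c))\<^sup>2) powr - a) \<partial>lborel)"
    by (rule nn_integral_cmult[symmetric]) measurable
  also have "\<dots> = (\<integral>\<^sup>+y. \<integral>\<^sup>+t. ?g t * ennreal (exp (- t * (norm (y - c))\<^sup>2)) \<partial>lborel \<partial>lborel)"
  proof (rule nn_integral_cong)
    fix y :: 'a
    have "ennreal (Gamma a) * ennreal ((d + (norm (y - c))\<^sup>2) powr - a)
      = ennreal (Gamma a * (d + (norm (y - c))\<^sup>2) powr - a)"
      using Gamma_real_pos[OF a0] by (simp add: ennreal_mult')
    also have "\<dots> = (\<integral>\<^sup>+t. ennreal (t powr (a - 1) * exp (- (d + (norm (y - c))\<^sup>2) * t)) * indicator {0<..} t \<partial>lborel)"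
      by (rule nn_integral_Gamma[symmetric, OF a0]) (use d in \<open>simp add: add_pos_nonneg\<close>)
    also have "\<dots> = (\<integral>\<^sup>+t. ?g t * ennreal (exp (- t * (norm (y - c))\<^sup>2)) \<partial>lborel)"
      unfolding split by (intro nn_integral_cong) (simp add: ennreal_mult' mult_ac)
    finally show "ennreal (Gamma a) * ennreal ((d + (norm (y - c))\<^sup>2) powr - a)
      = (\<integral>\<^sup>+t. ?g t * ennreal (exp (- t * (norm (y - c))\<^sup>2)) \<partial>lborel)" .
  qed
  also have "\<dots> = (\<integral>\<^sup>+t. \<integral>\<^sup>+y. ?g t * ennreal (exp (- t * (norm (y - c))\<^sup>2)) \<partial>lborel \<partial>lborel)"
    by (rule lborel_pair.Fubini') measurable
  also have "\<dots> = (\<integral>\<^sup>+t. ennreal (pi powr ?n) * (ennreal (t powr ((a - ?n) - 1) * exp (- d * t)) * indicator {0<..} t) \<partial>lborel)"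
  proof (rule nn_integral_cong)
    fix t :: real
    have "(\<integral>\<^sup>+y. ?g t * ennreal (exp (- t * (norm (y - c))\<^sup>2)) \<partial>lborel)
      = ?g t * (\<integral>\<^sup>+y. ennreal (exp (- t * (norm (y - c))\<^sup>2)) \<partial>lborel)"
      by (rule nn_integral_cmult) measurable
    also have "\<dots> = ennreal (pi powr ?n) * (ennreal (t powr ((a - ?n) - 1) * exp (- d * t)) * indicator {0<..} t)"
    proof (cases "t > 0")
      case True
      have "(pi / t) powr ?n = pi powr ?n * t powr - ?n"
        using True by (subst powr_divide) (auto simp: powr_minus_divide)
      moreover have "t powr (a - 1) * t powr - ?n = t powr ((a - ?n) - 1)"
        unfolding powr_add[symmetric] by (rule arg_cong[where f="\<lambda>e. t powr e"]) simp
      ultimately have "t powr (a - 1) * exp (- d * t) * (pi / t) powr ?n = pi powr ?n * (t powr ((a - ?n) - 1) * exp (- d * t))"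
        by (simp add: mult_ac)
      then have "ennreal (t powr (a - 1) * exp (- d * t)) * ennreal ((pi / t) powr ?n)
        = ennreal (pi powr ?n) * ennreal (t powr ((a - ?n) - 1) * exp (- d * t))"
        by (simp only: ennreal_mult'[symmetric] mult_nonneg_nonneg powr_ge_zero exp_ge_zero)
      then show ?thesis unfolding nn_integral_gaussian_euclidean[OF True] using True
        by (simp only: indicator_simps greaterThan_iff mult_1_right)
    qed simp
    finally show "(\<integral>\<^sup>+y. ?g t * ennreal (exp (- t * (norm (y - c))\<^sup>2)) \<partial>lborel)
      = ennreal (pi powr ?n) * (ennreal (t powr ((a - ?n) - 1) * exp (- d * t)) * indicator {0<..} t)" .
  qed
  also have "\<dots> = ennreal (pi powr ?n) * (\<integral>\<^sup>+t. ennreal (t powr ((a - ?n) - 1) * exp (- d * t)) * indicator {0<..} t \<partial>lborel)"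
    by (rule nn_integral_cmult) measurable
  also have "\<dots> = ennreal (pi powr ?n) * ennreal (Gamma (a - ?n) * d powr - (a - ?n))"
    using a d by (subst nn_integral_Gamma) auto
  finally have "ennreal (1 / Gamma a) * (ennreal (Gamma a) * (\<integral>\<^sup>+y. ennreal ((d + (norm (y - c))\<^sup>2) powr - a) \<partial>lborel))
    = ennreal (1 / Gamma a) * (ennreal (pi powr ?n) * ennreal (Gamma (a - ?n) * d powr - (a - ?n)))" by (rule arg_cong)
  then show ?thesis
    using Gamma_real_pos[OF a0] by (simp add: ennreal_mult_left_assoc ennreal_mult'[symmetric] mult_ac)
qed

lemma bubble_const_pos: "0 < n \<Longrightarrow> 2 * \<gamma> < real n \<Longrightarrow> bubble_const \<gamma> n > 0"
  unfolding bubble_const_def by (intro divide_pos_pos mult_pos_pos Gamma_real_pos) auto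

text \<open>The inversion in the sphere around \<open>x\<close> of radius \<open>r\<close> with \<open>r\<^sup>2 = d + |x - x\<^sub>0|\<^sup>2\<close> preserves the bubble
  and moves the singularity of the kernel to infinity.\<close>

lemma riesz_potential_bubble:
  fixes x\<^sub>0 :: "'a::euclidean_space"
  assumes \<gamma>: "2 * \<gamma> < real DIM('a)" and d: "d > 0"
  shows "riesz_potential (2 * \<gamma>) (\<lambda>y. ennreal ((d + (norm (y - x\<^sub>0))\<^sup>2) powr (\<gamma> - real DIM('a)))) x
    = ennreal ((d + (norm (x - x\<^sub>0))\<^sup>2) powr - \<gamma>
      * (bubble_const \<gamma> DIM('a) * d powr (\<gamma> - real DIM('a) / 2)))"
proof -
  let ?N = "real DIM('a)"
  let ?b = "\<lambda>y. d + (norm (y - x\<^sub>0))\<^sup>2"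
  define r where "r = sqrt (?b x)"
  have r2: "r\<^sup>2 = ?b x" using d by (simp add: r_def)
  have r: "r > 0" using d by (simp add: r_def add_pos_nonneg)
  have "riesz_potential (2 * \<gamma>) (\<lambda>y. ennreal (?b y powr (\<gamma> - ?N))) x
    = (\<integral>\<^sup>+y. ennreal ((r / norm (y - x)) powr (2 * ?N)) * (ennreal (norm (x - inversion x r y) powr - (2 * \<gamma>))
        * ennreal (?b (inversion x r y) powr (\<gamma> - ?N))) \<partial>lborel)"
    unfolding riesz_potential_def by (rule nn_integral_inversion) (use r in auto)
  also have "\<dots> = (\<integral>\<^sup>+y. ennreal (r powr - (2 * \<gamma>)) * ennreal (?b y powr (\<gamma> - ?N)) \<partial>lborel)"
  proof (rule nn_integral_cong_except[of x])
    fix y assume y: "y \<noteq> x"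
    let ?W = "norm (y - x)" and ?X = "x - x\<^sub>0"
    have W: "?W > 0" using y by simp
    have "?b (inversion x r y) = ?b y * (r / ?W)\<^sup>2"
    proof -
      let ?k = "r\<^sup>2 / ?W\<^sup>2"
      have "inversion x r y - x\<^sub>0 = ?X + ?k *\<^sub>R (y - x)" by (simp add: inversion_def)
      then have "(norm (inversion x r y - x\<^sub>0))\<^sup>2 = (norm ?X)\<^sup>2 + 2 * ?k * (?X \<bullet> (y - x)) + ?k\<^sup>2 * ?W\<^sup>2"
        by (simp only: norm_add_scaleR_sq)
      also have "?k\<^sup>2 * ?W\<^sup>2 = ?k * r\<^sup>2" using W by (simp add: power2_eq_square)
      finally have "?b (inversion x r y) = r\<^sup>2 + 2 * ?k * (?X \<bullet> (y - x)) + ?k * r\<^sup>2" using r2 by simp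
      moreover have "(norm (y - x\<^sub>0))\<^sup>2 = (norm ?X)\<^sup>2 + 2 * (?X \<bullet> (y - x)) + ?W\<^sup>2"
      proof -
        have "y - x\<^sub>0 = ?X + 1 *\<^sub>R (y - x)" by simp
        then show ?thesis by (simp only: norm_add_scaleR_sq) simp
      qed
      then have "?b y = r\<^sup>2 + 2 * (?X \<bullet> (y - x)) + ?W\<^sup>2" using r2 by simp
      ultimately show ?thesis using W by (simp add: power_divide field_simps)
    qed
    moreover have bpos: "?b y > 0" using d by (simp add: add_pos_nonneg)
    ultimately have 1: "?b (inversion x r y) powr (\<gamma> - ?N) = ?b y powr (\<gamma> - ?N) * (r / ?W) powr (2 * (\<gamma> - ?N))"
      using W r by (simp add: powr_mult powr_powr flip: powr_numeral)
    have "norm (x - inversion x r y) = r * (r / ?W)"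
      using norm_inversion[OF y, of r] by (simp add: norm_minus_commute power2_eq_square)
    then have 2: "norm (x - inversion x r y) powr - (2 * \<gamma>) = r powr - (2 * \<gamma>) * (r / ?W) powr - (2 * \<gamma>)"
      by (simp only: powr_mult)
    \<comment> \<open>The exponents 2n, -2\<gamma> and 2(\<gamma> - n) add up to 0, so the kernel no
      longer depends on y.\<close>
    have 3: "(r / ?W) powr (2 * ?N) * ((r / ?W) powr - (2 * \<gamma>) * (r / ?W) powr (2 * (\<gamma> - ?N))) = 1"
      unfolding powr_add[symmetric] using W r by (simp add: algebra_simps)
    have "(r / ?W) powr (2 * ?N) * (norm (x - inversion x r y) powr - (2 * \<gamma>) * ?b (inversion x r y) powr (\<gamma> - ?N))
      = r powr - (2 * \<gamma>) * ?b y powr (\<gamma> - ?N)" unfolding 1 2 using 3 by algebra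
    then show "ennreal ((r / ?W) powr (2 * ?N)) * (ennreal (norm (x - inversion x r y) powr - (2 * \<gamma>))
        * ennreal (?b (inversion x r y) powr (\<gamma> - ?N))) = ennreal (r powr - (2 * \<gamma>)) * ennreal (?b y powr (\<gamma> - ?N))"
      by (simp only: ennreal_mult'[symmetric] powr_ge_zero)
  qed
  also have "\<dots> = ennreal (r powr - (2 * \<gamma>)) * (\<integral>\<^sup>+y. ennreal (?b y powr - (?N - \<gamma>)) \<partial>lborel)"
    by (subst nn_integral_cmult) auto
  also have "(\<integral>\<^sup>+y. ennreal (?b y powr - (?N - \<gamma>)) \<partial>lborel)
    = ennreal (pi powr (?N / 2) * Gamma (?N - \<gamma> - ?N / 2) / Gamma (?N - \<gamma>) * d powr (?N / 2 - (?N - \<gamma>)))"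
    by (rule nn_integral_bubble) (use \<gamma> d in auto)
  also have "?N - \<gamma> - ?N / 2 = (?N - 2 * \<gamma>) / 2" by simp
  also have "?N / 2 - (?N - \<gamma>) = \<gamma> - ?N / 2" by simp
  also have "r powr - (2 * \<gamma>) = ?b x powr - \<gamma>"
    using r unfolding r2[symmetric] by (simp add: powr_powr flip: powr_numeral)
  finally show ?thesis by (simp only: bubble_const_def ennreal_mult'[OF powr_ge_zero])
qed

section \<open>Classification of the solutions\<close>

lemma filterlim_norm_diff_at_infinity:
  "filterlim (\<lambda>y::'a::real_normed_vector. norm (y - c)) at_top at_infinity"
proof (rule filterlim_at_top_mono)
  show "filterlim (\<lambda>y::'a. - norm c + norm y) at_top at_infinity"
    by (rule filterlim_tendsto_add_at_top[OF tendsto_const filterlim_norm_at_top])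
  show "\<forall>\<^sub>F y in at_infinity. - norm c + norm y \<le> norm (y - c)"
  proof (rule always_eventually, rule allI)
    fix y :: 'a show "- norm c + norm y \<le> norm (y - c)" using norm_triangle_ineq2[of y c] by simp
  qed
qed

lemma tendsto_norm_diff_ratio:
  "((\<lambda>y::'a::real_normed_vector. norm (y - b) / norm (y - c)) \<longlongrightarrow> 1) at_infinity"
proof -
  have "((\<lambda>y. norm (b - c) / norm (y - c)) \<longlongrightarrow> 0) at_infinity"
    by (rule tendsto_divide_0[OF tendsto_const filterlim_at_top_imp_at_infinity[OF filterlim_norm_diff_at_infinity]])
  then have "((\<lambda>y. norm (y - b) / norm (y - c) - 1) \<longlongrightarrow> 0) at_infinity"
  proof (rule Lim_null_comparison[rotated])
    have "\<forall>\<^sub>F y in at_infinity. norm (y - c) > 0"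
      using filterlim_norm_diff_at_infinity[of c] by (simp only: filterlim_at_top_dense)
    then show "\<forall>\<^sub>F y in at_infinity. norm (norm (y - b) / norm (y - c) - 1) \<le> norm (b - c) / norm (y - c)"
    proof (rule eventually_mono)
      fix y assume y: "norm (y - c) > 0"
      have "\<bar>norm (y - b) - norm (y - c)\<bar> \<le> norm (b - c)"
        using norm_triangle_ineq3[of "y - b" "y - c"] by (simp add: norm_minus_commute)
      then have "\<bar>norm (y - b) - norm (y - c)\<bar> / norm (y - c) \<le> norm (b - c) / norm (y - c)"
        by (intro divide_right_mono) auto
      moreover have "norm (y - b) / norm (y - c) - 1 = (norm (y - b) - norm (y - c)) / norm (y - c)"
        using y by (simp add: diff_divide_distrib)
      ultimately show "norm (norm (y - b) / norm (y - c) - 1) \<le> norm (b - c) / norm (y - c)" by simp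
    qed
  qed
  then show ?thesis by (simp add: LIM_zero_iff)
qed

context hartree
begin

lemma tendsto_u_inversion_at_infinity: "((\<lambda>y. r powr \<nu> * u (inversion c r y)) \<longlongrightarrow> r powr \<nu> * u c) at_infinity"
proof -
  have "((\<lambda>y. r\<^sup>2 / norm (y - c)) \<longlongrightarrow> 0) at_infinity"
    by (rule tendsto_divide_0[OF tendsto_const filterlim_at_top_imp_at_infinity[OF filterlim_norm_diff_at_infinity]])
  then have "((\<lambda>y. inversion c r y - c) \<longlongrightarrow> 0) at_infinity"
  proof (rule Lim_null_comparison[rotated])
    show "\<forall>\<^sub>F y in at_infinity. norm (inversion c r y - c) \<le> r\<^sup>2 / norm (y - c)"
    proof (rule always_eventually, rule allI)
      fix y show "norm (inversion c r y - c) \<le> r\<^sup>2 / norm (y - c)"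
        by (cases "y = c") (simp add: inversion_def, simp add: norm_inversion)
    qed
  qed
  then have "((\<lambda>y. inversion c r y) \<longlongrightarrow> c) at_infinity" by (simp add: LIM_zero_iff)
  moreover have "isCont u c" using cont by (simp add: continuous_on_eq_continuous_at)
  ultimately have "((\<lambda>y. u (inversion c r y)) \<longlongrightarrow> u c) at_infinity" by (rule isCont_tendsto_compose[rotated])
  then show ?thesis by (intro tendsto_intros)
qed

lemma ukelvin_weight: "y \<noteq> c \<Longrightarrow> norm (y - c) powr \<nu> * ukelvin c r y = r powr \<nu> * u (inversion c r y)"
proof -
  assume y: "y \<noteq> c"
  have "norm (y - c) powr \<nu> * (r / norm (y - c)) powr \<nu> = (norm (y - c) * (r / norm (y - c))) powr \<nu>"
    by (simp only: powr_mult)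
  also have "norm (y - c) * (r / norm (y - c)) = r" using y by simp
  finally show ?thesis by (simp add: ukelvin_def mult.assoc[symmetric])
qed

text \<open>Symmetry turns |y-c|^\<nu> u(y) into r^\<nu> times u at the reflected point, which tends
  to c. Measuring from b instead of c costs a factor tending to 1, so the limits found from
  different centres can be identified.\<close>

lemma tendsto_u_at_infinity:
  assumes "r > 0" "\<And>y. y \<noteq> c \<Longrightarrow> ukelvin c r y = u y"
  shows "((\<lambda>y. norm (y - b) powr \<nu> * u y) \<longlongrightarrow> r powr \<nu> * u c) at_infinity"
proof -
  have large: "\<forall>\<^sub>F y in at_infinity. norm (y - c) > 0"
    using filterlim_norm_diff_at_infinity[of c] by (simp only: filterlim_at_top_dense)
  have "((\<lambda>y. (norm (y - b) / norm (y - c)) powr \<nu> * (r powr \<nu> * u (inversion c r y)))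
      \<longlongrightarrow> 1 powr \<nu> * (r powr \<nu> * u c)) at_infinity"
    by (intro tendsto_mult tendsto_powr tendsto_norm_diff_ratio tendsto_u_inversion_at_infinity tendsto_const) auto
  moreover have "\<forall>\<^sub>F y in at_infinity. (norm (y - b) / norm (y - c)) powr \<nu> * (r powr \<nu> * u (inversion c r y))
      = norm (y - b) powr \<nu> * u y"
    using large
  proof (rule eventually_mono)
    fix y assume y: "norm (y - c) > 0"
    then have yc: "y \<noteq> c" by auto
    have "(norm (y - b) / norm (y - c)) powr \<nu> * norm (y - c) powr \<nu> = norm (y - b) powr \<nu>"
      unfolding powr_mult[symmetric] using yc by simp
    then show "(norm (y - b) / norm (y - c)) powr \<nu> * (r powr \<nu> * u (inversion c r y)) = norm (y - b) powr \<nu> * u y"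
      unfolding ukelvin_weight[OF yc, symmetric] assms(2)[OF yc] by (simp only: mult.assoc[symmetric])
  qed
  ultimately show ?thesis by (simp add: tendsto_cong)
qed

lemma bubble_shape: "\<exists>x\<^sub>0 d L. d > 0 \<and> L > 0 \<and> (\<forall>x. u x = L * (d + (norm (x - x\<^sub>0))\<^sup>2) powr - (\<nu> / 2))"
proof -
  obtain c0 r0 where r0: "r0 > 0" "\<And>y. y \<noteq> c0 \<Longrightarrow> ukelvin c0 r0 y = u y"
    using not_bad_empty_all moving_spheres_dichotomy by metis
  define L where "L = r0 powr \<nu> * u c0"
  have L: "L > 0" using r0 pos by (simp add: L_def)
  have lim: "((\<lambda>y. norm (y - b) powr \<nu> * u y) \<longlongrightarrow> L) at_infinity" for b
    unfolding L_def by (rule tendsto_u_at_infinity[OF r0])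
  have ex: "\<exists>r>0. (\<forall>y. y \<noteq> c \<longrightarrow> ukelvin c r y = u y) \<and> r powr \<nu> * u c = L" for c
  proof -
    have "\<not> (\<forall>r>0. bad c r = {})"
    proof
      assume all: "\<forall>r>0. bad c r = {}"
      \<comment> \<open>If the spheres about c never stopped, letting y go to infinity in u_r \<le>
        u would give r^\<nu> u(c) \<le> L for every r; this radius has the value L + 1.\<close>
      define r where "r = ((L + 1) / u c) powr (1 / \<nu>)"
      have r: "r > 0" "r powr \<nu> * u c = L + 1" using L pos[of c] nu by (simp_all add: r_def powr_powr)
      have "\<forall>\<^sub>F y in at_infinity. norm (y - c) > r"
        using filterlim_norm_diff_at_infinity[of c] by (simp only: filterlim_at_top_dense)
      then have "\<forall>\<^sub>F y in at_infinity. r powr \<nu> * u (inversion c r y) \<le> norm (y - c) powr \<nu> * u y"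
      proof (rule eventually_mono)
        fix y assume y: "norm (y - c) > r"
        then have yc: "y \<noteq> c" using r by auto
        show "r powr \<nu> * u (inversion c r y) \<le> norm (y - c) powr \<nu> * u y"
          unfolding ukelvin_weight[OF yc, symmetric] using ukelvin_le[of c r y] all r y by (intro mult_left_mono) auto
      qed
      then have "r powr \<nu> * u c \<le> L"
        by (rule tendsto_le[OF trivial_limit_at_infinity lim tendsto_u_inversion_at_infinity])
      then show False using r by simp
    qed
    then obtain r where r: "r > 0" "\<And>y. y \<noteq> c \<Longrightarrow> ukelvin c r y = u y"
      using moving_spheres_dichotomy[of c] by auto
    have "r powr \<nu> * u c = L"
      by (rule tendsto_unique[OF trivial_limit_at_infinity tendsto_u_at_infinity[OF r] lim])
    then show ?thesis using r by blast
  qed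
  \<comment> \<open>The power 2/\<nu> turns the conformal weight (r/|y-x|)^\<nu> into a ratio of
    squares, so that symmetry about every x becomes an equation for \<phi> alone.\<close>
  define \<phi> where "\<phi> x = (L / u x) powr (2 / \<nu>)" for x
  have \<phi>pos: "\<phi> x > 0" for x using L pos[of x] by (simp add: \<phi>_def)
  have ex': "\<exists>r>0. (\<forall>y. y \<noteq> c \<longrightarrow> ukelvin c r y = u y) \<and> r\<^sup>2 = \<phi> c" for c
  proof -
    obtain r where r: "r > 0" "\<forall>y. y \<noteq> c \<longrightarrow> ukelvin c r y = u y" "r powr \<nu> * u c = L" using ex by blast
    have "L / u c = r powr \<nu>" using r(3) pos[of c] by (simp add: field_simps)
    then have "\<phi> c = r\<^sup>2" using r(1) nu by (simp add: \<phi>_def powr_powr)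
    then show ?thesis using r by auto
  qed
  have "\<exists>x\<^sub>0 d. d > 0 \<and> (\<forall>x. \<phi> x = d + (norm (x - x\<^sub>0))\<^sup>2)"
  proof (rule conformal_functional_equation[OF \<phi>pos])
    show "continuous_on UNIV \<phi>"
      unfolding \<phi>_def using L pos less_imp_neq[OF pos]
      by (intro continuous_intros cont) (auto simp: less_imp_neq[OF pos, symmetric])
    fix x y :: 'a assume y: "y \<noteq> x"
    obtain r where r: "r > 0" "ukelvin x r y = u y" "r\<^sup>2 = \<phi> x" using ex'[of x] y by blast
    let ?T = "x + (\<phi> x / (norm (y - x))\<^sup>2) *\<^sub>R (y - x)"
    have "inversion x r y = ?T" by (simp add: inversion_def r(3))
    then have "u y = (r / norm (y - x)) powr \<nu> * u ?T" using r(2) by (simp add: ukelvin_def)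
    then have "L / u y = (norm (y - x) / r) powr \<nu> * (L / u ?T)"
    proof -
      have "(norm (y - x) / r) powr \<nu> = 1 / (r / norm (y - x)) powr \<nu>" by (simp add: powr_divide)
      then show ?thesis using \<open>u y = _\<close> by simp
    qed
    then have "\<phi> y = ((norm (y - x) / r) powr \<nu>) powr (2 / \<nu>) * \<phi> ?T"
      unfolding \<phi>_def[of y] \<phi>_def[of ?T] by (simp only: powr_mult)
    also have "((norm (y - x) / r) powr \<nu>) powr (2 / \<nu>) = (norm (y - x))\<^sup>2 / \<phi> x"
      using nu r y by (simp add: powr_powr power_divide)
    finally show "\<phi> x * \<phi> y = (norm (y - x))\<^sup>2 * \<phi> ?T" using less_imp_neq[OF \<phi>pos[of x]] by simp
  qed
  then obtain x0 d where d: "d > 0" "\<And>x. \<phi> x = d + (norm (x - x0))\<^sup>2" by blast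
  have "u x = L * (d + (norm (x - x0))\<^sup>2) powr - (\<nu> / 2)" for x
  proof -
    have "\<phi> x powr - (\<nu> / 2) = u x / L" using nu L pos[of x] by (simp add: \<phi>_def powr_powr powr_minus)
    then show ?thesis using L d(2)[of x] by simp
  qed
  then show ?thesis using d(1) L by blast
qed

text \<open>Criticality makes the exponents of u^p and of P u^q exactly \<sigma>/2 - n and \<nu>/2 -
  n, so each potential maps a bubble to a bubble. The equation reduces to one relation between
  coefficients, read off at the centre.\<close>

lemma bubble_height:
  assumes d: "d > 0" and L: "L > 0" and u: "\<And>x. u x = L * (d + (norm (x - x\<^sub>0))\<^sup>2) powr - (\<nu> / 2)"
  shows "L = K * (L powr (p + q) * (bubble_const (\<sigma> / 2) DIM('a) * bubble_const (\<nu> / 2) DIM('a)) * d powr ((\<sigma> + \<nu>) / 2 - real DIM('a)))"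
proof -
  let ?N = "real DIM('a)" and ?b = "\<lambda>y. d + (norm (y - x\<^sub>0))\<^sup>2"
  have m: "bubble_const (\<sigma> / 2) DIM('a) > 0" "bubble_const (\<nu> / 2) DIM('a) > 0" using sig nu by (auto intro: bubble_const_pos)
  have "- (\<nu> / 2) * p = - (p * \<nu>) / 2" "- (\<nu> / 2) * q = - (q * \<nu>) / 2" by simp_all
  then have ep: "- (\<nu> / 2) * p = \<sigma> / 2 - ?N" and eq': "- (\<sigma> / 2) + - (\<nu> / 2) * q = \<nu> / 2 - ?N"
    using critical by (simp_all add: field_simps)
  have "up y = ennreal (L powr p) * ennreal (?b y powr (\<sigma> / 2 - ?N))" for y
    unfolding up_def u powr_mult powr_powr ep by (simp add: ennreal_mult')
  then have Pb: "P y = ennreal (L powr p) * riesz_potential (2 * (\<sigma> / 2)) (\<lambda>y. ennreal (?b y powr (\<sigma> / 2 - ?N))) y" for y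
    unfolding P_def by (subst riesz_potential_cmult[symmetric]) (auto intro!: arg_cong[where f="\<lambda>g. riesz_potential \<sigma> g y"])
  have sn: "2 * (\<sigma> / 2) < ?N" "2 * (\<nu> / 2) < ?N" using sig nu by simp_all
  have P: "P y = ennreal (L powr p * (?b y powr - (\<sigma> / 2) * (bubble_const (\<sigma> / 2) DIM('a) * d powr (\<sigma> / 2 - ?N / 2))))" for y
    unfolding Pb riesz_potential_bubble[OF sn(1) d]
    by (rule ennreal_mult'[OF powr_ge_zero, symmetric])
  define A where "A = L powr (p + q) * bubble_const (\<sigma> / 2) DIM('a) * d powr (\<sigma> / 2 - ?N / 2)"
  have A: "A > 0" using L m d by (simp add: A_def)
  have "F y = ennreal A * ennreal (?b y powr (\<nu> / 2 - ?N))" for y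
  proof -
    have "F y = ennreal (L powr p * (?b y powr - (\<sigma> / 2) * (bubble_const (\<sigma> / 2) DIM('a) * d powr (\<sigma> / 2 - ?N / 2)))
      * (L powr q * ?b y powr (- (\<nu> / 2) * q)))"
      unfolding F_def P u powr_mult powr_powr using m by (simp add: ennreal_mult')
    also have "L powr p * (?b y powr - (\<sigma> / 2) * (bubble_const (\<sigma> / 2) DIM('a) * d powr (\<sigma> / 2 - ?N / 2)))
      * (L powr q * ?b y powr (- (\<nu> / 2) * q)) = A * ?b y powr (\<nu> / 2 - ?N)"
      unfolding A_def eq'[symmetric] powr_add by (simp only: mult_ac)
    finally show ?thesis using A by (simp add: ennreal_mult')
  qed
  then have "riesz_potential \<nu> F x\<^sub>0 = ennreal A * riesz_potential (2 * (\<nu> / 2)) (\<lambda>y. ennreal (?b y powr (\<nu> / 2 - ?N))) x\<^sub>0"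
    by (subst riesz_potential_cmult[symmetric]) (auto intro!: arg_cong[where f="\<lambda>g. riesz_potential \<nu> g x\<^sub>0"])
  also have "\<dots> = ennreal (A * (d powr - (\<nu> / 2) * (bubble_const (\<nu> / 2) DIM('a) * d powr (\<nu> / 2 - ?N / 2))))"
    using d unfolding riesz_potential_bubble[OF sn(2) d]
    by (simp only: ennreal_mult'[OF less_imp_le[OF A]]) simp
  finally have "ennreal (u x\<^sub>0) = ennreal (K * (A * (d powr - (\<nu> / 2) * (bubble_const (\<nu> / 2) DIM('a) * d powr (\<nu> / 2 - ?N / 2)))))"
    using K by (simp add: integral_equation ennreal_mult')
  then have "L * d powr - (\<nu> / 2) = K * (A * (d powr - (\<nu> / 2) * (bubble_const (\<nu> / 2) DIM('a) * d powr (\<nu> / 2 - ?N / 2))))"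
    using K A m L by (subst (asm) ennreal_inj) (auto simp: u)
  also have "\<dots> = (K * (A * (bubble_const (\<nu> / 2) DIM('a) * d powr (\<nu> / 2 - ?N / 2)))) * d powr - (\<nu> / 2)" by simp
  finally have "L = K * (A * (bubble_const (\<nu> / 2) DIM('a) * d powr (\<nu> / 2 - ?N / 2)))" using d by simp
  also have "\<dots> = K * (L powr (p + q) * (bubble_const (\<sigma> / 2) DIM('a) * bubble_const (\<nu> / 2) DIM('a)) * (d powr (\<sigma> / 2 - ?N / 2) * d powr (\<nu> / 2 - ?N / 2)))"
    by (simp add: A_def)
  also have "d powr (\<sigma> / 2 - ?N / 2) * d powr (\<nu> / 2 - ?N / 2) = d powr ((\<sigma> + \<nu>) / 2 - ?N)"
    unfolding powr_add[symmetric] by (rule arg_cong[where f="\<lambda>e. d powr e"]) (simp add: field_simps)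
  finally show ?thesis .
qed

text \<open>With e = 2n - \<nu> - \<sigma> the height relation becomes L^(2e/\<nu>) = A d^(e/2),
  which determines L from d; the remaining freedom in d is the scaling.\<close>

lemma bubble_classification:
  "\<exists>\<mu>>0. \<exists>x\<^sub>0. \<forall>x. u x = \<mu> powr (\<nu> / 2) *
    ((1 / (K * bubble_const (\<sigma> / 2) DIM('a) * bubble_const (\<nu> / 2) DIM('a))) powr (\<nu> / (2 * (2 * real DIM('a) - \<nu> - \<sigma>)))
      * (1 / (1 + (norm (\<mu> *\<^sub>R (x - x\<^sub>0)))\<^sup>2)) powr (\<nu> / 2))"
proof -
  obtain x0 d L where d: "d > 0" and L: "L > 0" and u: "\<And>x. u x = L * (d + (norm (x - x0))\<^sup>2) powr - (\<nu> / 2)"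
    using bubble_shape by blast
  let ?N = "real DIM('a)"
  define e where "e = 2 * ?N - \<nu> - \<sigma>"
  define A where "A = 1 / (K * bubble_const (\<sigma> / 2) DIM('a) * bubble_const (\<nu> / 2) DIM('a))"
  have A: "A > 0" using K sig nu by (auto simp: A_def intro!: mult_pos_pos bubble_const_pos)
  have e: "e > 0" using nu sig by (simp add: e_def)
  have w: "p + q - 1 = 2 * e / \<nu>"
  proof -
    have "(p + q - 1) * \<nu> = 2 * e" using critical by (simp add: e_def left_diff_distrib distrib_right)
    then show ?thesis using nu by (simp add: field_simps)
  qed
  have "L powr (p + q - 1) = A * d powr (e / 2)"
  proof -
    have "L * 1 = L * (K * (L powr (p + q - 1) * (bubble_const (\<sigma> / 2) DIM('a) * bubble_const (\<nu> / 2) DIM('a)) * d powr - (e / 2)))"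
    proof -
      have "L powr (p + q) = L * L powr (p + q - 1)" using L by (simp add: powr_mult_base)
      moreover have "(\<sigma> + \<nu>) / 2 - ?N = - (e / 2)" by (simp add: e_def field_simps)
      ultimately show ?thesis using bubble_height[OF d L u] by (simp add: mult_ac)
    qed
    then have "1 = L powr (p + q - 1) / A * d powr - (e / 2)" using L by (simp only: mult_cancel_left) (simp add: A_def mult_ac)
    then have "A * d powr (e / 2) = L powr (p + q - 1) * (d powr - (e / 2) * d powr (e / 2))" using A by (simp add: field_simps)
    also have "d powr - (e / 2) * d powr (e / 2) = 1" using d by (simp add: powr_minus)
    finally show ?thesis by simp
  qed
  then have "(L powr (2 * e / \<nu>)) powr (\<nu> / (2 * e)) = (A * d powr (e / 2)) powr (\<nu> / (2 * e))" unfolding w by simp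
  then have L': "L = A powr (\<nu> / (2 * e)) * d powr (\<nu> / 4)" using L e nu d A by (simp add: powr_powr powr_mult)
  \<comment> \<open>Then d + |x-x0|^2 = d (1 + |\<mu> (x-x0)|^2). The resulting factor d^(-\<nu>/2)
    and the d^(\<nu>/4) contained in L combine to d^(-\<nu>/4) = \<mu>^(\<nu>/2).\<close>
  define \<mu> where "\<mu> = d powr - (1 / 2)"
  have "u x = \<mu> powr (\<nu> / 2) * (A powr (\<nu> / (2 * e)) * (1 / (1 + (norm (\<mu> *\<^sub>R (x - x0)))\<^sup>2)) powr (\<nu> / 2))" for x
  proof -
    let ?r = "(norm (x - x0))\<^sup>2"
    have dr: "d + ?r > 0" using d by (simp add: add_pos_nonneg)
    have "\<mu>\<^sup>2 = d powr (- (1 / 2) + - (1 / 2))" unfolding \<mu>_def power2_eq_square powr_add by simp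
    then have "\<mu>\<^sup>2 = 1 / d" using d by (simp add: powr_neg_one)
    then have "1 + (norm (\<mu> *\<^sub>R (x - x0)))\<^sup>2 = (d + ?r) / d" using d by (simp add: power_mult_distrib add_divide_distrib)
    then have "(1 / (1 + (norm (\<mu> *\<^sub>R (x - x0)))\<^sup>2)) powr (\<nu> / 2) = d powr (\<nu> / 2) * (d + ?r) powr - (\<nu> / 2)"
      using d dr by (simp add: powr_divide powr_minus_divide)
    moreover have "\<mu> powr (\<nu> / 2) * d powr (\<nu> / 2) = d powr (\<nu> / 4)"
      unfolding \<mu>_def powr_powr powr_add[symmetric] by (rule arg_cong[where f="\<lambda>e. d powr e"]) simp
    ultimately have "\<mu> powr (\<nu> / 2) * (A powr (\<nu> / (2 * e)) * (1 / (1 + (norm (\<mu> *\<^sub>R (x - x0)))\<^sup>2)) powr (\<nu> / 2))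
      = A powr (\<nu> / (2 * e)) * d powr (\<nu> / 4) * (d + ?r) powr - (\<nu> / 2)" by (simp add: mult_ac)
    then have shape: "\<mu> powr (\<nu> / 2) * (A powr (\<nu> / (2 * e)) * (1 / (1 + (norm (\<mu> *\<^sub>R (x - x0)))\<^sup>2)) powr (\<nu> / 2))
      = L * (d + ?r) powr - (\<nu> / 2)" by (simp only: L'[symmetric])
    show ?thesis by (rule trans[OF u shape[symmetric]])
  qed
  moreover have "\<mu> > 0" using d by (simp add: \<mu>_def)
  ultimately show ?thesis unfolding A_def e_def by blast
qed

end

section \<open>From nonnegative to positive solutions\<close>

lemma riesz_potential_pos:
  fixes f :: "'a::euclidean_space \<Rightarrow> ennreal"
  assumes [measurable]: "f \<in> borel_measurable borel" and "\<epsilon> > 0" "\<And>y. y \<in> ball b \<epsilon> \<Longrightarrow> f y > 0"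
  shows "riesz_potential \<gamma> f x > 0"
proof (rule ccontr)
  assume "\<not> ?thesis"
  then have "(\<integral>\<^sup>+y. ennreal (norm (x - y) powr - \<gamma>) * f y \<partial>lborel) = 0" by (simp add: riesz_potential_def)
  then have "AE y in lborel. ennreal (norm (x - y) powr - \<gamma>) * f y = 0"
    by (subst (asm) nn_integral_0_iff_AE) auto
  then have "AE y in lborel. f y = 0"
    using AE_lborel_singleton[of x] by eventually_elim auto
  then obtain y where "y \<in> ball b \<epsilon>" "f y = 0" using AE_lborel_ex_ball \<open>\<epsilon> > 0\<close> by blast
  then show False using assms(3)[of y] by simp
qed

text \<open>Quotients become negative powers and the constant leaves the outer integral. The two
  forms of the kernels agree even at coinciding points, where both are 0.\<close>

lemma hartree_integral_solution_riesz:
  fixes u :: "real ^ 'n::finite \<Rightarrow> real"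
  assumes [measurable]: "u \<in> borel_measurable borel" and K: "riesz_const (2 * s) CARD('n) > 0"
    and sol: "hartree_integral_solution s \<sigma> p q u"
  shows "ennreal (u x) = ennreal (riesz_const (2 * s) CARD('n)) * riesz_potential (real CARD('n) - 2 * s)
    (\<lambda>y. riesz_potential \<sigma> (\<lambda>z. ennreal (u z powr p)) y * ennreal (u y powr q)) x"
proof -
  let ?K = "riesz_const (2 * s) CARD('n)" and ?\<nu> = "real CARD('n) - 2 * s"
  have inner: "(\<integral>\<^sup>+z. ennreal (1 / norm (y - z) powr \<sigma> * u z powr p) \<partial>lborel)
    = riesz_potential \<sigma> (\<lambda>z. ennreal (u z powr p)) y" for y
    unfolding riesz_potential_def by (simp add: powr_minus_divide ennreal_mult'[symmetric])
  have "ennreal (u x) = (\<integral>\<^sup>+y. ennreal (?K / norm (x - y) powr ?\<nu>)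
    * riesz_potential \<sigma> (\<lambda>z. ennreal (u z powr p)) y * ennreal (u y powr q) \<partial>lborel)"
    using sol unfolding hartree_integral_solution_def inner by (rule spec)
  also have "\<dots> = (\<integral>\<^sup>+y. ennreal ?K * (ennreal (norm (x - y) powr - ?\<nu>)
    * (riesz_potential \<sigma> (\<lambda>z. ennreal (u z powr p)) y * ennreal (u y powr q))) \<partial>lborel)"
  proof (rule nn_integral_cong)
    fix y
    have "?K / norm (x - y) powr ?\<nu> = ?K * norm (x - y) powr - ?\<nu>"
      by (simp only: powr_minus divide_inverse)
    then show "ennreal (?K / norm (x - y) powr ?\<nu>)
        * riesz_potential \<sigma> (\<lambda>z. ennreal (u z powr p)) y * ennreal (u y powr q)
      = ennreal ?K * (ennreal (norm (x - y) powr - ?\<nu>)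
        * (riesz_potential \<sigma> (\<lambda>z. ennreal (u z powr p)) y * ennreal (u y powr q)))"
      using K by (simp only: ennreal_mult' less_imp_le mult.assoc)
  qed
  also have "\<dots> = ennreal ?K * riesz_potential ?\<nu>
    (\<lambda>y. riesz_potential \<sigma> (\<lambda>z. ennreal (u z powr p)) y * ennreal (u y powr q)) x"
    unfolding riesz_potential_def[of ?\<nu>] by (rule nn_integral_cmult) measurable
  finally show ?thesis .
qed

text \<open>If u is positive near one point, the inner potential is positive everywhere, hence so is
  the outer one, and the equation makes u positive everywhere.\<close>

lemma hartree_integral_solution_cases:
  fixes u :: "real ^ 'n::finite \<Rightarrow> real"
  assumes s: "0 < s" "2 * s < real CARD('n)" and \<sigma>: "0 < \<sigma>" "\<sigma> < real CARD('n)"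
    and p: "0 < p" "p \<le> (2 * real CARD('n) - \<sigma>) / (real CARD('n) - 2 * s)"
    and q: "0 < q" "q \<le> (real CARD('n) + 2 * s - \<sigma>) / (real CARD('n) - 2 * s)"
    and cont: "continuous_on UNIV u" and nonneg: "\<And>x. 0 \<le> u x"
    and sol: "hartree_integral_solution s \<sigma> p q u"
  shows "(\<forall>x. u x = 0) \<or> hartree u (real CARD('n) - 2 * s) \<sigma> p q (riesz_const (2 * s) CARD('n))"
proof (rule disjCI)
  let ?K = "riesz_const (2 * s) CARD('n)" and ?\<nu> = "real CARD('n) - 2 * s"
  assume "\<not> hartree u ?\<nu> \<sigma> p q ?K"
  have meas [measurable]: "u \<in> borel_measurable borel" using cont by (rule borel_measurable_continuous_onI)
  have K: "?K > 0"
    unfolding riesz_const_def using s by (intro divide_pos_pos mult_pos_pos Gamma_real_pos) auto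
  note eq = hartree_integral_solution_riesz[OF meas K sol]
  show "\<forall>x. u x = 0"
  proof (rule ccontr)
    assume "\<not> (\<forall>x. u x = 0)"
    then obtain b where "u b > 0" using nonneg by (auto simp: less_le)
    have "isCont u b" using cont by (simp add: continuous_on_eq_continuous_at)
    then have "\<forall>\<^sub>F x in nhds b. u x > 0"
      using \<open>u b > 0\<close> by (intro order_tendstoD(1)[of _ "u b"]) (auto simp: isCont_def tendsto_at_iff_tendsto_nhds)
    then obtain \<epsilon> where \<epsilon>: "\<epsilon> > 0" "\<And>x. x \<in> ball b \<epsilon> \<Longrightarrow> u x > 0"
      by (auto simp: eventually_nhds_metric dist_commute)
    have P: "riesz_potential \<sigma> (\<lambda>z. ennreal (u z powr p)) y > 0" for y
      by (rule riesz_potential_pos[OF _ \<epsilon>(1), of _ b]) (use less_imp_neq[OF \<epsilon>(2)] in \<open>auto simp del: mem_ball\<close>)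
    have "riesz_potential ?\<nu> (\<lambda>y. riesz_potential \<sigma> (\<lambda>z. ennreal (u z powr p)) y * ennreal (u y powr q)) x > 0" for x
      by (rule riesz_potential_pos[OF _ \<epsilon>(1), of _ b])
         (use P less_imp_neq[OF \<epsilon>(2)] in \<open>auto simp: ennreal_zero_less_mult_iff simp del: mem_ball\<close>)
    then have "ennreal (u x) > 0" for x
      unfolding eq using K by (simp only: ennreal_zero_less_mult_iff ennreal_less_zero_iff)
    then have upos: "u x > 0" for x by simp
    have "hartree u ?\<nu> \<sigma> p q ?K"
      by unfold_locales (use s \<sigma> p q cont K upos eq in \<open>auto simp: le_divide_eq\<close>)
    then show False using \<open>\<not> hartree u ?\<nu> \<sigma> p q ?K\<close> by contradiction
  qed
qed

text \<open>Zero really is a solution, by \<open>0 powr a = 0\<close>; this is the converse half of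
  the subcritical equivalence.\<close>

lemma hartree_integral_solution_zero: "hartree_integral_solution s \<sigma> p q (\<lambda>_. 0)"
  by (simp add: hartree_integral_solution_def)

theorem theorem1p4:
  fixes m :: nat and n \<alpha> s \<sigma> p q :: real
  assumes "n = real CARD('n::finite)"
    and "0 < \<alpha>" and "\<alpha> \<le> 2"
    and "s = real m + \<alpha> / 2"
    and "0 < s" and "s < n / 2"
    and "0 < \<sigma>" and "\<sigma> < n"
    and "0 < p" and "p \<le> (2 * n - \<sigma>) / (n - 2 * s)"
    and "0 < q" and "q \<le> (n + 2 * s - \<sigma>) / (n - 2 * s)"
  shows
    "(p = (2 * n - \<sigma>) / (n - 2 * s) \<and> q = (n + 2 * s - \<sigma>) / (n - 2 * s) \<longrightarrow>
       (\<forall>u :: real ^ 'n \<Rightarrow> real.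
         continuous_on UNIV u \<and> (\<forall>x. 0 \<le> u x) \<and> hartree_integral_solution s \<sigma> p q u \<longrightarrow>
         (\<forall>x. u x = 0) \<or>
         (\<exists>\<mu> > 0. \<exists>x\<^sub>0. \<forall>x. u x = \<mu> powr ((n - 2 * s) / 2) * Q_profile s \<sigma> (\<mu> *\<^sub>R (x - x\<^sub>0)))))
     \<and>
     (p < (2 * n - \<sigma>) / (n - 2 * s) \<or> q < (n + 2 * s - \<sigma>) / (n - 2 * s) \<longrightarrow>
       (\<forall>u :: real ^ 'n \<Rightarrow> real.
         continuous_on UNIV u \<and> (\<forall>x. 0 \<le> u x) \<and> hartree_integral_solution s \<sigma> p q u \<longleftrightarrow>
         (\<forall>x. u x = 0)))"
proof (intro conjI impI allI)
  have n: "real DIM(real ^ 'n) = n" using assms(1) by simp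
  have sol_cases: "(\<forall>x. u x = 0) \<or> hartree u (n - 2 * s) \<sigma> p q (riesz_const (2 * s) CARD('n))"
    if "continuous_on UNIV u" "\<forall>x. 0 \<le> u x" "hartree_integral_solution s \<sigma> p q u" for u :: "real ^ 'n \<Rightarrow> real"
    unfolding assms(1) by (rule hartree_integral_solution_cases) (use assms that in auto)
  {
    fix u :: "real ^ 'n \<Rightarrow> real"
    assume u: "continuous_on UNIV u \<and> (\<forall>x. 0 \<le> u x) \<and> hartree_integral_solution s \<sigma> p q u"
    have "\<exists>\<mu>>0. \<exists>x\<^sub>0. \<forall>x. u x = \<mu> powr ((n - 2 * s) / 2) * Q_profile s \<sigma> (\<mu> *\<^sub>R (x - x\<^sub>0))"
      if "hartree u (n - 2 * s) \<sigma> p q (riesz_const (2 * s) CARD('n))"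
    proof -
      \<comment> \<open>With \<nu> = n - 2s this matches the denominator in the exponent of
        \<open>Q_profile\<close>; the constant \<open>bubble_const (\<nu> / 2)\<close> matches as it
        stands.\<close>
      have "2 * real DIM(real ^ 'n) - (n - 2 * s) - \<sigma> = n + 2 * s - \<sigma>" unfolding n by simp
      then show ?thesis
        using hartree.bubble_classification[OF that] assms(1) by (simp add: Q_profile_def)
    qed
    then show "(\<forall>x. u x = 0) \<or> (\<exists>\<mu>>0. \<exists>x\<^sub>0. \<forall>x. u x = \<mu> powr ((n - 2 * s) / 2) * Q_profile s \<sigma> (\<mu> *\<^sub>R (x - x\<^sub>0)))"
      using sol_cases[of u] u by blast
  }
  fix u :: "real ^ 'n \<Rightarrow> real"
  assume sub: "p < (2 * n - \<sigma>) / (n - 2 * s) \<or> q < (n + 2 * s - \<sigma>) / (n - 2 * s)"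
  show "continuous_on UNIV u \<and> (\<forall>x. 0 \<le> u x) \<and> hartree_integral_solution s \<sigma> p q u \<longleftrightarrow> (\<forall>x. u x = 0)"
  proof
    assume u: "continuous_on UNIV u \<and> (\<forall>x. 0 \<le> u x) \<and> hartree_integral_solution s \<sigma> p q u"
    show "\<forall>x. u x = 0"
    proof (rule ccontr)
      assume "\<not> ?thesis"
      then have "hartree u (n - 2 * s) \<sigma> p q (riesz_const (2 * s) CARD('n))" using sol_cases[of u] u by blast
      from hartree.critical[OF this] have "p * (n - 2 * s) = 2 * n - \<sigma>" "q * (n - 2 * s) = n + 2 * s - \<sigma>"
        unfolding n by simp_all
      then show False using sub assms(6) by (auto simp: less_divide_eq)
    qed
  next
    assume "\<forall>x. u x = 0"
    then have "u = (\<lambda>_. 0)" by auto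
    then show "continuous_on UNIV u \<and> (\<forall>x. 0 \<le> u x) \<and> hartree_integral_solution s \<sigma> p q u"
      by (simp add: hartree_integral_solution_zero)
  qed
qed

end
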